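(* Let $d\ge1$ be an integer, $s>0$ with $d>2s$, $T>0$, and let $\psi$ be a Friedrichs mollifier on $\mathbb{R}^d$. Let $a\in L^{d/s}(\mathbb{R}^d)\cap L^{d/(2s)}(\mathbb{R}^d)$ and $b\in L^{d/s}(\mathbb{R}^d)$ be non-negative, $u_0\in H^{2s}(\mathbb{R}^d)$ and $u_1\in H^s(\mathbb{R}^d)$. Let $(a_\varepsilon)_\varepsilon=(a\ast\psi_\varepsilon)_\varepsilon$, $(b_\varepsilon)_\varepsilon=(b\ast\psi_\varepsilon)_\varepsilon$ be regularising families for the coefficients and $(u_{0,\varepsilon})_\varepsilon=(u_0\ast\psi_\varepsilon)_\varepsilon$, $(u_{1,\varepsilon})_\varepsilon=(u_1\ast\psi_\varepsilon)_\varepsilon$ regularising families for the initial data. For $\varepsilon\in(0,1]$ let $u_\varepsilon\in C([0,T];H^{2s}(\mathbb{R}^d))\cap C^1([0,T];H^s(\mathbb{R}^d))$ be the solution of $$\partial_t^2u_\varepsilon+(-\Delta)^su_\varepsilon+a_\varepsilon(x)u_\varepsilon+b_\varepsilon(x)\partial_tu_\varepsilon=0\ \text{on }[0,T]\times\mathbb{R}^d,\quad u_\varepsilon(0,\cdot)=u_{0,\varepsilon},\ \partial_tu_\varepsilon(0,\cdot)=u_{1,\varepsilon},$$ and let $u\in C([0,T];H^{2s}(\mathbb{R}^d))\cap C^1([0,T];H^s(\mathbb{R}^d))$ be the classical solution, i.e. the unique solution in this class of $$u_{tt}+(-\Delta)^su+a(x)u+b(x)u_t=0\ \text{on }[0,T]\times\mathbb{R}^d,\quad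 u(0,\cdot)=u_0,\ u_t(0,\cdot)=u_1.$$ Then, for every $t\in[0,T]$, $u_\varepsilon(t,\cdot)\to u(t,\cdot)$ in $L^2(\mathbb{R}^d)$ as $\varepsilon\to0$.
   Context: A Friedrichs mollifier is a non-negative $\psi\in C_0^\infty(\mathbb{R}^d)$ with $\int_{\mathbb{R}^d}\psi(x)\,dx=1$. The associated mollifying net is $\psi_\varepsilon(x)=\varepsilon^{-d}\psi(x/\varepsilon)$, $\varepsilon\in(0,1]$. The fractional Laplacian is $(-\Delta)^s f=\mathcal{F}^{-1}(|\xi|^{2s}\widehat f)$, and for $\sigma>0$, $H^\sigma(\mathbb{R}^d)=\{f\in L^2(\mathbb{R}^d): (-\Delta)^{\sigma/2}f\in L^2(\mathbb{R}^d)\}$ with norm $\|f\|_{H^\sigma}=\|f\|_{L^2}+\|(-\Delta)^{\sigma/2}f\|_{L^2}$. The equations are understood in the sense of distributions on $(0,T)\times\mathbb{R}^d$. *)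

theory Defs
  imports "HOL-Analysis.Analysis"
begin

section \<open>Lebesgue spaces\<close>

text \<open>Elements of $L^p$ are represented by Borel functions; every equality between such functions
  below is required almost everywhere only.\<close>

definition Lp_space :: "real \<Rightarrow> ('a::euclidean_space \<Rightarrow> 'b::{banach, second_countable_topology}) set"
  where "Lp_space p =
    {f \<in> borel_measurable lborel. integrable lborel (\<lambda>x. norm (f x) powr p)}"

definition Lp_norm :: "real \<Rightarrow> ('a::euclidean_space \<Rightarrow> 'b::{banach, second_countable_topology}) \<Rightarrow> real"
  where "Lp_norm p f = (LINT x|lborel. norm (f x) powr p) powr (1 / p)"

definition tendsto_L2 ::
  "('i \<Rightarrow> 'a::euclidean_space \<Rightarrow> 'b::{banach, second_countable_topology}) \<Rightarrow> ('a \<Rightarrow> 'b) \<Rightarrow> 'i filter \<Rightarrow> bool"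
  where "tendsto_L2 f g F \<longleftrightarrow>
    (\<forall>\<^sub>F i in F. f i \<in> Lp_space 2) \<and> g \<in> Lp_space 2 \<and>
    ((\<lambda>i. Lp_norm 2 (\<lambda>x. f i x - g x)) \<longlongrightarrow> 0) F"


section \<open>Fractional Laplacian and Sobolev spaces\<close>

definition fourier_integral :: "('a::euclidean_space \<Rightarrow> complex) \<Rightarrow> 'a \<Rightarrow> complex"
  where "fourier_integral f \<xi> = (LINT x|lborel. exp (- \<i> * complex_of_real (x \<bullet> \<xi>)) * f x)"

text \<open>The Fourier transform on $L^2$ (Plancherel), a relation because $\hat f$ is determined only
  up to null sets: $\hat f$ is the $L^2$-limit of the transforms of the truncations
  $1_{|x| \le R} f \in L^1 \cap L^2$. The normalisation is the one for which
  $|\xi|^2$ is the symbol of $-\Delta$.\<close>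

definition has_fourier_transform :: "('a::euclidean_space \<Rightarrow> complex) \<Rightarrow> ('a \<Rightarrow> complex) \<Rightarrow> bool"
  where "has_fourier_transform f fhat \<longleftrightarrow>
    f \<in> Lp_space 2 \<and>
    tendsto_L2 (\<lambda>R. fourier_integral (\<lambda>x. indicator (cball 0 R) x *\<^sub>R f x)) fhat at_top"

text \<open>$g = (-\Delta)^s f = \mathcal F^{-1}(|\xi|^{2s} \hat f)$ with $g \in L^2$. As $\mathcal F$ is a
  bijection of $L^2$, the equation $g = \mathcal F^{-1} h$ is expressed as $\mathcal F g = h$.\<close>

definition has_frac_laplacian ::
  "real \<Rightarrow> ('a::euclidean_space \<Rightarrow> complex) \<Rightarrow> ('a \<Rightarrow> complex) \<Rightarrow> bool"
  where "has_frac_laplacian s f g \<longleftrightarrow>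
    (\<exists>fhat. has_fourier_transform f fhat \<and>
      has_fourier_transform g (\<lambda>\<xi>. complex_of_real (norm \<xi> powr (2 * s)) * fhat \<xi>))"

text \<open>A representative of the $L^2$ class $(-\Delta)^s f$; meaningful only if
  $(-\Delta)^s f \in L^2$.\<close>

definition frac_laplacian :: "real \<Rightarrow> ('a::euclidean_space \<Rightarrow> complex) \<Rightarrow> 'a \<Rightarrow> complex"
  where "frac_laplacian s f = (SOME g. has_frac_laplacian s f g)"

definition sobolev_space :: "real \<Rightarrow> ('a::euclidean_space \<Rightarrow> complex) set"
  where "sobolev_space \<sigma> =
    {f \<in> Lp_space 2. \<exists>g \<in> Lp_space 2. has_frac_laplacian (\<sigma> / 2) f g}"

definition sobolev_norm :: "real \<Rightarrow> ('a::euclidean_space \<Rightarrow> complex) \<Rightarrow> real"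
  where "sobolev_norm \<sigma> f = Lp_norm 2 f + Lp_norm 2 (frac_laplacian (\<sigma> / 2) f)"


section \<open>Test functions and mollifiers\<close>

fun Ck :: "nat \<Rightarrow> ('a::real_normed_vector \<Rightarrow> 'b::real_normed_vector) \<Rightarrow> bool"
  where
    "Ck 0 f \<longleftrightarrow> continuous_on UNIV f"
  | "Ck (Suc k) f \<longleftrightarrow>
      (\<forall>x. f differentiable (at x)) \<and> (\<forall>v. Ck k (\<lambda>x. frechet_derivative f (at x) v))"

definition test_function :: "'a set \<Rightarrow> ('a::euclidean_space \<Rightarrow> 'b::real_normed_vector) \<Rightarrow> bool"
  where "test_function \<Omega> \<phi> \<longleftrightarrow>
    (\<forall>k. Ck k \<phi>) \<and> compact (closure {x. \<phi> x \<noteq> 0}) \<and> closure {x. \<phi> x \<noteq> 0} \<subseteq> \<Omega>"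

definition friedrichs_mollifier :: "('a::euclidean_space \<Rightarrow> real) \<Rightarrow> bool"
  where "friedrichs_mollifier \<psi> \<longleftrightarrow>
    test_function UNIV \<psi> \<and> (\<forall>x. 0 \<le> \<psi> x) \<and> (LINT x|lborel. \<psi> x) = 1"

definition mollifying_net :: "('a::euclidean_space \<Rightarrow> real) \<Rightarrow> real \<Rightarrow> 'a \<Rightarrow> real"
  where "mollifying_net \<psi> \<epsilon> x = \<psi> (x /\<^sub>R \<epsilon>) / \<epsilon> ^ DIM('a)"

definition convolution ::
  "('a::euclidean_space \<Rightarrow> 'b::{banach, second_countable_topology}) \<Rightarrow> ('a \<Rightarrow> real) \<Rightarrow> 'a \<Rightarrow> 'b"
  where "convolution f \<psi> x = (LINT y|lborel. \<psi> (x - y) *\<^sub>R f y)"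


section \<open>Solutions of the damped wave equation\<close>

text \<open>A function of time and space is curried, $t \mapsto u(t,\cdot)$. Only times in $[0,T]$ matter.\<close>

definition continuous_in_sobolev ::
  "real \<Rightarrow> real \<Rightarrow> (real \<Rightarrow> 'a::euclidean_space \<Rightarrow> complex) \<Rightarrow> bool"
  where "continuous_in_sobolev \<sigma> T u \<longleftrightarrow>
    (\<forall>t\<in>{0..T}. u t \<in> sobolev_space \<sigma>) \<and>
    (\<forall>t\<in>{0..T}. ((\<lambda>\<tau>. sobolev_norm \<sigma> (\<lambda>x. u \<tau> x - u t x)) \<longlongrightarrow> 0) (at t within {0..T}))"

text \<open>$u \in C^1([0,T]; H^\sigma)$ with $\partial_t u = v$ (difference quotients converge in
  $H^\sigma$; one-sided at the end points).\<close>

definition C1_in_sobolev ::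
  "real \<Rightarrow> real \<Rightarrow> (real \<Rightarrow> 'a::euclidean_space \<Rightarrow> complex) \<Rightarrow> (real \<Rightarrow> 'a \<Rightarrow> complex) \<Rightarrow> bool"
  where "C1_in_sobolev \<sigma> T u v \<longleftrightarrow>
    continuous_in_sobolev \<sigma> T u \<and> continuous_in_sobolev \<sigma> T v \<and>
    (\<forall>t\<in>{0..T}. ((\<lambda>\<tau>. sobolev_norm \<sigma> (\<lambda>x. (u \<tau> x - u t x) /\<^sub>R (\<tau> - t) - v t x)) \<longlongrightarrow> 0)
      (at t within {0..T}))"

text \<open>The action on a test function $\phi$ of the distribution on $(0,T) \times \mathbb R^d$ given by
  $t \mapsto g(t,\cdot)$. The integral is iterated, so that it depends only on the class of
  each $g(t,\cdot)$ and needs no jointly measurable representative.\<close>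

definition dist_pairing ::
  "real \<Rightarrow> (real \<Rightarrow> 'a::euclidean_space \<Rightarrow> complex) \<Rightarrow> (real \<times> 'a \<Rightarrow> complex) \<Rightarrow> complex"
  where "dist_pairing T g \<phi> = (LINT t:{0<..<T}|lborel. (LINT x|lborel. g t x * \<phi> (t, x)))"

definition time_derivative ::
  "(real \<times> 'a \<Rightarrow> complex) \<Rightarrow> real \<times> 'a \<Rightarrow> complex"
  where "time_derivative \<phi> = (\<lambda>(t, x). vector_derivative (\<lambda>\<tau>. \<phi> (\<tau>, x)) (at t))"

text \<open>$u \in C([0,T]; H^{2s}) \cap C^1([0,T]; H^s)$ solves
  $\partial_t^2 u + (-\Delta)^s u + a u + b \partial_t u = 0$, $u(0) = u_0$, $\partial_t u(0) = u_1$,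
  the equation holding in the sense of distributions on $(0,T) \times \mathbb R^d$.
  The function $v$ is $\partial_t u$.\<close>

definition wave_solution ::
  "real \<Rightarrow> real \<Rightarrow> ('a::euclidean_space \<Rightarrow> real) \<Rightarrow> ('a \<Rightarrow> real) \<Rightarrow>
   ('a \<Rightarrow> complex) \<Rightarrow> ('a \<Rightarrow> complex) \<Rightarrow> (real \<Rightarrow> 'a \<Rightarrow> complex) \<Rightarrow> bool"
  where "wave_solution s T a b u0 u1 u \<longleftrightarrow>
    continuous_in_sobolev (2 * s) T u \<and>
    (\<exists>v. C1_in_sobolev s T u v \<and>
      (\<forall>\<phi>. test_function ({0<..<T} \<times> UNIV) \<phi> \<longrightarrow>
        dist_pairing T u (time_derivative (time_derivative \<phi>))
        + dist_pairing T (\<lambda>t. frac_laplacian s (u t)) \<phi>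
        + dist_pairing T (\<lambda>t x. a x *\<^sub>R u t x) \<phi>
        + dist_pairing T (\<lambda>t x. b x *\<^sub>R v t x) \<phi> = 0) \<and>
      (AE x in lborel. u 0 x = u0 x) \<and>
      (AE x in lborel. v 0 x = u1 x))"

end

theory Submission imports Defs "HOL-Probability.Probability" begin

text \<open>The difference $w = u_\varepsilon - u$ solves the regularised equation
  \[ w_{tt} + (-\Delta)^s w + a_\varepsilon w + b_\varepsilon w_t = (a - a_\varepsilon) u + (b - b_\varepsilon) u_t, \]
  whose right-hand side contains only the fixed solution \<open>u\<close>. Because $a_\varepsilon$ and $b_\varepsilon$ are
  non-negative, the energy
  $\|w_t\|^2 + \|(-\Delta)^{s/2} w\|^2 + \langle a_\varepsilon w, w\rangle$ grows only through this forcing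
  (\<open>energy_estimate\<close>, applied in \<open>wave_stability\<close>). It remains to see that the forcing and the energy at time
  zero tend to zero.

  For the forcing, multiplication by a coefficient in $L^{d/s}$ maps $H^s$ to $L^2$ with a norm bounded by a
  multiple of the $L^{d/s}$ norm of the coefficient (\<open>multiplication_bound\<close>): this is Hoelder's inequality
  together with the embedding of $H^s$ into $L^{2d/(d-2s)}$ (\<open>sobolev_inequality\<close>). As mollifications
  converge in $L^{d/s}$ (\<open>convolution_tendsto_Lp\<close>), the forcing tends to zero uniformly in time.
  For the initial energy, mollification is a Fourier multiplier and commutes with the fractional Laplacian
  (\<open>has_frac_laplacian_convolution\<close>), so that $(-\Delta)^{s/2} u_{0,\varepsilon}$ is the mollification of
  $(-\Delta)^{s/2} u_0$ and converges to it in $L^2$.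

  The energy argument needs a classical equation, whereas solutions are distributional. Tested with products
  $\theta(t)\,\psi_\delta(y - x)$, the equation becomes a scalar weak equation in time, which integrates to an
  identity without derivatives of test functions (\<open>weak_second_derivative\<close>). All $\psi_\delta(y - \cdot)$
  together determine an element of $L^2$, and therefore $u_t$ is a continuously differentiable curve in the
  Hilbert space $L^2$ that satisfies the equation at every time (\<open>wave_solution_curve\<close>).

  The Fourier transform enters through Plancherel's identity, proved on $L^1 \cap L^2$ with a Gaussian cutoff in
  frequency (\<open>plancherel_regularised\<close>) and extended by density (\<open>has_ft_norm\<close>). The Sobolev inequality is
  obtained from it by duality: pairing with the phase of a function on a level set bounds the size of the
  level set through inner products of transforms.\<close>

(* "convolution" denotes the convolution of functions throughout, not that of measures. *)
hide_const (open) Convolution.convolution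
hide_fact (open) Convolution.convolution_def

section \<open>Affine substitutions in Lebesgue integrals\<close>

lemma lborel_eq_density_affine:
  fixes t :: "'a::euclidean_space"
  assumes "c \<noteq> 0"
  shows "lborel = density (distr lborel borel (\<lambda>x. t + c *\<^sub>R x)) (\<lambda>_. ennreal (\<bar>c\<bar> ^ DIM('a)))"
  using lborel_affine[OF assms, of t] by (simp add: prod_constant)

lemma nn_integral_lborel_affine:
  fixes t :: "'a::euclidean_space" and f :: "'a \<Rightarrow> ennreal"
  assumes "c \<noteq> 0" and [measurable]: "f \<in> borel_measurable borel"
  shows "(\<integral>\<^sup>+x. f x \<partial>lborel) = ennreal (\<bar>c\<bar> ^ DIM('a)) * (\<integral>\<^sup>+x. f (t + c *\<^sub>R x) \<partial>lborel)"
  by (subst lborel_eq_density_affine[OF assms(1), of t])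
     (simp add: nn_integral_density nn_integral_distr nn_integral_cmult)

lemma integral_lborel_affine:
  fixes t :: "'a::euclidean_space" and g :: "'a \<Rightarrow> 'b::{banach, second_countable_topology}"
  assumes "c \<noteq> 0" and [measurable]: "g \<in> borel_measurable borel"
  shows "(LINT x|lborel. g x) = \<bar>c\<bar> ^ DIM('a) *\<^sub>R (LINT x|lborel. g (t + c *\<^sub>R x))"
  by (subst lborel_eq_density_affine[OF assms(1), of t]) (simp add: integral_density integral_distr)

lemma nn_integral_lborel_translate:
  fixes f :: "'a::euclidean_space \<Rightarrow> ennreal"
  assumes "f \<in> borel_measurable borel"
  shows "(\<integral>\<^sup>+x. f (x - h) \<partial>lborel) = (\<integral>\<^sup>+x. f x \<partial>lborel)"
  using nn_integral_lborel_affine[of 1 f "-h"] assms by simp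

lemma integral_lborel_translate:
  fixes f :: "'a::euclidean_space \<Rightarrow> 'b::{banach, second_countable_topology}"
  assumes "f \<in> borel_measurable borel"
  shows "(LINT x|lborel. f (x - h)) = (LINT x|lborel. f x)"
  using integral_lborel_affine[of 1 f "-h"] assms by simp

lemma integrable_lborel_translate:
  fixes f :: "'a::euclidean_space \<Rightarrow> 'b::{banach, second_countable_topology}"
  assumes "integrable lborel f"
  shows "integrable lborel (\<lambda>x. f (x - h))"
proof -
  have [measurable]: "f \<in> borel_measurable borel" using assms by auto
  show ?thesis
    using assms nn_integral_lborel_translate[of "\<lambda>x. ennreal (norm (f x))" h]
    by (simp add: integrable_iff_bounded)
qed

section \<open>Continuity of translations\<close>

lemma translation_L1_bound:
  fixes f :: "'a::euclidean_space \<Rightarrow> 'b::{banach, second_countable_topology}"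
  assumes f: "integrable lborel f"
  shows "(LINT x|lborel. norm (f (x - h) - f x)) \<le> 2 * (LINT x|lborel. norm (f x))"
proof -
  note fh = integrable_lborel_translate[OF f, of h]
  have "(LINT x|lborel. norm (f (x - h) - f x)) \<le> (LINT x|lborel. norm (f (x - h)) + norm (f x))"
    by (intro integral_mono Bochner_Integration.integrable_add integrable_norm
        Bochner_Integration.integrable_diff f fh norm_triangle_ineq4)
  also have "\<dots> = 2 * (LINT x|lborel. norm (f x))"
    using f fh integral_lborel_translate[of "\<lambda>x. norm (f x)" h] by simp
  finally show ?thesis .
qed

text \<open>Translations are $L^1$ isometries, so functions with vanishing $L^1$ modulus of continuity form a closed set;
  the lemma carries the property from indicators of open sets to all integrable functions.\<close>

lemma translation_L1_approx:
  fixes f :: "'a::euclidean_space \<Rightarrow> 'b::{banach, second_countable_topology}"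
  assumes f: "integrable lborel f"
    and approx: "\<And>e. e > 0 \<Longrightarrow> \<exists>g. integrable lborel g \<and> (LINT x|lborel. norm (f x - g x)) < e \<and>
      ((\<lambda>h. LINT x|lborel. norm (g (x - h) - g x)) \<longlongrightarrow> 0) (at 0)"
  shows "((\<lambda>h. LINT x|lborel. norm (f (x - h) - f x)) \<longlongrightarrow> 0) (at 0)"
proof (rule tendstoI)
  fix e :: real assume "e > 0"
  then obtain g where g: "integrable lborel g" and gf: "(LINT x|lborel. norm (f x - g x)) < e / 3"
    and lim: "((\<lambda>h. LINT x|lborel. norm (g (x - h) - g x)) \<longlongrightarrow> 0) (at 0)"
    using approx[of "e/3"] by auto
  have ev: "\<forall>\<^sub>F h in at 0. (LINT x|lborel. norm (g (x - h) - g x)) < e / 3"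
    using tendstoD[OF lim, of "e/3"] \<open>e > 0\<close> by (auto elim!: eventually_mono)
  have bound: "(LINT x|lborel. norm (f (x - h) - f x)) \<le>
      (LINT x|lborel. norm (g (x - h) - g x)) + 2 * (LINT x|lborel. norm (f x - g x))" for h
  proof -
    have d: "integrable lborel (\<lambda>x. f x - g x)" using f g by auto
    note fh = integrable_lborel_translate[OF f, of h] and gh = integrable_lborel_translate[OF g, of h]
    have "(LINT x|lborel. norm (f (x - h) - f x)) \<le> (LINT x|lborel. norm (g (x - h) - g x) +
        norm ((f (x - h) - g (x - h)) - (f x - g x)))"
      apply (intro integral_mono Bochner_Integration.integrable_add integrable_norm
        Bochner_Integration.integrable_diff f fh g gh)
      using norm_triangle_ineq[of "g (x - h) - g x" "(f (x - h) - g (x - h)) - (f x - g x)" for x]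
      by (simp add: algebra_simps)
    also have "\<dots> = (LINT x|lborel. norm (g (x - h) - g x)) +
        (LINT x|lborel. norm ((f (x - h) - g (x - h)) - (f x - g x)))"
      by (intro Bochner_Integration.integral_add integrable_norm Bochner_Integration.integrable_diff f fh g gh)
    also have "\<dots> \<le> (LINT x|lborel. norm (g (x - h) - g x)) + 2 * (LINT x|lborel. norm (f x - g x))"
      using translation_L1_bound[OF d, of h] by simp
    finally show ?thesis .
  qed
  show "\<forall>\<^sub>F h in at 0. dist (LINT x|lborel. norm (f (x - h) - f x)) 0 < e"
    using ev
  proof eventually_elim
    case (elim h)
    have "0 \<le> (LINT x|lborel. norm (f (x - h) - f x))" by simp
    then show ?case using bound[of h] gf elim by (simp add: dist_real_def)
  qed
qed

text \<open>Outer regularity reduces the claim to an open set, where dominated convergence applies directly.\<close>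

lemma indicator_translate_continuous:
  fixes A :: "'a::euclidean_space set"
  assumes A: "A \<in> sets borel" "emeasure lborel A < \<infinity>"
  shows "((\<lambda>h. LINT x|lborel. norm ((indicator A (x - h) :: real) - indicator A x)) \<longlongrightarrow> 0) (at 0)"
proof (rule translation_L1_approx)
  show "integrable lborel (indicator A :: 'a \<Rightarrow> real)" using A by simp
  fix e :: real assume e: "e > 0"
  obtain U where U: "open U" "A \<subseteq> U" "emeasure lborel (U - A) < ennreal e"
    using outer_regular_lborel[OF A(1) e] by auto
  have fU: "emeasure lborel U < \<infinity>"
  proof -
    have "emeasure lborel U \<le> emeasure lborel A + emeasure lborel (U - A)"
      by (rule order_trans[OF emeasure_mono emeasure_subadditive]) (use U A in auto)
    also have "emeasure lborel (U - A) < \<infinity>" by (rule less_trans[OF U(3)]) simp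
    then have "emeasure lborel A + emeasure lborel (U - A) < \<infinity>" using A(2) by simp
    finally show ?thesis .
  qed
  have iU: "integrable lborel (indicator U :: 'a \<Rightarrow> real)" using U fU by simp
  have bU: "U \<in> sets borel" using U by simp
  \<comment> \<open>For open \<open>U\<close> and every \<open>x\<close> the product of \<open>1\<^sub>U x\<close> with \<open>1\<^sub>U (x - h)\<close> tends to \<open>1\<^sub>U x\<close>,
    because an open set contains a neighbourhood of each of its points.\<close>
  have "((\<lambda>h. LINT x|lborel. norm ((indicator U (x - h) :: real) - indicator U x)) \<longlongrightarrow> 0) (at 0)"
    unfolding tendsto_at_iff_sequentially comp_def
  proof (intro allI impI)
    fix X :: "nat \<Rightarrow> 'a" assume X: "X \<longlonglongrightarrow> 0"
    have tr: "integrable lborel (\<lambda>x. indicator U (x - X n) :: real)" for n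
      by (rule integrable_lborel_translate[OF iU])
    have pr: "integrable lborel (\<lambda>x. indicator U x * indicator U (x - X n) :: real)" for n
      by (rule Bochner_Integration.integrable_bound[OF iU]) (use tr[of n] iU in \<open>auto split: split_indicator\<close>)
    have eq: "(LINT x|lborel. norm ((indicator U (x - X n) :: real) - indicator U x)) =
        2 * measure lborel U - 2 * (LINT x|lborel. indicator U x * indicator U (x - X n) :: real)" for n
    proof -
      have "(LINT x|lborel. norm ((indicator U (x - X n) :: real) - indicator U x)) =
         (LINT x|lborel. indicator U (x - X n) + indicator U x - 2 * (indicator U x * indicator U (x - X n)) :: real)"
        by (intro Bochner_Integration.integral_cong) (auto split: split_indicator)
      also have "\<dots> = (LINT x|lborel. indicator U (x - X n) :: real) + (LINT x|lborel. indicator U x :: real)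
          - 2 * (LINT x|lborel. indicator U x * indicator U (x - X n) :: real)"
        using tr[of n] iU pr[of n] by simp
      also have "(LINT x|lborel. indicator U (x - X n) :: real) = (LINT x|lborel. indicator U x :: real)"
        by (rule integral_lborel_translate) (use bU in simp)
      finally show ?thesis using bU by simp
    qed
    have "(\<lambda>n. LINT x|lborel. indicator U x * indicator U (x - X n) :: real) \<longlonglongrightarrow> (LINT x|lborel. indicator U x :: real)"
    proof (rule integral_dominated_convergence[where w="indicator U"])
      show "AE x in lborel. (\<lambda>n. indicator U x * indicator U (x - X n) :: real) \<longlonglongrightarrow> indicator U x"
      proof (rule AE_I2)
        fix x :: 'a
        show "(\<lambda>n. indicator U x * indicator U (x - X n) :: real) \<longlonglongrightarrow> indicator U x"
        proof (cases "x \<in> U")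
          case True
          have "(\<lambda>n. x - X n) \<longlonglongrightarrow> x - 0" by (intro tendsto_intros X)
          then have "\<forall>\<^sub>F n in sequentially. x - X n \<in> U"
            using topological_tendstoD[of _ x _ U] U(1) True by simp
          then have "\<forall>\<^sub>F n in sequentially. indicator U x * indicator U (x - X n) = (indicator U x :: real)"
            by eventually_elim (simp add: True)
          then show ?thesis by (rule tendsto_eventually)
        qed simp
      qed
    qed (use iU bU pr in \<open>auto split: split_indicator intro: borel_measurable_integrable\<close>)
    then have "(\<lambda>n. 2 * measure lborel U - 2 * (LINT x|lborel. indicator U x * indicator U (x - X n) :: real))
        \<longlonglongrightarrow> 2 * measure lborel U - 2 * measure lborel U"
      using bU by (intro tendsto_intros) simp_all
    then show "(\<lambda>n. LINT x|lborel. norm ((indicator U (x - X n) :: real) - indicator U x)) \<longlonglongrightarrow> 0"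
      unfolding eq by simp
  qed
  moreover have "(LINT x|lborel. norm (indicator A x - (indicator U x :: real))) < e"
  proof -
    have "(LINT x|lborel. norm (indicator A x - (indicator U x :: real))) = (LINT x|lborel. indicator (U - A) x)"
      using U(2) by (intro Bochner_Integration.integral_cong) (auto split: split_indicator)
    also have "\<dots> = measure lborel (U - A)" using bU A by simp
    also have "\<dots> < e" using U(3) e by (metis emeasure_eq_ennreal_measure ennreal_less_iff
        ennreal_less_top measure_nonneg not_less_iff_gr_or_eq)
    finally show ?thesis .
  qed
  ultimately show "\<exists>g. integrable lborel g \<and> (LINT x|lborel. norm (indicator A x - (g x :: real))) < e \<and>
      ((\<lambda>h. LINT x|lborel. norm (g (x - h) - g x)) \<longlongrightarrow> 0) (at 0)"
    using iU by blast
qed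

lemma translation_L1_continuous:
  fixes f :: "'a::euclidean_space \<Rightarrow> 'b::{banach, second_countable_topology}"
  assumes "integrable lborel f"
  shows "((\<lambda>h. LINT x|lborel. norm (f (x - h) - f x)) \<longlongrightarrow> 0) (at 0)"
  using assms
proof (induct rule: integrable_induct)
  case (base A c)
  have "(LINT x|lborel. norm (indicator A (x - h) *\<^sub>R c - indicator A x *\<^sub>R c)) =
      norm c * (LINT x|lborel. norm ((indicator A (x - h) :: real) - indicator A x))" for h
    unfolding scaleR_diff_left[symmetric] norm_scaleR by simp
  then show ?case
    using tendsto_mult[OF tendsto_const[of "norm c"] indicator_translate_continuous[of A]] base by simp
next
  case (add f g)
  have "((\<lambda>h. (LINT x|lborel. norm (f (x - h) - f x)) + (LINT x|lborel. norm (g (x - h) - g x))) \<longlongrightarrow> 0) (at 0)"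
    using tendsto_add[OF add(2) add(4)] by simp
  then show ?case
  proof (rule tendsto_sandwich[OF _ _ tendsto_const, rotated 2])
    note int = add(1) add(3) integrable_lborel_translate[OF add(1)] integrable_lborel_translate[OF add(3)]
    have "(LINT x|lborel. norm (f (x - h) + g (x - h) - (f x + g x))) \<le>
       (LINT x|lborel. norm (f (x - h) - f x) + norm (g (x - h) - g x))" for h
      by (intro integral_mono Bochner_Integration.integrable_add integrable_norm
        Bochner_Integration.integrable_diff int) (metis add_diff_add norm_triangle_ineq)
    also have "\<dots> h = (LINT x|lborel. norm (f (x - h) - f x)) + (LINT x|lborel. norm (g (x - h) - g x))" for h
      by (intro Bochner_Integration.integral_add integrable_norm Bochner_Integration.integrable_diff int)
    finally show "\<forall>\<^sub>F h in at 0. (LINT x|lborel. norm (f (x - h) + g (x - h) - (f x + g x))) \<le>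
      (LINT x|lborel. norm (f (x - h) - f x)) + (LINT x|lborel. norm (g (x - h) - g x))"
      by (intro always_eventually allI)
  qed simp
next
  case (lim f S)
  show ?case
  proof (rule translation_L1_approx[OF lim(5)])
    fix e :: real assume e: "e > 0"
    have "(\<lambda>n. LINT x|lborel. norm (f x - S n x)) \<longlonglongrightarrow> (LINT x|(lborel :: 'a measure). (0::real))"
    proof (rule integral_dominated_convergence[where w="\<lambda>x. 3 * norm (f x)"])
      show "AE x in lborel. (\<lambda>n. norm (f x - S n x)) \<longlonglongrightarrow> 0"
        using lim(3) by (intro AE_I2 tendsto_norm_zero) (auto intro!: tendsto_eq_intros)
      show "AE x in lborel. norm (norm (f x - S n x)) \<le> 3 * norm (f x)" for n
      proof (rule AE_I2)
        fix x :: 'a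
        have "norm (f x - S n x) \<le> norm (f x) + norm (S n x)" by (rule norm_triangle_ineq4)
        also have "norm (S n x) \<le> 2 * norm (f x)" using lim(4)[of x n] by simp
        finally show "norm (norm (f x - S n x)) \<le> 3 * norm (f x)" by simp
      qed
    qed (use lim in \<open>auto simp: borel_measurable_integrable\<close>)
    then have "\<forall>\<^sub>F n in sequentially. (LINT x|lborel. norm (f x - S n x)) < e"
      using e by (simp add: order_tendsto_iff)
    then obtain n where "(LINT x|lborel. norm (f x - S n x)) < e"
      by (meson eventually_sequentially order_refl)
    with lim(1,2) show "\<exists>g. integrable lborel g \<and> (LINT x|lborel. norm (f x - g x)) < e \<and>
      ((\<lambda>h. LINT x|lborel. norm (g (x - h) - g x)) \<longlongrightarrow> 0) (at 0)"
      by blast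
  qed
qed

text \<open>Together with \<open>norm_diff_powr_le\<close>, a form of the triangle inequality for the $p$-th power of the $L^p$ norm
  that holds pointwise.\<close>

lemma powr_add_le:
  fixes a b p :: real
  assumes "0 \<le> a" "0 \<le> b" "0 \<le> p"
  shows "(a + b) powr p \<le> 2 powr p * (a powr p + b powr p)"
proof -
  have "(a + b) powr p \<le> (2 * max a b) powr p" using assms by (intro powr_mono2) auto
  also have "\<dots> = 2 powr p * max a b powr p" using assms by (simp add: powr_mult)
  also have "max a b powr p \<le> a powr p + b powr p" by (simp add: max_def)
  finally show ?thesis by simp
qed

lemma norm_diff_powr_le:
  assumes "0 \<le> p"
  shows "norm (a - b) powr p \<le> 2 powr p * (norm a powr p + norm b powr p)"
proof -
  have "norm (a - b) powr p \<le> (norm a + norm b) powr p"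
    using assms by (intro powr_mono2 norm_triangle_ineq4) auto
  also have "\<dots> \<le> 2 powr p * (norm a powr p + norm b powr p)"
    using assms by (intro powr_add_le) auto
  finally show ?thesis .
qed

lemma Lp_space_measurable: "f \<in> Lp_space p \<Longrightarrow> f \<in> borel_measurable borel"
  by (simp add: Lp_space_def)

lemma Lp_space_integrable: "f \<in> Lp_space p \<Longrightarrow> integrable lborel (\<lambda>x. norm (f x) powr p)"
  by (simp add: Lp_space_def)

lemma Lp_space_diff:
  assumes "0 \<le> p" and f: "f \<in> Lp_space p" and g: "g \<in> Lp_space p"
  shows "(\<lambda>x. f x - g x) \<in> Lp_space p"
proof -
  note [measurable] = Lp_space_measurable[OF f] Lp_space_measurable[OF g]
  have "integrable lborel (\<lambda>x. 2 powr p * (norm (f x) powr p + norm (g x) powr p))"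
    using Lp_space_integrable[OF f] Lp_space_integrable[OF g] by simp
  then have "integrable lborel (\<lambda>x. norm (f x - g x) powr p)"
    by (rule Bochner_Integration.integrable_bound)
       (use norm_diff_powr_le[OF assms(1)] in \<open>auto simp: intro!: AE_I2\<close>)
  then show ?thesis by (simp add: Lp_space_def)
qed

lemma Lp_space_scaleR:
  assumes "f \<in> Lp_space p"
  shows "(\<lambda>x. c *\<^sub>R f x) \<in> Lp_space p"
  using assms by (auto simp: Lp_space_def powr_mult intro: borel_measurable_scaleR)

lemma Lp_space_add:
  assumes "0 \<le> p" and f: "f \<in> Lp_space p" and g: "g \<in> Lp_space p"
  shows "(\<lambda>x. f x + g x) \<in> Lp_space p"
  using Lp_space_diff[OF assms(1) f Lp_space_scaleR[OF g, of "-1"]] by simp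

lemma Lp_space_translate:
  assumes f: "f \<in> Lp_space p"
  shows "(\<lambda>x. f (x - h)) \<in> Lp_space p"
proof -
  note [measurable] = Lp_space_measurable[OF f]
  show ?thesis
    using integrable_lborel_translate[OF Lp_space_integrable[OF f], of h] by (simp add: Lp_space_def)
qed

text \<open>Cutting off both the size of \<open>f\<close> and its domain produces a bounded integrable function, for which
  the $L^p$ modulus is controlled by the $L^1$ modulus.\<close>

lemma translation_Lp_continuous:
  fixes f :: "'a::euclidean_space \<Rightarrow> 'b::{banach, second_countable_topology}"
  assumes p: "1 \<le> p" and f: "f \<in> Lp_space p"
  shows "((\<lambda>h. LINT x|lborel. norm (f (x - h) - f x) powr p) \<longlongrightarrow> 0) (at 0)"
proof (rule tendstoI)
  fix e :: real assume e: "e > 0"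
  note [measurable] = Lp_space_measurable[OF f]
  define g where "g n x = indicator {x. norm x \<le> real n \<and> norm (f x) \<le> real n} x *\<^sub>R f x" for n x
  have [measurable]: "g n \<in> borel_measurable borel" for n unfolding g_def by measurable
  have bg: "norm (g n x) \<le> real n" for n x by (auto simp: g_def split: split_indicator)
  have ig: "integrable lborel (g n)" for n
  proof (rule Bochner_Integration.integrable_bound)
    show "integrable lborel (\<lambda>x::'a. real n * indicator (cball 0 (real n)) x)"
      by (intro integrable_mult_right integrable_real_indicator)
         (simp_all add: emeasure_bounded_finite[unfolded infinity_ennreal_def])
  qed (auto intro!: AE_I2 simp: g_def split: split_indicator)
  have fg: "norm (f x - g n x) powr p \<le> norm (f x) powr p" for n x
    by (auto simp: g_def split: split_indicator)
  have ifg: "integrable lborel (\<lambda>x. norm (f x - g n x) powr p)" for n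
    by (rule Bochner_Integration.integrable_bound[OF Lp_space_integrable[OF f]]) (auto intro!: AE_I2 fg)
  have "(\<lambda>n. LINT x|lborel. norm (f x - g n x) powr p) \<longlonglongrightarrow> (LINT x|(lborel :: 'a measure). (0::real))"
  proof (rule integral_dominated_convergence[where w="\<lambda>x. norm (f x) powr p"])
    show "AE x in lborel. (\<lambda>n. norm (f x - g n x) powr p) \<longlonglongrightarrow> 0"
    proof (rule AE_I2)
      fix x :: 'a
      obtain N where N: "norm x \<le> real N" "norm (f x) \<le> real N"
        using real_arch_simple[of "max (norm x) (norm (f x))"] by auto
      have "\<forall>\<^sub>F n in sequentially. norm (f x - g n x) powr p = 0"
        using eventually_ge_at_top[of N]
      proof eventually_elim
        case (elim n)
        then have "norm x \<le> real n \<and> norm (f x) \<le> real n" using N by (meson of_nat_le_iff order_trans)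
        then show ?case by (simp add: g_def)
      qed
      then show "(\<lambda>n. norm (f x - g n x) powr p) \<longlonglongrightarrow> 0" by (rule tendsto_eventually)
    qed
  qed (use Lp_space_integrable[OF f] fg in auto)
  then have lim1: "(\<lambda>n. LINT x|lborel. norm (f x - g n x) powr p) \<longlonglongrightarrow> 0" by simp
  define C where "C = 2 powr p * 2 powr p"
  have C: "C > 0" by (simp add: C_def)
  have "\<forall>\<^sub>F n in sequentially. (LINT x|lborel. norm (f x - g n x) powr p) < e / (4 * C)"
    using e C by (intro order_tendstoD(2)[OF lim1]) simp
  then obtain n where n: "(LINT x|lborel. norm (f x - g n x) powr p) < e / (4 * C)"
    by (meson eventually_sequentially order_refl)
  have tg: "(LINT x|lborel. norm (g n (x - h) - g n x) powr p) \<le>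
      (2 * real n) powr (p - 1) * (LINT x|lborel. norm (g n (x - h) - g n x))"
    and itg: "integrable lborel (\<lambda>x. norm (g n (x - h) - g n x) powr p)" for h
  proof -
    have *: "norm (g n (x - h) - g n x) powr p \<le> (2 * real n) powr (p - 1) * norm (g n (x - h) - g n x)" for x
    proof (cases "norm (g n (x - h) - g n x) = 0")
      case False
      have "norm (g n (x - h) - g n x) powr p =
          norm (g n (x - h) - g n x) powr (p - 1) * norm (g n (x - h) - g n x) powr 1"
        unfolding powr_add[symmetric] by simp
      also have "\<dots> \<le> (2 * real n) powr (p - 1) * norm (g n (x - h) - g n x) powr 1"
        using p norm_triangle_ineq4[of "g n (x - h)" "g n x"] bg[of n "x-h"] bg[of n x]
        by (intro mult_right_mono powr_mono2) auto
      finally show ?thesis using False by simp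
    qed simp
    have int: "integrable lborel (\<lambda>x. (2 * real n) powr (p - 1) * norm (g n (x - h) - g n x))"
      by (intro integrable_mult_right integrable_norm Bochner_Integration.integrable_diff
          ig integrable_lborel_translate)
    show i: "integrable lborel (\<lambda>x. norm (g n (x - h) - g n x) powr p)"
      by (rule Bochner_Integration.integrable_bound[OF int]) (auto intro!: AE_I2 order_trans[OF *])
    show "(LINT x|lborel. norm (g n (x - h) - g n x) powr p) \<le>
      (2 * real n) powr (p - 1) * (LINT x|lborel. norm (g n (x - h) - g n x))"
      using integral_mono[OF i int *] by simp
  qed
  have "((\<lambda>h. (2 * real n) powr (p - 1) * (LINT x|lborel. norm (g n (x - h) - g n x))) \<longlongrightarrow> 0) (at 0)"
    using tendsto_mult[OF tendsto_const translation_L1_continuous[OF ig[of n]]] by simp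
  then have "\<forall>\<^sub>F h in at 0. (2 * real n) powr (p - 1) * (LINT x|lborel. norm (g n (x - h) - g n x)) < e / (2 * C)"
    by (rule order_tendstoD(2)) (use e C in \<open>auto intro!: divide_pos_pos\<close>)
  then show "\<forall>\<^sub>F h in at 0. dist (LINT x|lborel. norm (f (x - h) - f x) powr p) 0 < e"
  proof eventually_elim
    case (elim h)
    let ?T = "\<lambda>x. norm (g n (x - h) - g n x) powr p"
    let ?r = "\<lambda>x. norm (f x - g n x) powr p"
    have ir: "integrable lborel (\<lambda>x. ?r (x - h))" by (rule integrable_lborel_translate[OF ifg])
    have le: "norm (f (x - h) - f x) powr p \<le> C * (?T x + (?r (x - h) + ?r x))" for x
    proof -
      have "norm (f (x - h) - f x) powr p =
          norm ((g n (x - h) - g n x) - ((f x - g n x) - (f (x - h) - g n (x - h)))) powr p"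
        by (simp add: algebra_simps)
      also have "\<dots> \<le> 2 powr p * (?T x + norm ((f x - g n x) - (f (x - h) - g n (x - h))) powr p)"
        using p by (intro norm_diff_powr_le) simp
      also have "\<dots> \<le> 2 powr p * (?T x + 2 powr p * (?r x + ?r (x - h)))"
        using p by (intro mult_left_mono add_left_mono norm_diff_powr_le) simp_all
      also have "\<dots> \<le> 2 powr p * (2 powr p * ?T x + 2 powr p * (?r x + ?r (x - h)))"
        using p mult_right_mono[of 1 "2 powr p" "?T x"] ge_one_powr_ge_zero[of 2 p]
        by (intro mult_left_mono add_right_mono) auto
      finally show ?thesis by (simp add: C_def algebra_simps)
    qed
    have "(LINT x|lborel. norm (f (x - h) - f x) powr p) \<le> (LINT x|lborel. C * (?T x + (?r (x - h) + ?r x)))"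
      using Lp_space_integrable[OF Lp_space_diff[OF _ Lp_space_translate[OF f, of h] f]] p
      by (intro integral_mono le integrable_mult_right Bochner_Integration.integrable_add itg ifg ir) auto
    also have "\<dots> = C * ((LINT x|lborel. ?T x) + ((LINT x|lborel. ?r (x - h)) + (LINT x|lborel. ?r x)))"
      using itg[of h] ifg[of n] ir by simp
    also have "(LINT x|lborel. ?r (x - h)) = (LINT x|lborel. ?r x)"
      by (rule integral_lborel_translate) measurable
    also have "C * ((LINT x|lborel. ?T x) + ((LINT x|lborel. ?r x) + (LINT x|lborel. ?r x)))
       < C * (e / (2 * C) + (e / (4 * C) + e / (4 * C)))"
      using C n elim tg[of h] by (intro mult_strict_left_mono add_strict_mono) auto
    also have "\<dots> = e" using C by (simp add: field_simps)
    finally show ?case by (simp add: dist_real_def)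
  qed
qed

section \<open>Mollification in Lebesgue spaces\<close>

lemma powr_tangent_le:
  fixes t m p :: real
  assumes "1 \<le> p" "0 \<le> t" "0 \<le> m"
  shows "p * (t * m powr (p - 1)) \<le> t powr p + (p - 1) * m powr p"
proof (cases "p = 1")
  case True then show ?thesis using assms by (cases "m = 0") auto
next
  case False
  then have p: "p > 1" using assms by simp
  let ?q = "p / (p - 1)"
  have "t * m powr (p - 1) \<le> t powr p / p + (m powr (p - 1)) powr ?q / ?q"
    using p assms by (intro Youngs_inequality) (auto simp: field_simps)
  also have "(m powr (p - 1)) powr ?q = m powr p" using p by (simp add: powr_powr)
  finally have "p * (t * m powr (p - 1)) \<le> p * (t powr p / p + m powr p / ?q)"
    using p by (intro mult_left_mono) auto
  also have "\<dots> = t powr p + (p - 1) * m powr p" using p by (simp add: field_simps)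
  finally show ?thesis .
qed

text \<open>Jensen's inequality for the convex function $t \mapsto t^p$ and the probability density \<open>k\<close>: integrate
  the tangent line at the mean value.\<close>

lemma jensen_powr:
  fixes f :: "'c \<Rightarrow> 'b::{banach, second_countable_topology}"
  assumes p: "1 \<le> p" and k: "\<And>y. 0 \<le> k y" "integrable M k" "(LINT y|M. k y) = 1"
    and [measurable]: "f \<in> borel_measurable M"
    and int: "integrable M (\<lambda>y. k y * norm (f y) powr p)"
  shows "integrable M (\<lambda>y. k y *\<^sub>R f y)"
    and "norm (LINT y|M. k y *\<^sub>R f y) powr p \<le> (LINT y|M. k y * norm (f y) powr p)"
proof -
  have [measurable]: "k \<in> borel_measurable M" using k by simp
  have le1: "t \<le> 1 + t powr p" if "t \<ge> 0" for t :: real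
  proof (cases "t \<le> 1")
    case False
    then have "t powr 1 \<le> t powr p" using p by (intro powr_mono) auto
    then show ?thesis using False by simp
  qed (use powr_ge_zero[of t p] in linarith)
  show i: "integrable M (\<lambda>y. k y *\<^sub>R f y)"
  proof (rule Bochner_Integration.integrable_bound[OF Bochner_Integration.integrable_add[OF k(2) int]])
    show "AE y in M. norm (k y *\<^sub>R f y) \<le> norm (k y + k y * norm (f y) powr p)"
    proof (rule AE_I2)
      fix y
      have "k y * norm (f y) \<le> k y * (1 + norm (f y) powr p)" by (intro mult_left_mono le1 k) simp
      then show "norm (k y *\<^sub>R f y) \<le> norm (k y + k y * norm (f y) powr p)"
        using k(1)[of y] by (simp add: distrib_left)
    qed
  qed simp
  define m where "m = (LINT y|M. k y * norm (f y))"
  have ik: "integrable M (\<lambda>y. k y * norm (f y))" using integrable_norm[OF i] k(1) by simp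
  have m0: "m \<ge> 0" unfolding m_def using k(1) by (intro integral_nonneg_AE) auto
  have nm: "norm (LINT y|M. k y *\<^sub>R f y) \<le> m"
    using integral_norm_bound[of M "\<lambda>y. k y *\<^sub>R f y"] k(1) by (simp add: m_def)
  have "(LINT y|M. p * m powr (p - 1) * (k y * norm (f y))) \<le>
     (LINT y|M. k y * norm (f y) powr p + (p - 1) * m powr p * k y)"
  proof (intro integral_mono integrable_mult_right Bochner_Integration.integrable_add ik k int)
    fix y
    show "p * m powr (p - 1) * (k y * norm (f y)) \<le> k y * norm (f y) powr p + (p - 1) * m powr p * k y"
      using mult_left_mono[OF powr_tangent_le[OF p norm_ge_zero[of "f y"] m0] k(1)[of y]]
      by (simp add: algebra_simps)
  qed
  then have "p * (m powr (p - 1) * m) \<le> (LINT y|M. k y * norm (f y) powr p) + (p - 1) * m powr p"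
    using k int ik by (simp add: m_def mult.assoc)
  moreover have "m powr (p - 1) * m = m powr p"
    using m0 by (cases "m = 0") (auto simp: powr_mult_base powr_diff)
  ultimately have "p * m powr p \<le> (LINT y|M. k y * norm (f y) powr p) + (p - 1) * m powr p" by simp
  then have "m powr p \<le> (LINT y|M. k y * norm (f y) powr p)" by (simp add: left_diff_distrib)
  moreover have "norm (LINT y|M. k y *\<^sub>R f y) powr p \<le> m powr p"
    using nm p by (intro powr_mono2) auto
  ultimately show "norm (LINT y|M. k y *\<^sub>R f y) powr p \<le> (LINT y|M. k y * norm (f y) powr p)" by simp
qed

text \<open>Friedrichs mollifiers and the Gaussian density are both needed: the latter has no compact support, but regularises
  the Fourier transform.\<close>

definition mollifying_kernel :: "('a::euclidean_space \<Rightarrow> real) \<Rightarrow> bool"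
  where "mollifying_kernel \<psi> \<longleftrightarrow>
    \<psi> \<in> borel_measurable borel \<and> (\<forall>x. 0 \<le> \<psi> x) \<and> integrable lborel \<psi> \<and> (LINT x|lborel. \<psi> x) = 1"

text \<open>Jensen's inequality in \<open>z\<close> followed by Tonelli's theorem. With $F(x,z) = f(x - \varepsilon z)$ this bounds the
  mollification of \<open>f\<close>, and with $F(x,z) = f(x - \varepsilon z) - f(x)$ its distance from \<open>f\<close>.\<close>

lemma kernel_average_Lp:
  fixes F :: "'a::euclidean_space \<Rightarrow> 'a \<Rightarrow> 'b::{banach, second_countable_topology}"
  assumes p: "1 \<le> p" and \<psi>: "mollifying_kernel \<psi>"
    and F[measurable]: "(\<lambda>(x, z). F x z) \<in> borel_measurable (borel \<Otimes>\<^sub>M borel)"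
    and int: "\<And>z. integrable lborel (\<lambda>x. norm (F x z) powr p)"
    and bd: "\<And>z. (LINT x|lborel. norm (F x z) powr p) \<le> B"
  shows "(\<lambda>x. LINT z|lborel. \<psi> z *\<^sub>R F x z) \<in> Lp_space p"
    and "(LINT x|lborel. norm (LINT z|lborel. \<psi> z *\<^sub>R F x z) powr p) \<le>
      (LINT z|lborel. \<psi> z * (LINT x|lborel. norm (F x z) powr p))"
    and "AE x in lborel. integrable lborel (\<lambda>z. \<psi> z *\<^sub>R F x z)"
proof -
  have [measurable]: "\<psi> \<in> borel_measurable borel" and \<psi>0: "\<And>z. 0 \<le> \<psi> z"
    and i\<psi>: "integrable lborel \<psi>" and \<psi>1: "(LINT z|lborel. \<psi> z) = 1"
    using \<psi> by (auto simp: mollifying_kernel_def)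
  let ?T = "\<lambda>z. LINT x|lborel. norm (F x z) powr p"
  have T0: "0 \<le> ?T z" for z by simp
  have [measurable]: "?T \<in> borel_measurable borel" by measurable
  have iT: "integrable lborel (\<lambda>z. \<psi> z * ?T z)"
  proof (rule Bochner_Integration.integrable_bound)
    show "integrable lborel (\<lambda>z. B * \<psi> z)" using i\<psi> by simp
    show "AE z in lborel. norm (\<psi> z * ?T z) \<le> norm (B * \<psi> z)"
    proof (rule AE_I2)
      fix z :: 'a
      have "\<psi> z * ?T z \<le> \<psi> z * B" by (rule mult_left_mono[OF bd \<psi>0])
      moreover have "0 \<le> \<psi> z * ?T z" using \<psi>0 T0 by simp
      ultimately show "norm (\<psi> z * ?T z) \<le> norm (B * \<psi> z)" by (simp add: mult.commute)
    qed
  qed simp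
  have tonelli: "(\<integral>\<^sup>+x. \<integral>\<^sup>+z. ennreal (\<psi> z * norm (F x z) powr p) \<partial>lborel \<partial>lborel) =
     ennreal (LINT z|lborel. \<psi> z * ?T z)"
  proof -
    have "(\<integral>\<^sup>+x. \<integral>\<^sup>+z. ennreal (\<psi> z * norm (F x z) powr p) \<partial>lborel \<partial>lborel) =
       (\<integral>\<^sup>+z. \<integral>\<^sup>+x. ennreal (\<psi> z * norm (F x z) powr p) \<partial>lborel \<partial>lborel)"
      by (rule lborel_pair.Fubini') measurable
    also have "\<dots> = (\<integral>\<^sup>+z. ennreal (\<psi> z * ?T z) \<partial>lborel)"
    proof (rule nn_integral_cong)
      fix z :: 'a
      have "(\<integral>\<^sup>+x. ennreal (\<psi> z * norm (F x z) powr p) \<partial>lborel) =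
          ennreal (LINT x|lborel. \<psi> z * norm (F x z) powr p)"
        using \<psi>0 int by (intro nn_integral_eq_integral) auto
      then show "(\<integral>\<^sup>+x. ennreal (\<psi> z * norm (F x z) powr p) \<partial>lborel) = ennreal (\<psi> z * ?T z)" by simp
    qed
    also have "\<dots> = ennreal (LINT z|lborel. \<psi> z * ?T z)"
      using \<psi>0 T0 by (intro nn_integral_eq_integral iT) auto
    finally show ?thesis .
  qed
  have "AE x in lborel. (\<integral>\<^sup>+z. ennreal (\<psi> z * norm (F x z) powr p) \<partial>lborel) \<noteq> \<infinity>"
    by (rule nn_integral_PInf_AE) (simp_all add: tonelli)
  then have AE_int: "AE x in lborel. integrable lborel (\<lambda>z. \<psi> z * norm (F x z) powr p)"
    by eventually_elim (auto simp: integrable_iff_bounded \<psi>0 less_top[symmetric])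
  then show "AE x in lborel. integrable lborel (\<lambda>z. \<psi> z *\<^sub>R F x z)"
    by eventually_elim (intro jensen_powr[OF p \<psi>0 i\<psi> \<psi>1], auto)
  have le: "AE x in lborel. ennreal (norm (LINT z|lborel. \<psi> z *\<^sub>R F x z) powr p) \<le>
      (\<integral>\<^sup>+z. ennreal (\<psi> z * norm (F x z) powr p) \<partial>lborel)"
    using AE_int
  proof eventually_elim
    case (elim x)
    have "norm (LINT z|lborel. \<psi> z *\<^sub>R F x z) powr p \<le> (LINT z|lborel. \<psi> z * norm (F x z) powr p)"
      by (intro jensen_powr[OF p \<psi>0 i\<psi> \<psi>1] elim) simp
    then show ?case using elim \<psi>0 by (subst nn_integral_eq_integral) (auto intro: ennreal_leI)
  qed
  have G[measurable]: "(\<lambda>x. LINT z|lborel. \<psi> z *\<^sub>R F x z) \<in> borel_measurable borel" by measurable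
  have nnG: "(\<integral>\<^sup>+x. ennreal (norm (LINT z|lborel. \<psi> z *\<^sub>R F x z) powr p) \<partial>lborel) \<le>
      ennreal (LINT z|lborel. \<psi> z * ?T z)"
    unfolding tonelli[symmetric] by (rule nn_integral_mono_AE[OF le])
  have iG: "integrable lborel (\<lambda>x. norm (LINT z|lborel. \<psi> z *\<^sub>R F x z) powr p)"
    using nnG by (auto simp: integrable_iff_bounded intro: le_less_trans)
  then show "(\<lambda>x. LINT z|lborel. \<psi> z *\<^sub>R F x z) \<in> Lp_space p" by (simp add: Lp_space_def)
  have "ennreal (LINT x|lborel. norm (LINT z|lborel. \<psi> z *\<^sub>R F x z) powr p) \<le>
      ennreal (LINT z|lborel. \<psi> z * ?T z)"
    using nnG by (subst nn_integral_eq_integral[symmetric, OF iG]) auto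
  then show "(LINT x|lborel. norm (LINT z|lborel. \<psi> z *\<^sub>R F x z) powr p) \<le> (LINT z|lborel. \<psi> z * ?T z)"
    using \<psi>0 by (subst (asm) ennreal_le_iff) (auto intro!: integral_nonneg_AE)
qed

lemma convolution_mollifying_net_eq:
  fixes f :: "'a::euclidean_space \<Rightarrow> 'b::{banach, second_countable_topology}"
  assumes [measurable]: "f \<in> borel_measurable borel" "\<psi> \<in> borel_measurable borel" and e: "\<epsilon> > 0"
  shows "convolution f (mollifying_net \<psi> \<epsilon>) x = (LINT z|lborel. \<psi> z *\<^sub>R f (x - \<epsilon> *\<^sub>R z))"
proof -
  have [measurable]: "mollifying_net \<psi> \<epsilon> \<in> borel_measurable borel"
    unfolding mollifying_net_def by measurable
  have "convolution f (mollifying_net \<psi> \<epsilon>) x =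
    \<bar>-\<epsilon>\<bar> ^ DIM('a) *\<^sub>R (LINT z|lborel. mollifying_net \<psi> \<epsilon> (x - (x + (-\<epsilon>) *\<^sub>R z)) *\<^sub>R f (x + (-\<epsilon>) *\<^sub>R z))"
    unfolding convolution_def using e by (subst integral_lborel_affine[where t=x and c="-\<epsilon>"]) auto
  also have "\<dots> = \<epsilon> ^ DIM('a) *\<^sub>R (LINT z|lborel. mollifying_net \<psi> \<epsilon> (\<epsilon> *\<^sub>R z) *\<^sub>R f (x - \<epsilon> *\<^sub>R z))"
    using e by simp
  also have "\<dots> = (LINT z|lborel. \<epsilon> ^ DIM('a) *\<^sub>R (mollifying_net \<psi> \<epsilon> (\<epsilon> *\<^sub>R z) *\<^sub>R f (x - \<epsilon> *\<^sub>R z)))"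
    by (rule integral_scaleR_right[symmetric])
  also have "\<dots> = (LINT z|lborel. \<psi> z *\<^sub>R f (x - \<epsilon> *\<^sub>R z))"
    using e by (simp add: mollifying_net_def)
  finally show ?thesis .
qed

lemma
  fixes f :: "'a::euclidean_space \<Rightarrow> 'b::{banach, second_countable_topology}"
  assumes p: "1 \<le> p" and f: "f \<in> Lp_space p" and \<psi>: "mollifying_kernel \<psi>" and e: "\<epsilon> > 0"
  shows convolution_Lp: "convolution f (mollifying_net \<psi> \<epsilon>) \<in> Lp_space p"
    and convolution_Lp_le: "(LINT x|lborel. norm (convolution f (mollifying_net \<psi> \<epsilon>) x) powr p) \<le>
      (LINT x|lborel. norm (f x) powr p)"
    and convolution_AE_integrable: "AE x in lborel. integrable lborel (\<lambda>z. \<psi> z *\<^sub>R f (x - \<epsilon> *\<^sub>R z))"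
proof -
  have [measurable]: "\<psi> \<in> borel_measurable borel" using \<psi> by (simp add: mollifying_kernel_def)
  note [measurable] = Lp_space_measurable[OF f]
  have F: "(\<lambda>(x, z). f (x - \<epsilon> *\<^sub>R z)) \<in> borel_measurable (borel \<Otimes>\<^sub>M borel)" by measurable
  have I: "integrable lborel (\<lambda>x. norm (f (x - \<epsilon> *\<^sub>R z)) powr p)" for z
    by (rule Lp_space_integrable[OF Lp_space_translate[OF f]])
  have E: "(LINT x|lborel. norm (f (x - \<epsilon> *\<^sub>R z)) powr p) = (LINT x|lborel. norm (f x) powr p)" for z
    by (rule integral_lborel_translate) measurable
  note avg = kernel_average_Lp[OF p \<psi> F I eq_refl[OF E]]
  have eq: "convolution f (mollifying_net \<psi> \<epsilon>) = (\<lambda>x. LINT z|lborel. \<psi> z *\<^sub>R f (x - \<epsilon> *\<^sub>R z))"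
    using e by (intro ext convolution_mollifying_net_eq) measurable
  show "convolution f (mollifying_net \<psi> \<epsilon>) \<in> Lp_space p" unfolding eq by (rule avg(1))
  show "(LINT x|lborel. norm (convolution f (mollifying_net \<psi> \<epsilon>) x) powr p) \<le> (LINT x|lborel. norm (f x) powr p)"
    using avg(2) \<psi> unfolding eq E by (simp add: mollifying_kernel_def)
  show "AE x in lborel. integrable lborel (\<lambda>z. \<psi> z *\<^sub>R f (x - \<epsilon> *\<^sub>R z))" by (rule avg(3))
qed

text \<open>By \<open>kernel_average_Lp\<close> the distance is at most the average over \<open>z\<close>, with density \<open>\<psi>\<close>, of the $L^p$ modulus of
  continuity at $\varepsilon z$; the latter is bounded and tends to zero for each \<open>z\<close>.\<close>

lemma convolution_tendsto_Lp:
  fixes f :: "'a::euclidean_space \<Rightarrow> 'b::{banach, second_countable_topology}"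
  assumes p: "1 \<le> p" and f: "f \<in> Lp_space p" and \<psi>: "mollifying_kernel \<psi>"
  shows "((\<lambda>\<epsilon>. LINT x|lborel. norm (convolution f (mollifying_net \<psi> \<epsilon>) x - f x) powr p) \<longlongrightarrow> 0) (at_right 0)"
proof -
  have [measurable]: "\<psi> \<in> borel_measurable borel" and \<psi>0: "\<And>z. 0 \<le> \<psi> z"
    and i\<psi>: "integrable lborel \<psi>" and \<psi>1: "(LINT z|lborel. \<psi> z) = 1"
    using \<psi> by (auto simp: mollifying_kernel_def)
  note [measurable] = Lp_space_measurable[OF f]
  define T where "T h = (LINT x|lborel. norm (f (x - h) - f x) powr p)" for h
  have [measurable]: "T \<in> borel_measurable borel" unfolding T_def by measurable
  define B where "B = 2 powr p * (2 * (LINT x|lborel. norm (f x) powr p))"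
  have I: "integrable lborel (\<lambda>x. norm (f (x - h) - f x) powr p)" for h
    using p by (intro Lp_space_integrable Lp_space_diff Lp_space_translate f) simp
  have TB: "T h \<le> B" for h
  proof -
    have "T h \<le> (LINT x|lborel. 2 powr p * (norm (f (x - h)) powr p + norm (f x) powr p))"
      unfolding T_def using p
      by (intro integral_mono I integrable_mult_right Bochner_Integration.integrable_add norm_diff_powr_le
          Lp_space_integrable Lp_space_translate f) auto
    also have "\<dots> = 2 powr p * ((LINT x|lborel. norm (f (x - h)) powr p) + (LINT x|lborel. norm (f x) powr p))"
      using Lp_space_integrable[OF f] Lp_space_integrable[OF Lp_space_translate[OF f, of h]] by simp
    also have "(LINT x|lborel. norm (f (x - h)) powr p) = (LINT x|lborel. norm (f x) powr p)"
      by (rule integral_lborel_translate) measurable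
    finally show ?thesis by (simp add: B_def)
  qed
  have T0: "0 \<le> T h" for h by (simp add: T_def)
  have le: "(LINT x|lborel. norm (convolution f (mollifying_net \<psi> \<epsilon>) x - f x) powr p) \<le>
      (LINT z|lborel. \<psi> z * T (\<epsilon> *\<^sub>R z))" if e: "\<epsilon> > 0" for \<epsilon>
  proof -
    have F: "(\<lambda>(x, z). f (x - \<epsilon> *\<^sub>R z) - f x) \<in> borel_measurable (borel \<Otimes>\<^sub>M borel)" by measurable
    have "AE x in lborel. (LINT z|lborel. \<psi> z *\<^sub>R (f (x - \<epsilon> *\<^sub>R z) - f x)) =
        convolution f (mollifying_net \<psi> \<epsilon>) x - f x"
      using convolution_AE_integrable[OF p f \<psi> e]
    proof eventually_elim
      case (elim x)
      then show ?case
        using i\<psi> \<psi>1 e by (simp add: convolution_mollifying_net_eq scaleR_diff_right)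
    qed
    then have "(LINT x|lborel. norm (convolution f (mollifying_net \<psi> \<epsilon>) x - f x) powr p) =
        (LINT x|lborel. norm (LINT z|lborel. \<psi> z *\<^sub>R (f (x - \<epsilon> *\<^sub>R z) - f x)) powr p)"
      using convolution_Lp[OF p f \<psi> e, THEN Lp_space_measurable]
      by (intro integral_cong_AE) (auto elim!: eventually_mono)
    also have "\<dots> \<le> (LINT z|lborel. \<psi> z * T (\<epsilon> *\<^sub>R z))"
      using kernel_average_Lp(2)[OF p \<psi> F I] TB unfolding T_def by blast
    finally show ?thesis .
  qed
  have "((\<lambda>\<epsilon>. LINT z|lborel. \<psi> z * T (\<epsilon> *\<^sub>R z)) \<longlongrightarrow> 0) (at_right 0)"
    unfolding tendsto_at_iff_sequentially comp_def
  proof (intro allI impI)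
    fix X :: "nat \<Rightarrow> real" assume X: "\<forall>i. X i \<in> {0<..} - {0}" "X \<longlonglongrightarrow> 0"
    have Tlim: "(\<lambda>n. T (X n *\<^sub>R z)) \<longlonglongrightarrow> 0" for z
    proof -
      have T00: "T 0 = 0" by (simp add: T_def)
      have "isCont T 0"
        using translation_Lp_continuous[OF p f] by (simp add: isCont_def T00) (simp add: T_def[abs_def])
      moreover have "(\<lambda>n. X n *\<^sub>R z) \<longlonglongrightarrow> 0 *\<^sub>R z" by (intro tendsto_intros X)
      ultimately show ?thesis using isCont_tendsto_compose[of 0 T "\<lambda>n. X n *\<^sub>R z"] T00 by simp
    qed
    have "(\<lambda>n. LINT z|lborel. \<psi> z * T (X n *\<^sub>R z)) \<longlonglongrightarrow> (LINT z|(lborel :: 'a measure). (0::real))"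
    proof (rule integral_dominated_convergence[where w="\<lambda>z. B * \<psi> z"])
      show "AE z in lborel. (\<lambda>n. \<psi> z * T (X n *\<^sub>R z)) \<longlonglongrightarrow> 0"
        using tendsto_mult[OF tendsto_const Tlim] by (intro AE_I2) (metis mult_zero_right)
      show "AE z in lborel. norm (\<psi> z * T (X n *\<^sub>R z)) \<le> B * \<psi> z" for n
        using mult_left_mono[OF TB \<psi>0] T0 \<psi>0 by (intro AE_I2) (simp add: mult.commute[of B])
    qed (use i\<psi> in auto)
    then show "(\<lambda>n. LINT z|lborel. \<psi> z * T (X n *\<^sub>R z)) \<longlonglongrightarrow> 0" by simp
  qed
  then show ?thesis
  proof (rule tendsto_sandwich[OF _ _ tendsto_const, rotated 2])
    show "\<forall>\<^sub>F \<epsilon> in at_right 0. (LINT x|lborel. norm (convolution f (mollifying_net \<psi> \<epsilon>) x - f x) powr p) \<le>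
      (LINT z|lborel. \<psi> z * T (\<epsilon> *\<^sub>R z))"
      using eventually_at_right_less[of 0] by eventually_elim (rule le)
  qed (intro always_eventually allI, simp)
qed



section \<open>The Hilbert space of classes of square-integrable functions\<close>

lemma L2_iff:
  "f \<in> Lp_space 2 \<longleftrightarrow> f \<in> borel_measurable borel \<and> integrable lborel (\<lambda>x. (norm (f x))\<^sup>2)"
  by (simp add: Lp_space_def)

lemma Lp_norm_2: "Lp_norm 2 f = sqrt (LINT x|lborel. (norm (f x))\<^sup>2)"
  by (simp add: Lp_norm_def powr_half_sqrt)

lemma L2_zero: "(\<lambda>_. 0) \<in> Lp_space 2"
  by (simp add: L2_iff)

lemmas L2_add = Lp_space_add[of 2, simplified]
lemmas L2_diff = Lp_space_diff[of 2, simplified]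
lemmas L2_scaleR = Lp_space_scaleR[of _ 2]

lemma L2_mult_integrable:
  assumes f: "f \<in> Lp_space 2" and g: "g \<in> Lp_space 2"
  shows "integrable lborel (\<lambda>x. norm (f x) * norm (g x))"
proof -
  have [measurable]: "f \<in> borel_measurable borel" "g \<in> borel_measurable borel" using f g by (auto simp: L2_iff)
  have "integrable lborel (\<lambda>x. (norm (f x))\<^sup>2 + (norm (g x))\<^sup>2)" using f g by (auto simp: L2_iff)
  then show ?thesis
  proof (rule Bochner_Integration.integrable_bound)
    have "a * b \<le> a\<^sup>2 + b\<^sup>2" if "0 \<le> a" "0 \<le> b" for a b :: real
      using sum_squares_bound[of a b] that mult_nonneg_nonneg[OF that] by linarith
    then show "AE x in lborel. norm (norm (f x) * norm (g x)) \<le> norm ((norm (f x))\<^sup>2 + (norm (g x))\<^sup>2)"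
      by (intro AE_I2) simp
  qed simp
qed

lemma L2_inner_integrable:
  fixes f g :: "'a::euclidean_space \<Rightarrow> 'b::euclidean_space"
  assumes f: "f \<in> Lp_space 2" and g: "g \<in> Lp_space 2"
  shows "integrable lborel (\<lambda>x. f x \<bullet> g x)"
proof -
  have [measurable]: "f \<in> borel_measurable borel" "g \<in> borel_measurable borel" using f g by (auto simp: L2_iff)
  show ?thesis
    by (rule Bochner_Integration.integrable_bound[OF L2_mult_integrable[OF f g]])
       (auto intro!: AE_I2 simp: Cauchy_Schwarz_ineq2)
qed

text \<open>Passing to classes makes $L^2$ an instance of \<open>real_inner\<close> and \<open>banach\<close>, so that derivatives and
  integrals of $L^2$-valued curves are those of the general theory. The real inner product is the real part
  of the complex one, which suffices for energies.\<close>

definition L2_eq :: "('a::euclidean_space \<Rightarrow> complex) \<Rightarrow> ('a \<Rightarrow> complex) \<Rightarrow> bool"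
  where "L2_eq f g \<longleftrightarrow> f \<in> Lp_space 2 \<and> g \<in> Lp_space 2 \<and> (AE x in lborel. f x = g x)"

lemma part_equivp_L2_eq: "part_equivp (L2_eq :: ('a::euclidean_space \<Rightarrow> complex) \<Rightarrow> _)"
proof (rule part_equivpI)
  let ?R = "L2_eq :: ('a \<Rightarrow> complex) \<Rightarrow> _"
  show "\<exists>f. ?R f f" by (intro exI[of _ "\<lambda>_. 0"]) (simp add: L2_eq_def L2_zero)
  show "symp ?R" by (rule sympI) (auto simp: L2_eq_def eq_commute)
  show "transp ?R"
  proof (rule transpI)
    fix f g h :: "'a \<Rightarrow> complex" assume fg: "L2_eq f g" and gh: "L2_eq g h"
    have "AE x in lborel. f x = g x" "AE x in lborel. g x = h x" using fg gh by (simp_all add: L2_eq_def)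
    then have "AE x in lborel. f x = h x" by eventually_elim simp
    with fg gh show "L2_eq f h" by (simp add: L2_eq_def)
  qed
qed

quotient_type (overloaded) 'a l2 = "'a::euclidean_space \<Rightarrow> complex" / partial: L2_eq
  by (rule part_equivp_L2_eq)

lemma AE_L2_eq_binop:
  assumes "L2_eq f f'" "L2_eq g g'"
  shows "AE x in lborel. h (f x) (g x) = h (f' x) (g' x)"
proof -
  have "AE x in lborel. f x = f' x" "AE x in lborel. g x = g' x" using assms by (simp_all add: L2_eq_def)
  then show ?thesis by eventually_elim simp
qed

text \<open>Functions outside $L^2$ get the class $0$, so that the quotient map is total.\<close>

lift_definition cls :: "('a::euclidean_space \<Rightarrow> complex) \<Rightarrow> 'a l2"
  is "\<lambda>f. if f \<in> Lp_space 2 then f else (\<lambda>_. 0)"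
  by (simp add: L2_eq_def L2_zero)

instantiation l2 :: (euclidean_space) real_vector
begin

lift_definition zero_l2 :: "'a l2" is "\<lambda>_. 0" by (simp add: L2_eq_def L2_zero)
lift_definition plus_l2 :: "'a l2 \<Rightarrow> 'a l2 \<Rightarrow> 'a l2" is "\<lambda>f g x. f x + g x"
  using AE_L2_eq_binop[where h="(+)"] by (simp add: L2_eq_def L2_add)
lift_definition minus_l2 :: "'a l2 \<Rightarrow> 'a l2 \<Rightarrow> 'a l2" is "\<lambda>f g x. f x - g x"
  using AE_L2_eq_binop[where h="(-)"] by (simp add: L2_eq_def L2_diff)
lift_definition uminus_l2 :: "'a l2 \<Rightarrow> 'a l2" is "\<lambda>f x. - f x"
proof -
  fix f g :: "'a \<Rightarrow> complex" assume "L2_eq f g"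
  then show "L2_eq (\<lambda>x. - f x) (\<lambda>x. - g x)"
    using AE_L2_eq_binop[of f g f g "\<lambda>a b. - a"] L2_scaleR[of f "-1"] L2_scaleR[of g "-1"]
    by (simp add: L2_eq_def)
qed
lift_definition scaleR_l2 :: "real \<Rightarrow> 'a l2 \<Rightarrow> 'a l2" is "\<lambda>c f x. c *\<^sub>R f x"
proof -
  fix c :: real and f g :: "'a \<Rightarrow> complex" assume "L2_eq f g"
  then show "L2_eq (\<lambda>x. c *\<^sub>R f x) (\<lambda>x. c *\<^sub>R g x)"
    using AE_L2_eq_binop[of f g f g "\<lambda>a b. c *\<^sub>R a"] by (simp add: L2_eq_def L2_scaleR)
qed

instance
proof
  fix F G H :: "'a l2" and r c :: real
  note [simp] = L2_eq_def L2_zero L2_add L2_diff L2_scaleR L2_scaleR[of _ "-1", simplified]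
  show "F + G + H = F + (G + H)" by transfer (simp add: add.assoc[symmetric])
  show "F + G = G + F" by transfer (simp add: add.commute)
  show "0 + F = F" by transfer simp
  show "- F + F = 0" by transfer simp
  show "F - G = F + - G" by transfer simp
  show "r *\<^sub>R (F + G) = r *\<^sub>R F + r *\<^sub>R G" by transfer (simp add: scaleR_right_distrib)
  show "(r + c) *\<^sub>R F = r *\<^sub>R F + c *\<^sub>R F" by transfer (simp add: scaleR_left_distrib)
  show "r *\<^sub>R c *\<^sub>R F = (r * c) *\<^sub>R F" by transfer simp
  show "1 *\<^sub>R F = F" by transfer simp
qed

end

instantiation l2 :: (euclidean_space) real_inner
begin

lift_definition inner_l2 :: "'a l2 \<Rightarrow> 'a l2 \<Rightarrow> real" is "\<lambda>f g. LINT x|lborel. f x \<bullet> g x"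
  by (intro integral_cong_AE AE_L2_eq_binop) (auto simp: L2_eq_def L2_iff)

definition norm_l2 :: "'a l2 \<Rightarrow> real" where "norm_l2 F = sqrt (inner F F)"
definition sgn_l2 :: "'a l2 \<Rightarrow> 'a l2" where "sgn_l2 F = F /\<^sub>R norm F"
definition dist_l2 :: "'a l2 \<Rightarrow> 'a l2 \<Rightarrow> real" where "dist_l2 F G = norm (F - G)"
definition uniformity_l2 :: "('a l2 \<times> 'a l2) filter"
  where "uniformity_l2 = (INF e\<in>{0<..}. principal {(x, y). dist x y < e})"
definition open_l2 :: "'a l2 set \<Rightarrow> bool"
  where "open_l2 U \<longleftrightarrow> (\<forall>x\<in>U. eventually (\<lambda>(x', y). x' = x \<longrightarrow> y \<in> U) uniformity)"

instance
proof
  fix F G H :: "'a l2" and r :: real and U :: "'a l2 set"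
  show "dist F G = norm (F - G)" by (rule dist_l2_def)
  show "sgn F = F /\<^sub>R norm F" by (rule sgn_l2_def)
  show "uniformity = (INF e\<in>{0<..}. principal {(x, y). dist (x::'a l2) y < e})" by (rule uniformity_l2_def)
  show "open U \<longleftrightarrow> (\<forall>x\<in>U. \<forall>\<^sub>F (x', y) in uniformity. x' = x \<longrightarrow> y \<in> U)" by (rule open_l2_def)
  show "inner F G = inner G F" by transfer (simp add: inner_commute)
  show "inner (F + G) H = inner F H + inner G H"
    by transfer (simp add: L2_eq_def inner_add_left L2_inner_integrable)
  show "inner (r *\<^sub>R F) G = r * inner F G" by transfer simp
  show "0 \<le> inner F F" by transfer simp
  show "inner F F = 0 \<longleftrightarrow> F = 0"
  proof transfer
    fix f :: "'a \<Rightarrow> complex" assume "L2_eq f f"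
    then have f: "f \<in> Lp_space 2" by (simp add: L2_eq_def)
    have "(LINT x|lborel. f x \<bullet> f x) = 0 \<longleftrightarrow> (AE x in lborel. f x \<bullet> f x = 0)"
      using L2_inner_integrable[OF f f] by (intro integral_nonneg_eq_0_iff_AE) auto
    then show "(LINT x|lborel. f x \<bullet> f x) = 0 \<longleftrightarrow> L2_eq f (\<lambda>_. 0)"
      using f by (simp add: L2_eq_def L2_zero)
  qed
  show "norm F = sqrt (inner F F)" by (rule norm_l2_def)
qed

end

lemma L2_eq_refl: "L2_eq f f \<longleftrightarrow> f \<in> Lp_space 2"
  by (simp add: L2_eq_def)

lemma cls_eq_abs: "f \<in> Lp_space 2 \<Longrightarrow> cls f = abs_l2 f"
  by (simp add: cls_def)

lemma cls_surj: obtains f where "f \<in> Lp_space 2" "F = cls f"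
proof -
  have "\<exists>f. f \<in> Lp_space 2 \<and> F = cls f"
    by (induction F rule: l2.abs_induct) (auto simp: L2_eq_refl cls_eq_abs)
  then show ?thesis using that by blast
qed

lemma cls_eq_iff:
  "f \<in> Lp_space 2 \<Longrightarrow> g \<in> Lp_space 2 \<Longrightarrow> cls f = cls g \<longleftrightarrow> (AE x in lborel. f x = g x)"
  using Quotient_rel[OF Quotient_l2, of f g] by (simp add: cls_eq_abs L2_eq_def)

lemma cls_add: "f \<in> Lp_space 2 \<Longrightarrow> g \<in> Lp_space 2 \<Longrightarrow> cls (\<lambda>x. f x + g x) = cls f + cls g"
  by (simp add: cls_eq_abs plus_l2.abs_eq L2_eq_refl L2_add)

lemma cls_diff: "f \<in> Lp_space 2 \<Longrightarrow> g \<in> Lp_space 2 \<Longrightarrow> cls (\<lambda>x. f x - g x) = cls f - cls g"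
  by (simp add: cls_eq_abs minus_l2.abs_eq L2_eq_refl L2_diff)

lemma cls_scaleR: "f \<in> Lp_space 2 \<Longrightarrow> cls (\<lambda>x. c *\<^sub>R f x) = c *\<^sub>R cls f"
  by (simp add: cls_eq_abs scaleR_l2.abs_eq L2_eq_refl L2_scaleR)

lemma cls_zero [simp]: "cls (\<lambda>_. 0) = 0"
  by (simp add: cls_eq_abs L2_zero zero_l2.abs_eq)

lemma inner_cls: "f \<in> Lp_space 2 \<Longrightarrow> g \<in> Lp_space 2 \<Longrightarrow> inner (cls f) (cls g) = (LINT x|lborel. f x \<bullet> g x)"
  by (simp add: cls_eq_abs inner_l2.abs_eq L2_eq_refl)

lemma norm_cls: "f \<in> Lp_space 2 \<Longrightarrow> norm (cls f) = Lp_norm 2 f"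
  by (simp add: norm_eq_sqrt_inner inner_cls Lp_norm_2 power2_norm_eq_inner)

lemma norm_cls_sq: "f \<in> Lp_space 2 \<Longrightarrow> (norm (cls f))\<^sup>2 = (LINT x|lborel. (norm (f x))\<^sup>2)"
  by (simp add: power2_norm_eq_inner inner_cls)

lemma tendsto_L2_iff:
  fixes f :: "'i \<Rightarrow> 'a::euclidean_space \<Rightarrow> complex"
  shows "tendsto_L2 f g F \<longleftrightarrow>
    (\<forall>\<^sub>F i in F. f i \<in> Lp_space 2) \<and> g \<in> Lp_space 2 \<and> ((\<lambda>i. cls (f i)) \<longlongrightarrow> cls g) F"
proof -
  have "((\<lambda>i. Lp_norm 2 (\<lambda>x. f i x - g x)) \<longlongrightarrow> 0) F \<longleftrightarrow> ((\<lambda>i. cls (f i)) \<longlongrightarrow> cls g) F"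
    if ev: "\<forall>\<^sub>F i in F. f i \<in> Lp_space 2" and g: "g \<in> Lp_space 2"
  proof -
    have "\<forall>\<^sub>F i in F. Lp_norm 2 (\<lambda>x. f i x - g x) = dist (cls (f i)) (cls g)"
      using ev by eventually_elim (simp add: dist_norm g norm_cls[symmetric] cls_diff L2_diff)
    then have "((\<lambda>i. Lp_norm 2 (\<lambda>x. f i x - g x)) \<longlongrightarrow> 0) F \<longleftrightarrow> ((\<lambda>i. dist (cls (f i)) (cls g)) \<longlongrightarrow> 0) F"
      by (rule tendsto_cong)
    then show ?thesis unfolding tendsto_dist_iff[of "\<lambda>i. cls (f i)", symmetric] .
  qed
  then show ?thesis by (auto simp: tendsto_L2_def)
qed



section \<open>Plancherel's theorem\<close>

lemma tendsto_norm_diff_sq: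
  fixes x :: "'a::real_normed_vector"
  assumes "((\<lambda>i. (norm (X i - x))\<^sup>2) \<longlongrightarrow> 0) F"
  shows "(X \<longlongrightarrow> x) F"
  using tendsto_real_sqrt[OF assms] by (simp add: tendsto_norm_zero_iff LIM_zero_iff)

lemma borel_measurable_cis [measurable]: "cis \<in> borel_measurable borel"
  by (intro borel_measurable_continuous_onI continuous_intros)

lemma borel_measurable_cnj [measurable]: "cnj \<in> borel_measurable borel"
  by (intro borel_measurable_continuous_onI continuous_intros)

lemma fourier_integral_cis: "fourier_integral f \<xi> = (LINT x|lborel. cis (- (x \<bullet> \<xi>)) * f x)"
  by (simp add: fourier_integral_def cis_conv_exp)

lemma integrable_cis_mult:
  assumes u: "integrable lborel u" and [measurable]: "h \<in> borel_measurable borel"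
  shows "integrable lborel (\<lambda>x::'a::euclidean_space. cis (h x) * u x)"
proof -
  have [measurable]: "u \<in> borel_measurable borel" using u by auto
  show ?thesis by (rule Bochner_Integration.integrable_bound[OF u]) (auto intro!: AE_I2 simp: norm_mult)
qed

lemma fourier_integral_measurable [measurable]:
  assumes [measurable]: "f \<in> borel_measurable borel"
  shows "fourier_integral f \<in> borel_measurable borel"
  unfolding fourier_integral_cis[abs_def] by measurable

lemma fourier_integral_bound:
  "norm (fourier_integral f \<xi>) \<le> (LINT x|lborel. norm (f x))"
  unfolding fourier_integral_cis
  by (rule order_trans[OF integral_norm_bound]) (simp add: norm_mult)

text \<open>Fubini's theorem moves the transform from one factor to the other. The factor \<open>s\<close> allows for the
  forward and the backward transform at once.\<close>

lemma fourier_multiplication: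
  fixes u v :: "'a::euclidean_space \<Rightarrow> complex"
  assumes u: "integrable lborel u" and v: "integrable lborel v"
  shows "(LINT \<xi>|lborel. (LINT x|lborel. cis (s * (x \<bullet> \<xi>)) * u x) * v \<xi>) =
    (LINT x|lborel. u x * (LINT \<xi>|lborel. cis (s * (x \<bullet> \<xi>)) * v \<xi>))"
proof -
  have [measurable]: "u \<in> borel_measurable borel" "v \<in> borel_measurable borel" using u v by auto
  have int: "integrable (lborel \<Otimes>\<^sub>M lborel) (\<lambda>(x, \<xi>). cis (s * (x \<bullet> \<xi>)) * u x * v \<xi>)"
  proof (rule lborel_pair.Fubini_integrable)
    show "integrable lborel (\<lambda>x. LINT \<xi>|lborel. norm (case (x, \<xi>) of (x, \<xi>) \<Rightarrow> cis (s * (x \<bullet> \<xi>)) * u x * v \<xi>))"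
      using u by (simp add: norm_mult)
    show "AE x in lborel. integrable lborel (\<lambda>\<xi>. case (x, \<xi>) of (x, \<xi>) \<Rightarrow> cis (s * (x \<bullet> \<xi>)) * u x * v \<xi>)"
      using integrable_cis_mult[OF v, of "\<lambda>\<xi>. s * (x \<bullet> \<xi>)" for x]
      by (intro AE_I2) (simp add: mult.assoc mult.left_commute)
  qed measurable
  have "(LINT \<xi>|lborel. (LINT x|lborel. cis (s * (x \<bullet> \<xi>)) * u x) * v \<xi>) =
      (LINT \<xi>|lborel. (LINT x|lborel. cis (s * (x \<bullet> \<xi>)) * u x * v \<xi>))" by simp
  also have "\<dots> = (LINT x|lborel. (LINT \<xi>|lborel. cis (s * (x \<bullet> \<xi>)) * u x * v \<xi>))"
    by (rule lborel_pair.Fubini_integral[OF int])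
  also have "\<dots> = (LINT x|lborel. u x * (LINT \<xi>|lborel. cis (s * (x \<bullet> \<xi>)) * v \<xi>))"
    unfolding integral_mult_right_zero[symmetric] by (simp add: mult_ac)
  finally show ?thesis .
qed

lemma
  fixes f :: "'a::euclidean_space \<Rightarrow> real \<Rightarrow> complex"
  assumes f: "\<And>b. b \<in> Basis \<Longrightarrow> integrable lborel (f b)"
  shows integral_prod_Basis: "(LINT x|lborel. (\<Prod>b\<in>Basis. f b (x \<bullet> b))) = (\<Prod>b\<in>Basis. (LINT t|lborel. f b t))"
    and integrable_prod_Basis: "integrable lborel (\<lambda>x::'a. \<Prod>b\<in>Basis. f b (x \<bullet> b))"
proof -
  interpret product_sigma_finite "\<lambda>_::'a. lborel :: real measure" by standard
  have [measurable]: "f b \<in> borel_measurable borel" if "b \<in> Basis" for b using f[OF that] by auto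
  have eq: "(\<lambda>y. \<Prod>b\<in>Basis. f b ((\<Sum>b\<in>Basis. y b *\<^sub>R b) \<bullet> b)) = (\<lambda>y. \<Prod>b\<in>Basis. f b (y b))"
    by (intro ext prod.cong) (auto simp: inner_sum_left inner_Basis if_distrib cong: if_cong)
  have meas: "(\<lambda>x. \<Prod>b\<in>Basis. f b (x \<bullet> b)) \<in> borel_measurable borel" by measurable
  have sm: "(\<lambda>y. \<Sum>b\<in>Basis. y b *\<^sub>R b) \<in> measurable (\<Pi>\<^sub>M b\<in>(Basis::'a set). (lborel::real measure)) borel"
    by measurable
  show "(LINT x|lborel. (\<Prod>b\<in>Basis. f b (x \<bullet> b))) = (\<Prod>b\<in>Basis. (LINT t|lborel. f b t))"
    by (subst lborel_eq) (simp add: integral_distr[OF sm meas] eq product_integral_prod f)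
  show "integrable lborel (\<lambda>x::'a. \<Prod>b\<in>Basis. f b (x \<bullet> b))"
    by (subst lborel_eq) (simp add: integrable_distr_eq[OF sm meas] eq product_integrable_prod f)
qed

definition gauss :: "'a::euclidean_space \<Rightarrow> real"
  where "gauss x = exp (- (norm x)\<^sup>2 / 2)"

lemma gauss_measurable [measurable]: "gauss \<in> borel_measurable borel"
  unfolding gauss_def[abs_def] by measurable

text \<open>The characteristic function of the standard normal distribution, without its normalisation.\<close>

lemma gauss_real:
  shows integral_cis_gauss_real:
      "(LINT t|lborel. cis (- (z * t)) * complex_of_real (exp (- t\<^sup>2 / 2))) =
        complex_of_real (sqrt (2 * pi) * exp (- z\<^sup>2 / 2))"
    and integrable_cis_gauss_real:
      "integrable lborel (\<lambda>t. cis (- (z * t)) * complex_of_real (exp (- t\<^sup>2 / 2)))"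
proof -
  have s: "sqrt (2 * pi) * std_normal_density t = exp (- t\<^sup>2 / 2)" for t
    by (simp add: std_normal_density_def)
  have "complex_of_real (exp (- z\<^sup>2 / 2)) = char std_normal_distribution (- z)"
    by (simp add: char_std_normal_distribution)
  also have "\<dots> = (LINT t|lborel. std_normal_density t *\<^sub>R cis (- (z * t)))"
    unfolding char_def by (subst integral_density) (auto simp: cis_conv_exp)
  finally have "complex_of_real (sqrt (2 * pi)) * complex_of_real (exp (- z\<^sup>2 / 2)) =
     complex_of_real (sqrt (2 * pi)) * (LINT t|lborel. std_normal_density t *\<^sub>R cis (- (z * t)))" by simp
  also have "\<dots> = (LINT t|lborel. complex_of_real (sqrt (2 * pi)) * (std_normal_density t *\<^sub>R cis (- (z * t))))"
    by (rule integral_mult_right_zero[symmetric])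
  also have "\<dots> = (LINT t|lborel. cis (- (z * t)) * complex_of_real (exp (- t\<^sup>2 / 2)))"
    unfolding s[symmetric] by (simp add: scaleR_conv_of_real mult_ac)
  finally show "(LINT t|lborel. cis (- (z * t)) * complex_of_real (exp (- t\<^sup>2 / 2))) =
        complex_of_real (sqrt (2 * pi) * exp (- z\<^sup>2 / 2))" by simp
  have "integrable lborel (\<lambda>t. complex_of_real (sqrt (2 * pi) * std_normal_density t))"
    using integrable_normal_moment[of 0 1 0] by (intro integrable_of_real) simp
  then show "integrable lborel (\<lambda>t. cis (- (z * t)) * complex_of_real (exp (- t\<^sup>2 / 2)))"
    unfolding s by (intro integrable_cis_mult) measurable
qed

lemma
  fixes z :: "'a::euclidean_space"
  shows fourier_gauss: "(LINT \<xi>|lborel. cis (- (z \<bullet> \<xi>)) * complex_of_real (gauss \<xi>)) =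
      complex_of_real (sqrt (2 * pi) ^ DIM('a) * gauss z)"
    and integrable_cis_gauss: "integrable lborel (\<lambda>\<xi>. cis (- (z \<bullet> \<xi>)) * complex_of_real (gauss \<xi>))"
proof -
  define f where "f b t = cis (- ((z \<bullet> b) * t)) * complex_of_real (exp (- t\<^sup>2 / 2))" for b t
  have f: "integrable lborel (f b)" for b unfolding f_def[abs_def] by (rule integrable_cis_gauss_real)
  have g: "exp (- (norm x)\<^sup>2 / 2) = (\<Prod>b\<in>Basis. exp (- (x \<bullet> b)\<^sup>2 / 2))" for x :: 'a
  proof -
    have "(norm x)\<^sup>2 = (\<Sum>b\<in>Basis. (x \<bullet> b)\<^sup>2)"
      unfolding power2_norm_eq_inner by (subst euclidean_inner) (simp add: power2_eq_square)
    then have "- (norm x)\<^sup>2 / 2 = (\<Sum>b\<in>Basis. - (x \<bullet> b)\<^sup>2 / 2)"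
      by (simp add: sum_negf sum_divide_distrib[symmetric])
    then show ?thesis by (simp add: exp_sum)
  qed
  have c: "cis (- (z \<bullet> x)) = (\<Prod>b\<in>Basis. cis (- ((z \<bullet> b) * (x \<bullet> b))))" for x
  proof -
    have "\<i> * complex_of_real (- (z \<bullet> x)) = (\<Sum>b\<in>Basis. \<i> * complex_of_real (- ((z \<bullet> b) * (x \<bullet> b))))"
      unfolding euclidean_inner[of z x] by (simp add: sum_negf sum_distrib_left)
    then show ?thesis unfolding cis_conv_exp by (simp add: exp_sum)
  qed
  have eq: "cis (- (z \<bullet> \<xi>)) * complex_of_real (gauss \<xi>) = (\<Prod>b\<in>Basis. f b (\<xi> \<bullet> b))" for \<xi>
    unfolding gauss_def g c f_def by (simp add: prod.distrib)
  show "(LINT \<xi>|lborel. cis (- (z \<bullet> \<xi>)) * complex_of_real (gauss \<xi>)) =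
      complex_of_real (sqrt (2 * pi) ^ DIM('a) * gauss z)"
    unfolding eq integral_prod_Basis[OF f] unfolding f_def integral_cis_gauss_real
    unfolding gauss_def g by (simp add: prod.distrib)
  show "integrable lborel (\<lambda>\<xi>. cis (- (z \<bullet> \<xi>)) * complex_of_real (gauss \<xi>))"
    unfolding eq by (rule integrable_prod_Basis[OF f])
qed

text \<open>The Gaussian is its own transform up to a factor, and $\sqrt{2\pi}^{\,d}$ is also its integral.\<close>

definition gauss_kernel :: "'a::euclidean_space \<Rightarrow> real"
  where "gauss_kernel x = gauss x / sqrt (2 * pi) ^ DIM('a)"

lemma gauss_kernel_measurable [measurable]: "gauss_kernel \<in> borel_measurable borel"
  unfolding gauss_kernel_def[abs_def] by measurable

lemma integrable_gauss: "integrable lborel (gauss :: 'a::euclidean_space \<Rightarrow> real)"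
  using integrable_cis_gauss[of "0::'a"] integrable_norm[OF integrable_cis_gauss[of "0::'a"]]
  by (simp add: gauss_def[abs_def])

lemma mollifying_kernel_gauss: "mollifying_kernel (gauss_kernel :: 'a::euclidean_space \<Rightarrow> real)"
proof -
  have "complex_of_real (LINT \<xi>|lborel. gauss (\<xi>::'a)) = complex_of_real (sqrt (2 * pi) ^ DIM('a))"
    using fourier_gauss[of "0::'a"] by (simp add: gauss_def)
  then have "(LINT \<xi>|lborel. gauss (\<xi>::'a)) = sqrt (2 * pi) ^ DIM('a)" by (rule of_real_eq_iff[THEN iffD1])
  then show ?thesis
    using integrable_gauss by (auto simp: mollifying_kernel_def gauss_kernel_def[abs_def] gauss_def[abs_def])
qed

lemma integrable_gauss_scaled:
  assumes "\<epsilon> \<noteq> 0"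
  shows "integrable lborel (\<lambda>\<xi>::'a::euclidean_space. gauss (\<epsilon> *\<^sub>R \<xi>))"
proof -
  have "(\<integral>\<^sup>+\<xi>. ennreal (gauss (\<xi>::'a)) \<partial>lborel) =
      ennreal (\<bar>\<epsilon>\<bar> ^ DIM('a)) * (\<integral>\<^sup>+\<xi>. ennreal (gauss (\<epsilon> *\<^sub>R \<xi>::'a)) \<partial>lborel)"
    using nn_integral_lborel_affine[OF assms, of "\<lambda>\<xi>. ennreal (gauss \<xi>)" 0] by simp
  moreover have "(\<integral>\<^sup>+\<xi>. ennreal (gauss (\<xi>::'a)) \<partial>lborel) < \<infinity>"
    using integrable_gauss[where 'a='a] by (simp add: integrable_iff_bounded gauss_def)
  ultimately have "(\<integral>\<^sup>+\<xi>. ennreal (gauss (\<epsilon> *\<^sub>R \<xi>::'a)) \<partial>lborel) < \<infinity>"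
    using assms by (auto simp: ennreal_mult_less_top)
  then show ?thesis by (simp add: integrable_iff_bounded gauss_def)
qed

lemma fourier_gauss_scaled:
  fixes z :: "'a::euclidean_space"
  assumes e: "\<epsilon> > 0"
  shows "(LINT \<xi>|lborel. cis (- (z \<bullet> \<xi>)) * complex_of_real (gauss (\<epsilon> *\<^sub>R \<xi>))) =
    complex_of_real ((2 * pi) ^ DIM('a) * mollifying_net gauss_kernel \<epsilon> z)"
proof -
  have "(LINT \<xi>|lborel. cis (- (z \<bullet> \<xi>)) * complex_of_real (gauss (\<epsilon> *\<^sub>R \<xi>))) =
      \<bar>1 / \<epsilon>\<bar> ^ DIM('a) *\<^sub>R (LINT \<xi>|lborel. cis (- (z \<bullet> (0 + (1 / \<epsilon>) *\<^sub>R \<xi>))) *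
        complex_of_real (gauss (\<epsilon> *\<^sub>R (0 + (1 / \<epsilon>) *\<^sub>R \<xi>))))"
    using e by (intro integral_lborel_affine) auto
  also have "\<dots> = (1 / \<epsilon>) ^ DIM('a) *\<^sub>R (LINT \<xi>|lborel. cis (- ((z /\<^sub>R \<epsilon>) \<bullet> \<xi>)) * complex_of_real (gauss \<xi>))"
    using e by (simp add: divide_inverse)
  also have "\<dots> = (1 / \<epsilon>) ^ DIM('a) *\<^sub>R complex_of_real (sqrt (2 * pi) ^ DIM('a) * gauss (z /\<^sub>R \<epsilon>))"
    unfolding fourier_gauss ..
  also have "\<dots> = complex_of_real ((sqrt (2 * pi) * sqrt (2 * pi)) ^ DIM('a) * mollifying_net gauss_kernel \<epsilon> z)"
    using e unfolding mollifying_net_def gauss_kernel_def power_mult_distrib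
    by (simp add: scaleR_conv_of_real field_simps)
  finally show ?thesis by simp
qed

lemma Re_of_real_mult: "Re (complex_of_real r * z) = r * Re z"
  by simp

lemma cnj_fourier_integral: "cnj (fourier_integral f \<xi>) = (LINT x|lborel. cis (1 * (x \<bullet> \<xi>)) * cnj (f x))"
  unfolding fourier_integral_cis Bochner_Integration.integral_cnj[symmetric] by (simp add: cis_cnj del: Bochner_Integration.integral_cnj)

text \<open>The Gaussian factor makes the frequency integral absolutely convergent for integrable \<open>f\<close>, so the
  transform of $\hat f$ may be computed by moving it onto the Gaussian, whose transform is a mollifier.\<close>

lemma plancherel_regularised:
  fixes f :: "'a::euclidean_space \<Rightarrow> complex"
  assumes f: "integrable lborel f" and f2: "f \<in> Lp_space 2" and e: "\<epsilon> > 0"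
  shows "(LINT \<xi>|lborel. (norm (fourier_integral f \<xi>))\<^sup>2 * gauss (\<epsilon> *\<^sub>R \<xi>)) =
    (2 * pi) ^ DIM('a) * (LINT x|lborel. f x \<bullet> convolution f (mollifying_net gauss_kernel \<epsilon>) x)"
proof -
  let ?F = "fourier_integral f" and ?g = "convolution f (mollifying_net gauss_kernel \<epsilon>)"
    and ?c = "complex_of_real ((2 * pi) ^ DIM('a))"
  have [measurable]: "f \<in> borel_measurable borel" using f by auto
  have ig: "integrable lborel (\<lambda>\<xi>::'a. complex_of_real (gauss (\<epsilon> *\<^sub>R \<xi>)))"
    using integrable_gauss_scaled[of \<epsilon>] e by (intro integrable_of_real) simp
  define v where "v \<xi> = complex_of_real (gauss (\<epsilon> *\<^sub>R \<xi>)) * cnj (?F \<xi>)" for \<xi>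
  have [measurable]: "v \<in> borel_measurable borel" unfolding v_def[abs_def] by measurable
  have v: "integrable lborel v"
  proof (rule Bochner_Integration.integrable_bound)
    show "integrable lborel (\<lambda>\<xi>. (LINT x|lborel. norm (f x)) * gauss (\<epsilon> *\<^sub>R \<xi>))"
      using integrable_gauss_scaled[of \<epsilon>] e by (intro integrable_mult_right) simp
    show "AE \<xi> in lborel. norm (v \<xi>) \<le> norm ((LINT x|lborel. norm (f x)) * gauss (\<epsilon> *\<^sub>R \<xi>))"
      using fourier_integral_bound[of f] by (intro AE_I2) (simp add: v_def norm_mult gauss_def)
  qed measurable
  have inner: "(LINT \<xi>|lborel. cis (- 1 * (x \<bullet> \<xi>)) * v \<xi>) = ?c * cnj (?g x)" for x
  proof -
    have icf: "integrable lborel (\<lambda>y. cnj (f y))" using f by simp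
    have iv: "integrable lborel (\<lambda>\<xi>. cis (- (x \<bullet> \<xi>)) * complex_of_real (gauss (\<epsilon> *\<^sub>R \<xi>)))"
      by (rule integrable_cis_mult[OF ig]) measurable
    have "(LINT \<xi>|lborel. cis (- 1 * (x \<bullet> \<xi>)) * v \<xi>) =
       (LINT \<xi>|lborel. (LINT y|lborel. cis (1 * (y \<bullet> \<xi>)) * cnj (f y)) *
         (cis (- (x \<bullet> \<xi>)) * complex_of_real (gauss (\<epsilon> *\<^sub>R \<xi>))))"
      unfolding v_def cnj_fourier_integral by (intro Bochner_Integration.integral_cong) simp_all
    also have "\<dots> = (LINT y|lborel. cnj (f y) * (LINT \<xi>|lborel. cis (1 * (y \<bullet> \<xi>)) *
         (cis (- (x \<bullet> \<xi>)) * complex_of_real (gauss (\<epsilon> *\<^sub>R \<xi>)))))"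
      by (rule fourier_multiplication[OF icf iv])
    also have "\<dots> = (LINT y|lborel. cnj (f y) * (LINT \<xi>|lborel. cis (- ((x - y) \<bullet> \<xi>)) *
         complex_of_real (gauss (\<epsilon> *\<^sub>R \<xi>))))"
      unfolding mult.assoc[symmetric] cis_mult by (simp add: inner_diff_left)
    also have "\<dots> = (LINT y|lborel. ?c * cnj (mollifying_net gauss_kernel \<epsilon> (x - y) *\<^sub>R f y))"
      unfolding fourier_gauss_scaled[OF e]
      by (intro Bochner_Integration.integral_cong) (simp_all add: scaleR_conv_of_real)
    also have "\<dots> = ?c * cnj (?g x)"
      unfolding integral_mult_right_zero Bochner_Integration.integral_cnj convolution_def ..
    finally show ?thesis .
  qed
  have g2: "?g \<in> Lp_space 2" using convolution_Lp[OF _ f2 mollifying_kernel_gauss e] by simp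
  then have [measurable]: "?g \<in> borel_measurable borel" by (simp add: L2_iff)
  have ifg: "integrable lborel (\<lambda>x. f x * cnj (?g x))"
    by (rule Bochner_Integration.integrable_bound[OF L2_mult_integrable[OF f2 g2]])
       (auto intro!: AE_I2 simp: norm_mult)
  have "complex_of_real (LINT \<xi>|lborel. (norm (?F \<xi>))\<^sup>2 * gauss (\<epsilon> *\<^sub>R \<xi>)) = (LINT \<xi>|lborel. ?F \<xi> * v \<xi>)"
    unfolding integral_complex_of_real[symmetric] v_def
    by (intro Bochner_Integration.integral_cong) (simp_all add: complex_norm_square[symmetric] mult_ac)
  also have "\<dots> = (LINT x|lborel. f x * (LINT \<xi>|lborel. cis (- 1 * (x \<bullet> \<xi>)) * v \<xi>))"
    using fourier_multiplication[OF f v, of "-1"] by (simp add: fourier_integral_cis)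
  also have "\<dots> = ?c * (LINT x|lborel. f x * cnj (?g x))"
    unfolding inner integral_mult_right_zero[symmetric] by (simp add: mult_ac)
  finally have "complex_of_real (LINT \<xi>|lborel. (norm (?F \<xi>))\<^sup>2 * gauss (\<epsilon> *\<^sub>R \<xi>)) =
    ?c * (LINT x|lborel. f x * cnj (?g x))" .
  then have "(LINT \<xi>|lborel. (norm (?F \<xi>))\<^sup>2 * gauss (\<epsilon> *\<^sub>R \<xi>)) =
      Re (?c * (LINT x|lborel. f x * cnj (?g x)))" by (metis Re_complex_of_real)
  also have "\<dots> = (2 * pi) ^ DIM('a) * Re (LINT x|lborel. f x * cnj (?g x))"
    by (rule Re_of_real_mult)
  also have "Re (LINT x|lborel. f x * cnj (?g x)) = (LINT x|lborel. f x \<bullet> ?g x)"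
    using integral_Re[OF ifg] by (simp add: inner_complex_def)
  finally show ?thesis .
qed

text \<open>Let the Gaussian cutoff tend to one: monotone convergence applies on the frequency side, and on the
  other side the mollifications of \<open>f\<close> converge to \<open>f\<close> in $L^2$.\<close>

lemma plancherel_L1_L2:
  fixes f :: "'a::euclidean_space \<Rightarrow> complex"
  assumes f: "integrable lborel f" and f2: "f \<in> Lp_space 2"
  shows "fourier_integral f \<in> Lp_space 2"
    and "(LINT \<xi>|lborel. (norm (fourier_integral f \<xi>))\<^sup>2) = (2 * pi) ^ DIM('a) * (LINT x|lborel. (norm (f x))\<^sup>2)"
proof -
  let ?F = "fourier_integral f" and ?g = "\<lambda>\<epsilon>. convolution f (mollifying_net gauss_kernel \<epsilon>)"
  define e where "e n = 1 / real (Suc n)" for n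
  have e: "e n > 0" for n by (simp add: e_def)
  have e0: "e \<longlonglongrightarrow> 0" unfolding e_def using LIMSEQ_inverse_real_of_nat by (simp add: inverse_eq_divide)
  have [measurable]: "f \<in> borel_measurable borel" using f by auto
  have g2: "?g (e n) \<in> Lp_space 2" for n using convolution_Lp[OF _ f2 mollifying_kernel_gauss e] by simp
  have eright: "filterlim e (at_right 0) sequentially"
    unfolding filterlim_at using e0 e by (auto intro!: always_eventually simp: less_imp_neq[symmetric] order_less_imp_not_eq2)
  have "(\<lambda>n. LINT x|lborel. norm (?g (e n) x - f x) powr 2) \<longlonglongrightarrow> 0"
    using filterlim_compose[OF convolution_tendsto_Lp[OF _ f2 mollifying_kernel_gauss] eright] by simp
  then have "(\<lambda>n. (norm (cls (?g (e n)) - cls f))\<^sup>2) \<longlonglongrightarrow> 0"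
    by (simp add: cls_diff[symmetric] g2 f2 norm_cls_sq L2_diff)
  then have "(\<lambda>n. cls (?g (e n))) \<longlonglongrightarrow> cls f" by (rule tendsto_norm_diff_sq)
  then have "(\<lambda>n. inner (cls f) (cls (?g (e n)))) \<longlonglongrightarrow> inner (cls f) (cls f)"
    by (intro tendsto_intros)
  then have lim: "(\<lambda>n. (2 * pi) ^ DIM('a) * (LINT x|lborel. f x \<bullet> ?g (e n) x)) \<longlonglongrightarrow>
      (2 * pi) ^ DIM('a) * (LINT x|lborel. (norm (f x))\<^sup>2)"
    by (intro tendsto_intros) (simp add: inner_cls f2 g2 power2_norm_eq_inner)
  have int: "integrable lborel (\<lambda>\<xi>. (norm (?F \<xi>))\<^sup>2 * gauss (e n *\<^sub>R \<xi>))" for n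
  proof (rule Bochner_Integration.integrable_bound)
    show "integrable lborel (\<lambda>\<xi>::'a. (LINT x|lborel. norm (f x))\<^sup>2 * gauss (e n *\<^sub>R \<xi>))"
      using e[of n] by (intro integrable_mult_right integrable_gauss_scaled) auto
    show "AE \<xi> in lborel. norm ((norm (?F \<xi>))\<^sup>2 * gauss (e n *\<^sub>R \<xi>)) \<le> norm ((LINT x|lborel. norm (f x))\<^sup>2 * gauss (e n *\<^sub>R \<xi>))"
      using power_mono[OF fourier_integral_bound[of f], of _ 2]
      by (intro AE_I2) (simp add: gauss_def abs_mult)
  qed measurable
  have mono: "mono (\<lambda>n. (norm (?F \<xi>))\<^sup>2 * gauss (e n *\<^sub>R \<xi>))" for \<xi>
  proof (rule monoI)
    fix m n :: nat assume "m \<le> n"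
    then have "e n \<le> e m" by (simp add: e_def frac_le)
    then have "(e n * norm \<xi>)\<^sup>2 \<le> (e m * norm \<xi>)\<^sup>2"
      using e[of n] by (intro power_mono mult_right_mono) auto
    then show "(norm (?F \<xi>))\<^sup>2 * gauss (e m *\<^sub>R \<xi>) \<le> (norm (?F \<xi>))\<^sup>2 * gauss (e n *\<^sub>R \<xi>)"
      using e[of n] e[of m] by (intro mult_left_mono) (auto simp: gauss_def)
  qed
  have ptw: "(\<lambda>n. (norm (?F \<xi>))\<^sup>2 * gauss (e n *\<^sub>R \<xi>)) \<longlonglongrightarrow> (norm (?F \<xi>))\<^sup>2" for \<xi>
  proof -
    have "(\<lambda>n. (norm (?F \<xi>))\<^sup>2 * exp (- (norm (e n *\<^sub>R \<xi>))\<^sup>2 / 2)) \<longlonglongrightarrow>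
        (norm (?F \<xi>))\<^sup>2 * exp (- (norm (0 *\<^sub>R \<xi>))\<^sup>2 / 2)"
      by (intro tendsto_intros e0) simp
    then show ?thesis by (simp add: gauss_def)
  qed
  have ilim: "(\<lambda>n. LINT \<xi>|lborel. (norm (?F \<xi>))\<^sup>2 * gauss (e n *\<^sub>R \<xi>)) \<longlonglongrightarrow>
      (2 * pi) ^ DIM('a) * (LINT x|lborel. (norm (f x))\<^sup>2)"
    unfolding plancherel_regularised[OF f f2 e] by (rule lim)
  have m: "(\<lambda>\<xi>. (norm (?F \<xi>))\<^sup>2) \<in> borel_measurable lborel" by measurable
  note mc = integral_monotone_convergence[OF int AE_I2[OF mono] AE_I2[OF ptw] ilim m]
  show "(LINT \<xi>|lborel. (norm (fourier_integral f \<xi>))\<^sup>2) = (2 * pi) ^ DIM('a) * (LINT x|lborel. (norm (f x))\<^sup>2)"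
    by (rule mc)
  have "integrable lborel (\<lambda>\<xi>. (norm (?F \<xi>))\<^sup>2)"
    by (rule integrable_monotone_convergence[OF int AE_I2[OF mono] AE_I2[OF ptw] ilim m])
  then show "?F \<in> Lp_space 2" by (simp add: L2_iff)
qed


section \<open>The Fourier transform on square-integrable functions\<close>

definition truncate :: "real \<Rightarrow> ('a::euclidean_space \<Rightarrow> complex) \<Rightarrow> 'a \<Rightarrow> complex"
  where "truncate R f = (\<lambda>x. indicator (cball 0 R) x *\<^sub>R f x)"

lemma
  fixes f :: "'a::euclidean_space \<Rightarrow> complex"
  assumes f: "f \<in> Lp_space 2"
  shows truncate_L2: "truncate R f \<in> Lp_space 2"
    and truncate_integrable: "integrable lborel (truncate R f)"
proof -
  have [measurable]: "f \<in> borel_measurable borel" and i: "integrable lborel (\<lambda>x. (norm (f x))\<^sup>2)"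
    using f by (auto simp: L2_iff)
  have [measurable]: "truncate R f \<in> borel_measurable borel" unfolding truncate_def
    by (intro borel_measurable_scaleR borel_measurable_indicator) auto
  have le: "norm (truncate R f x) \<le> norm (f x)" for x
    by (simp add: truncate_def split: split_indicator)
  have "integrable lborel (\<lambda>x. (norm (truncate R f x))\<^sup>2)"
  proof (rule Bochner_Integration.integrable_bound[OF i])
    show "AE x in lborel. norm ((norm (truncate R f x))\<^sup>2) \<le> norm ((norm (f x))\<^sup>2)"
      using power_mono[OF le norm_ge_zero, of _ 2] by (intro AE_I2) simp
  qed measurable
  then show "truncate R f \<in> Lp_space 2" by (simp add: L2_iff)
  have b: "integrable lborel (indicator (cball 0 R) :: 'a \<Rightarrow> real)"
    by (intro integrable_real_indicator) (simp_all add: emeasure_bounded_finite[unfolded infinity_ennreal_def])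
  have a: "a \<le> 1 + a\<^sup>2" for a :: real
    using zero_le_power2[of "a - 1/2"] by (simp add: power2_eq_square algebra_simps)
  show "integrable lborel (truncate R f)"
  proof (rule Bochner_Integration.integrable_bound[OF Bochner_Integration.integrable_add[OF b i]])
    show "AE x in lborel. norm (truncate R f x) \<le> norm (indicator (cball 0 R) x + (norm (f x))\<^sup>2)"
      using a[of "norm (f x)" for x] by (intro AE_I2) (simp add: truncate_def split: split_indicator)
  qed measurable
qed

lemma cls_truncate_tendsto:
  fixes f :: "'a::euclidean_space \<Rightarrow> complex"
  assumes f: "f \<in> Lp_space 2"
  shows "((\<lambda>R. cls (truncate R f)) \<longlongrightarrow> cls f) at_top"
proof -
  have [measurable]: "f \<in> borel_measurable borel" and i: "integrable lborel (\<lambda>x. (norm (f x))\<^sup>2)"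
    using f by (auto simp: L2_iff)
  have [measurable]: "truncate R f \<in> borel_measurable borel" for R unfolding truncate_def
    by (intro borel_measurable_scaleR borel_measurable_indicator) auto
  have "((\<lambda>R. LINT x|lborel. (norm (truncate R f x - f x))\<^sup>2) \<longlongrightarrow> (LINT x|(lborel :: 'a measure). (0::real))) at_top"
  proof (rule integral_dominated_convergence_at_top[where w="\<lambda>x. (norm (f x))\<^sup>2"])
    show "AE x in lborel. ((\<lambda>R. (norm (truncate R f x - f x))\<^sup>2) \<longlongrightarrow> 0) at_top"
    proof (rule AE_I2)
      fix x :: 'a
      have "\<forall>\<^sub>F R in at_top. (norm (truncate R f x - f x))\<^sup>2 = 0"
        using eventually_ge_at_top[of "norm x"] by eventually_elim (simp add: truncate_def)
      then show "((\<lambda>R. (norm (truncate R f x - f x))\<^sup>2) \<longlongrightarrow> 0) at_top" by (rule tendsto_eventually)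
    qed
    show "\<forall>\<^sub>F R in at_top. AE x in lborel. norm ((norm (truncate R f x - f x))\<^sup>2) \<le> (norm (f x))\<^sup>2"
      by (intro always_eventually allI AE_I2) (auto simp: truncate_def split: split_indicator)
  qed (use i in auto)
  then have "((\<lambda>R. (norm (cls (truncate R f) - cls f))\<^sup>2) \<longlongrightarrow> 0) at_top"
    by (simp add: cls_diff[symmetric] f truncate_L2 norm_cls_sq L2_diff)
  then show ?thesis by (rule tendsto_norm_diff_sq)
qed

lemma norm_cls_fourier_integral:
  fixes f :: "'a::euclidean_space \<Rightarrow> complex"
  assumes f: "integrable lborel f" and f2: "f \<in> Lp_space 2"
  shows "norm (cls (fourier_integral f)) = sqrt ((2 * pi) ^ DIM('a)) * norm (cls f)"
  using plancherel_L1_L2[OF f f2] f2 by (simp add: norm_cls Lp_norm_2 real_sqrt_mult)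

lemma fourier_integral_add:
  assumes "integrable lborel f" "integrable lborel g"
  shows "fourier_integral (\<lambda>x. f x + g x) = (\<lambda>\<xi>. fourier_integral f \<xi> + fourier_integral g \<xi>)"
  unfolding fourier_integral_cis distrib_left
  by (intro ext Bochner_Integration.integral_add integrable_cis_mult assms) measurable

lemma fourier_integral_scaleR: "fourier_integral (\<lambda>x. c *\<^sub>R f x) = (\<lambda>\<xi>. c *\<^sub>R fourier_integral f \<xi>)"
  by (intro ext) (simp add: fourier_integral_cis)

lemma fourier_truncate_L2: "f \<in> Lp_space 2 \<Longrightarrow> fourier_integral (truncate R f) \<in> Lp_space 2"
  by (rule plancherel_L1_L2(1)[OF truncate_integrable truncate_L2])

lemma has_fourier_transform_iff:
  "has_fourier_transform f F \<longleftrightarrow> f \<in> Lp_space 2 \<and> F \<in> Lp_space 2 \<and>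
    ((\<lambda>R. cls (fourier_integral (truncate R f))) \<longlongrightarrow> cls F) at_top"
  by (auto simp: fourier_truncate_L2 has_fourier_transform_def tendsto_L2_iff truncate_def[symmetric] intro!: always_eventually)

lemma has_ft_L2: "has_fourier_transform f F \<Longrightarrow> f \<in> Lp_space 2" "has_fourier_transform f F \<Longrightarrow> F \<in> Lp_space 2"
  by (simp_all add: has_fourier_transform_iff)

lemma has_ft_add:
  assumes f: "has_fourier_transform f F" and g: "has_fourier_transform g G"
  shows "has_fourier_transform (\<lambda>x. f x + g x) (\<lambda>\<xi>. F \<xi> + G \<xi>)"
proof -
  note L2 = has_ft_L2[OF f] has_ft_L2[OF g]
  have "fourier_integral (truncate R (\<lambda>x. f x + g x)) =
      (\<lambda>\<xi>. fourier_integral (truncate R f) \<xi> + fourier_integral (truncate R g) \<xi>)" for R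
    using fourier_integral_add[OF truncate_integrable[OF L2(1), of R] truncate_integrable[OF L2(3), of R]]
    by (simp add: truncate_def scaleR_add_right)
  then have "cls (fourier_integral (truncate R (\<lambda>x. f x + g x))) =
      cls (fourier_integral (truncate R f)) + cls (fourier_integral (truncate R g))" for R
    by (simp add: cls_add fourier_truncate_L2 L2)
  then show ?thesis
    using f g L2 by (auto simp: has_fourier_transform_iff L2_add cls_add intro!: tendsto_add)
qed

lemma has_ft_scaleR:
  assumes f: "has_fourier_transform f F"
  shows "has_fourier_transform (\<lambda>x. c *\<^sub>R f x) (\<lambda>\<xi>. c *\<^sub>R F \<xi>)"
proof -
  note L2 = has_ft_L2[OF f]
  have "fourier_integral (truncate R (\<lambda>x. c *\<^sub>R f x)) = (\<lambda>\<xi>. c *\<^sub>R fourier_integral (truncate R f) \<xi>)" for R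
    using fourier_integral_scaleR[of c "truncate R f"] by (simp add: truncate_def mult.commute)
  then have "cls (fourier_integral (truncate R (\<lambda>x. c *\<^sub>R f x))) = c *\<^sub>R cls (fourier_integral (truncate R f))" for R
    by (simp add: cls_scaleR fourier_truncate_L2 L2)
  then show ?thesis
    using f L2 by (auto simp: has_fourier_transform_iff L2_scaleR cls_scaleR intro!: tendsto_scaleR)
qed

lemma has_ft_diff:
  assumes f: "has_fourier_transform f F" and g: "has_fourier_transform g G"
  shows "has_fourier_transform (\<lambda>x. f x - g x) (\<lambda>\<xi>. F \<xi> - G \<xi>)"
  using has_ft_add[OF f has_ft_scaleR[OF g, of "-1"]] by simp

lemma has_ft_norm:
  fixes f :: "'a::euclidean_space \<Rightarrow> complex"
  assumes f: "has_fourier_transform f F"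
  shows "norm (cls F) = sqrt ((2 * pi) ^ DIM('a)) * norm (cls f)"
proof (rule tendsto_unique[OF trivial_limit_at_top_linorder])
  note L2 = has_ft_L2[OF f]
  show "((\<lambda>R. norm (cls (fourier_integral (truncate R f)))) \<longlongrightarrow> norm (cls F)) at_top"
    using f by (intro tendsto_norm) (simp add: has_fourier_transform_iff)
  show "((\<lambda>R. norm (cls (fourier_integral (truncate R f)))) \<longlongrightarrow> sqrt ((2 * pi) ^ DIM('a)) * norm (cls f)) at_top"
    unfolding norm_cls_fourier_integral[OF truncate_integrable truncate_L2, OF L2(1) L2(1)]
    by (intro tendsto_intros cls_truncate_tendsto L2)
qed

text \<open>Polarisation of the isometry.\<close>

lemma has_ft_inner:
  fixes f :: "'a::euclidean_space \<Rightarrow> complex"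
  assumes f: "has_fourier_transform f F" and g: "has_fourier_transform g G"
  shows "inner (cls F) (cls G) = (2 * pi) ^ DIM('a) * inner (cls f) (cls g)"
proof -
  note L2 = has_ft_L2[OF f] has_ft_L2[OF g]
  have sq: "(norm (cls K))\<^sup>2 = (2 * pi) ^ DIM('a) * (norm (cls k))\<^sup>2"
    if "has_fourier_transform k K" for k K :: "'a \<Rightarrow> complex"
    unfolding has_ft_norm[OF that] by (simp add: power_mult_distrib)
  have add: "(norm (cls F + cls G))\<^sup>2 = (2 * pi) ^ DIM('a) * (norm (cls f + cls g))\<^sup>2"
    using sq[OF has_ft_add[OF f g]] by (simp add: cls_add L2)
  have "inner (cls F) (cls G) = ((norm (cls F + cls G))\<^sup>2 - (norm (cls F))\<^sup>2 - (norm (cls G))\<^sup>2) / 2"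
    by (rule dot_norm)
  also have "\<dots> = (2 * pi) ^ DIM('a) * (((norm (cls f + cls g))\<^sup>2 - (norm (cls f))\<^sup>2 - (norm (cls g))\<^sup>2) / 2)"
    unfolding add sq[OF f] sq[OF g] by (simp only: right_diff_distrib times_divide_eq_right)
  also have "\<dots> = (2 * pi) ^ DIM('a) * inner (cls f) (cls g)"
    by (simp only: dot_norm)
  finally show ?thesis .
qed

lemma has_ft_unique:
  assumes f: "has_fourier_transform f F" and g: "has_fourier_transform g G" and eq: "cls f = cls g"
  shows "cls F = cls G"
proof -
  note L2 = has_ft_L2[OF f] has_ft_L2[OF g]
  have "norm (cls F - cls G) = 0"
    using has_ft_norm[OF has_ft_diff[OF f g]] eq by (simp add: cls_diff L2)
  then show ?thesis by simp
qed

text \<open>The isometry gives injectivity up to null sets. It identifies a function that is specified through its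
  transform, such as a fractional Laplacian.\<close>

lemma has_ft_injective:
  fixes f :: "'a::euclidean_space \<Rightarrow> complex"
  assumes f: "has_fourier_transform f F" and g: "has_fourier_transform g G" and eq: "cls F = cls G"
  shows "cls f = cls g"
proof -
  note L2 = has_ft_L2[OF f] has_ft_L2[OF g]
  have "sqrt ((2 * pi) ^ DIM('a)) * norm (cls f - cls g) = 0"
    using has_ft_norm[OF has_ft_diff[OF f g]] eq by (simp add: cls_diff L2)
  then show ?thesis by simp
qed

text \<open>The Fourier transform, as a relation, is closed: the transforms of the truncations of \<open>f\<close> stay within
  a multiple of \<open>norm (f - f\<^sub>n)\<close> of those of \<open>f\<^sub>n\<close>, uniformly in the truncation radius.\<close>

lemma has_ft_closed:
  fixes f :: "'a::euclidean_space \<Rightarrow> complex"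
  assumes ft: "\<And>n::nat. has_fourier_transform (f' n) (F' n)"
    and f: "f \<in> Lp_space 2" "(\<lambda>n. cls (f' n)) \<longlonglongrightarrow> cls f"
    and F: "F \<in> Lp_space 2" "(\<lambda>n. cls (F' n)) \<longlonglongrightarrow> cls F"
  shows "has_fourier_transform f F"
proof -
  define C where "C = sqrt ((2 * pi) ^ DIM('a))"
  have C: "C > 0" by (simp add: C_def)
  let ?T = "\<lambda>R f. cls (fourier_integral (truncate R f))"
  note L2' = has_ft_L2[OF ft]
  have contr: "norm (?T R f - ?T R (f' n)) \<le> C * norm (cls f - cls (f' n))" for R n
  proof -
    note i = truncate_integrable[OF f(1), of R] truncate_integrable[OF L2'(1)[of n], of R]
      and t = truncate_L2[OF f(1), of R] truncate_L2[OF L2'(1)[of n], of R]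
    have eq: "fourier_integral (\<lambda>x. truncate R f x - truncate R (f' n) x) =
        (\<lambda>\<xi>. fourier_integral (truncate R f) \<xi> - fourier_integral (truncate R (f' n)) \<xi>)"
      using fourier_integral_add[OF i(1) integrable_scaleR_right[OF i(2), of "-1"]]
      unfolding fourier_integral_scaleR by simp
    have "?T R f - ?T R (f' n) = cls (fourier_integral (\<lambda>x. truncate R f x - truncate R (f' n) x))"
      unfolding eq using i t by (simp add: cls_diff plancherel_L1_L2)
    then have "norm (?T R f - ?T R (f' n)) = C * norm (cls (\<lambda>x. truncate R f x - truncate R (f' n) x))"
      using norm_cls_fourier_integral[OF Bochner_Integration.integrable_diff[OF i] L2_diff[OF t]]
      by (simp add: C_def)
    also have "norm (cls (\<lambda>x. truncate R f x - truncate R (f' n) x)) \<le> norm (cls (\<lambda>x. f x - f' n x))"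
    proof (rule power2_le_imp_le)
      have d: "integrable lborel (\<lambda>x. (norm (f x - f' n x))\<^sup>2)"
        using L2_diff[OF f(1) L2'(1)] by (simp add: L2_iff)
      have "integrable lborel (\<lambda>x. (norm (truncate R f x - truncate R (f' n) x))\<^sup>2)"
        using L2_diff[OF t] by (simp add: L2_iff)
      then have "(LINT x|lborel. (norm (truncate R f x - truncate R (f' n) x))\<^sup>2) \<le>
          (LINT x|lborel. (norm (f x - f' n x))\<^sup>2)"
        by (rule integral_mono[OF _ d]) (auto simp: truncate_def split: split_indicator)
      then show "(norm (cls (\<lambda>x. truncate R f x - truncate R (f' n) x)))\<^sup>2 \<le> (norm (cls (\<lambda>x. f x - f' n x)))\<^sup>2"
        by (simp add: norm_cls_sq L2_diff f L2' t)
    qed simp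
    finally show ?thesis using C by (simp add: cls_diff f L2')
  qed
  have "((\<lambda>R. ?T R f) \<longlongrightarrow> cls F) at_top"
  proof (rule tendstoI)
    fix e :: real assume e: "e > 0"
    have "\<forall>\<^sub>F n in sequentially. dist (cls (f' n)) (cls f) < e / (3 * C)"
      using e C by (intro tendstoD[OF f(2)]) simp
    moreover have "\<forall>\<^sub>F n in sequentially. dist (cls (F' n)) (cls F) < e / 3"
      using e by (intro tendstoD[OF F(2)]) simp
    ultimately have "\<forall>\<^sub>F n in sequentially. dist (cls (f' n)) (cls f) < e / (3 * C) \<and> dist (cls (F' n)) (cls F) < e / 3"
      by eventually_elim simp
    from eventually_happens'[OF sequentially_bot this]
    obtain n where n: "dist (cls (f' n)) (cls f) < e / (3 * C)" "dist (cls (F' n)) (cls F) < e / 3"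
      by (elim exE conjE)
    have "((\<lambda>R. ?T R (f' n)) \<longlongrightarrow> cls (F' n)) at_top" using ft[of n] by (simp add: has_fourier_transform_iff)
    then have "\<forall>\<^sub>F R in at_top. dist (?T R (f' n)) (cls (F' n)) < e / 3" using e by (intro tendstoD) simp_all
    then show "\<forall>\<^sub>F R in at_top. dist (?T R f) (cls F) < e"
    proof eventually_elim
      case (elim R)
      have "dist (cls f) (cls (f' n)) < e / (3 * C)" using n(1) by (subst dist_commute)
      then have "C * dist (cls f) (cls (f' n)) < C * (e / (3 * C))" using C by (rule mult_strict_left_mono)
      also have "C * (e / (3 * C)) = e / 3" using C by simp
      finally have "dist (?T R f) (?T R (f' n)) < e / 3"
        using contr[of R n] unfolding dist_norm by (rule le_less_trans[rotated])
      moreover have "dist (?T R f) (cls F) \<le> dist (?T R f) (?T R (f' n)) + dist (?T R (f' n)) (cls (F' n)) + dist (cls (F' n)) (cls F)"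
        using dist_triangle[of "?T R f" "cls F" "?T R (f' n)"] dist_triangle[of "?T R (f' n)" "cls F" "cls (F' n)"] by linarith
      ultimately show ?case using elim n(2) by linarith
    qed
  qed
  then show ?thesis using f F by (simp add: has_fourier_transform_iff)
qed

lemma has_ft_L1_L2:
  assumes f: "integrable lborel f" and f2: "f \<in> Lp_space 2"
  shows "has_fourier_transform f (fourier_integral f)"
proof -
  define C where "C = sqrt ((2 * pi) ^ DIM('a))"
  note t = truncate_integrable[OF f2] truncate_L2[OF f2]
  have "norm (cls (fourier_integral (truncate R f)) - cls (fourier_integral f)) =
      C * norm (cls (truncate R f) - cls f)" for R
  proof -
    have eq: "fourier_integral (\<lambda>x. truncate R f x - f x) =
        (\<lambda>\<xi>. fourier_integral (truncate R f) \<xi> - fourier_integral f \<xi>)"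
      using fourier_integral_add[OF t(1)[of R] integrable_scaleR_right[OF f, of "-1"]]
      unfolding fourier_integral_scaleR by simp
    show ?thesis
      using norm_cls_fourier_integral[OF Bochner_Integration.integrable_diff[OF t(1)[of R] f] L2_diff[OF t(2)[of R] f2]]
      unfolding eq using t f f2 by (simp add: cls_diff plancherel_L1_L2 C_def)
  qed
  moreover have "((\<lambda>R. C * norm (cls (truncate R f) - cls f)) \<longlongrightarrow> C * 0) at_top"
    by (intro tendsto_mult tendsto_const tendsto_norm_zero LIM_zero cls_truncate_tendsto f2)
  ultimately have "((\<lambda>R. norm (cls (fourier_integral (truncate R f)) - cls (fourier_integral f))) \<longlongrightarrow> 0) at_top"
    by simp
  then have "((\<lambda>R. cls (fourier_integral (truncate R f))) \<longlongrightarrow> cls (fourier_integral f)) at_top"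
    by (simp add: tendsto_norm_zero_iff LIM_zero_iff)
  then show ?thesis using f2 plancherel_L1_L2(1)[OF f f2] by (simp add: has_fourier_transform_iff)
qed



section \<open>Mollification and the fractional Laplacian\<close>

text \<open>Here \<open>\<psi>\<close> has to be rescaled: the multiplier of $\psi_\varepsilon$ is $\hat\psi(\varepsilon\xi)$.\<close>

lemma fourier_integral_convolution:
  fixes f :: "'a::euclidean_space \<Rightarrow> complex"
  assumes f: "integrable lborel f" and \<psi>: "mollifying_kernel \<psi>" and e: "\<epsilon> > 0"
  shows "fourier_integral (convolution f (mollifying_net \<psi> \<epsilon>)) \<xi> =
    fourier_integral (\<lambda>z. complex_of_real (\<psi> z)) (\<epsilon> *\<^sub>R \<xi>) * fourier_integral f \<xi>"
proof -
  have [measurable]: "\<psi> \<in> borel_measurable borel" and \<psi>0: "\<And>z. 0 \<le> \<psi> z" and i\<psi>: "integrable lborel \<psi>"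
    using \<psi> by (auto simp: mollifying_kernel_def)
  have [measurable]: "f \<in> borel_measurable borel" using f by auto
  define k where "k z x = cis (- (x \<bullet> \<xi>)) * (\<psi> z *\<^sub>R f (x - \<epsilon> *\<^sub>R z))" for z x
  have [measurable]: "(\<lambda>(z, x). k z x) \<in> borel_measurable (borel \<Otimes>\<^sub>M borel)"
    unfolding k_def by measurable
  have ft: "integrable lborel (\<lambda>x. f (x - \<epsilon> *\<^sub>R z))" for z by (rule integrable_lborel_translate[OF f])
  have nf: "(LINT x|lborel. norm (f (x - \<epsilon> *\<^sub>R z))) = (LINT x|lborel. norm (f x))" for z
    by (rule integral_lborel_translate) measurable
  have int: "integrable (lborel \<Otimes>\<^sub>M lborel) (\<lambda>(z, x). k z x)"
  proof (rule lborel_pair.Fubini_integrable)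
    show "integrable lborel (\<lambda>z. LINT x|lborel. norm (case (z, x) of (z, x) \<Rightarrow> k z x))"
      using i\<psi> \<psi>0 by (simp add: k_def norm_mult nf)
    show "AE z in lborel. integrable lborel (\<lambda>x. case (z, x) of (z, x) \<Rightarrow> k z x)"
      unfolding k_def prod.case by (intro AE_I2 integrable_cis_mult integrable_scaleR_right ft) measurable
  qed measurable
  have shift: "(LINT x|lborel. cis (- (x \<bullet> \<xi>)) * f (x - \<epsilon> *\<^sub>R z)) =
      cis (- (z \<bullet> (\<epsilon> *\<^sub>R \<xi>))) * fourier_integral f \<xi>" for z
  proof -
    have "(LINT x|lborel. cis (- (x \<bullet> \<xi>)) * f (x - \<epsilon> *\<^sub>R z)) =
        (LINT x|lborel. (\<lambda>x. cis (- ((x + \<epsilon> *\<^sub>R z) \<bullet> \<xi>)) * f x) (x - \<epsilon> *\<^sub>R z))" by simp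
    also have "\<dots> = (LINT x|lborel. cis (- ((x + \<epsilon> *\<^sub>R z) \<bullet> \<xi>)) * f x)"
      by (rule integral_lborel_translate) measurable
    also have "\<dots> = (LINT x|lborel. cis (- (z \<bullet> (\<epsilon> *\<^sub>R \<xi>))) * (cis (- (x \<bullet> \<xi>)) * f x))"
      unfolding mult.assoc[symmetric] cis_mult by (simp add: inner_add_left add.commute)
    also have "\<dots> = cis (- (z \<bullet> (\<epsilon> *\<^sub>R \<xi>))) * fourier_integral f \<xi>"
      unfolding fourier_integral_cis by (rule integral_mult_right_zero)
    finally show ?thesis .
  qed
  have conv: "convolution f (mollifying_net \<psi> \<epsilon>) x = (LINT z|lborel. \<psi> z *\<^sub>R f (x - \<epsilon> *\<^sub>R z))" for x
    by (rule convolution_mollifying_net_eq) (use e in auto)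
  have "fourier_integral (convolution f (mollifying_net \<psi> \<epsilon>)) \<xi> = (LINT x|lborel. (LINT z|lborel. k z x))"
    unfolding fourier_integral_cis k_def conv integral_mult_right_zero ..
  also have "\<dots> = (LINT z|lborel. (LINT x|lborel. k z x))"
    by (rule lborel_pair.Fubini_integral[OF int])
  also have "\<dots> = (LINT z|lborel. cis (- (z \<bullet> (\<epsilon> *\<^sub>R \<xi>))) * complex_of_real (\<psi> z) * fourier_integral f \<xi>)"
    unfolding k_def mult_scaleR_right integral_scaleR_right shift
    by (intro Bochner_Integration.integral_cong) (simp_all add: scaleR_conv_of_real)
  also have "\<dots> = fourier_integral (\<lambda>z. complex_of_real (\<psi> z)) (\<epsilon> *\<^sub>R \<xi>) * fourier_integral f \<xi>"
    by (simp add: fourier_integral_cis)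
  finally show ?thesis .
qed

lemma L2_multiplier:
  fixes F m :: "'a::euclidean_space \<Rightarrow> complex"
  assumes F: "F \<in> Lp_space 2" and [measurable]: "m \<in> borel_measurable borel" and m: "\<And>\<xi>. norm (m \<xi>) \<le> 1"
  shows "(\<lambda>\<xi>. m \<xi> * F \<xi>) \<in> Lp_space 2"
    and "norm (cls (\<lambda>\<xi>. m \<xi> * F \<xi>)) \<le> norm (cls F)"
proof -
  have [measurable]: "F \<in> borel_measurable borel" and i: "integrable lborel (\<lambda>\<xi>. (norm (F \<xi>))\<^sup>2)"
    using F by (auto simp: L2_iff)
  have le: "(norm (m \<xi> * F \<xi>))\<^sup>2 \<le> (norm (F \<xi>))\<^sup>2" for \<xi>
    using m[of \<xi>] by (intro power_mono) (auto simp: norm_mult mult_left_le_one_le)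
  have im: "integrable lborel (\<lambda>\<xi>. (norm (m \<xi> * F \<xi>))\<^sup>2)"
    by (rule Bochner_Integration.integrable_bound[OF i]) (measurable, intro AE_I2, use le in simp)
  then show L: "(\<lambda>\<xi>. m \<xi> * F \<xi>) \<in> Lp_space 2" by (simp add: L2_iff)
  have "(norm (cls (\<lambda>\<xi>. m \<xi> * F \<xi>)))\<^sup>2 \<le> (norm (cls F))\<^sup>2"
    unfolding norm_cls_sq[OF L] norm_cls_sq[OF F] by (rule integral_mono[OF im i le])
  then show "norm (cls (\<lambda>\<xi>. m \<xi> * F \<xi>)) \<le> norm (cls F)" by (rule power2_le_imp_le) simp
qed

lemma
  fixes f :: "'a::euclidean_space \<Rightarrow> complex"
  assumes f: "f \<in> Lp_space 2" and \<psi>: "mollifying_kernel \<psi>" and e: "\<epsilon> > 0"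
  shows convolution_L2: "convolution f (mollifying_net \<psi> \<epsilon>) \<in> Lp_space 2"
    and norm_cls_convolution_le: "norm (cls (convolution f (mollifying_net \<psi> \<epsilon>))) \<le> norm (cls f)"
proof -
  show L: "convolution f (mollifying_net \<psi> \<epsilon>) \<in> Lp_space 2" by (rule convolution_Lp[OF _ f \<psi> e]) simp
  have "(norm (cls (convolution f (mollifying_net \<psi> \<epsilon>))))\<^sup>2 \<le> (norm (cls f))\<^sup>2"
    using convolution_Lp_le[OF _ f \<psi> e] by (simp add: norm_cls_sq L f)
  then show "norm (cls (convolution f (mollifying_net \<psi> \<epsilon>))) \<le> norm (cls f)" by (rule power2_le_imp_le) simp
qed

lemma cls_convolution_diff:
  fixes f :: "'a::euclidean_space \<Rightarrow> complex"
  assumes f: "f \<in> Lp_space 2" and g: "g \<in> Lp_space 2" and \<psi>: "mollifying_kernel \<psi>" and e: "\<epsilon> > 0"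
  shows "cls (convolution (\<lambda>x. f x - g x) (mollifying_net \<psi> \<epsilon>)) =
    cls (convolution f (mollifying_net \<psi> \<epsilon>)) - cls (convolution g (mollifying_net \<psi> \<epsilon>))"
proof -
  have [measurable]: "f \<in> borel_measurable borel" "g \<in> borel_measurable borel" "\<psi> \<in> borel_measurable borel"
    using f g \<psi> by (auto simp: L2_iff mollifying_kernel_def)
  have two: "1 \<le> (2::real)" by simp
  have "AE x in lborel. convolution (\<lambda>x. f x - g x) (mollifying_net \<psi> \<epsilon>) x =
      convolution f (mollifying_net \<psi> \<epsilon>) x - convolution g (mollifying_net \<psi> \<epsilon>) x"
    using convolution_AE_integrable[OF two f \<psi> e] convolution_AE_integrable[OF two g \<psi> e]
  proof eventually_elim
    case (elim x)
    then show ?case using e by (simp add: convolution_mollifying_net_eq scaleR_diff_right)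
  qed
  then have "cls (convolution (\<lambda>x. f x - g x) (mollifying_net \<psi> \<epsilon>)) =
      cls (\<lambda>x. convolution f (mollifying_net \<psi> \<epsilon>) x - convolution g (mollifying_net \<psi> \<epsilon>) x)"
    by (subst cls_eq_iff) (auto intro!: L2_diff convolution_L2 f g \<psi> e)
  also have "\<dots> = cls (convolution f (mollifying_net \<psi> \<epsilon>)) - cls (convolution g (mollifying_net \<psi> \<epsilon>))"
    by (intro cls_diff convolution_L2 f g \<psi> e)
  finally show ?thesis .
qed

lemma cls_convolution_tendsto:
  fixes f :: "'a::euclidean_space \<Rightarrow> complex"
  assumes f: "f \<in> Lp_space 2" and \<psi>: "mollifying_kernel \<psi>"
  shows "((\<lambda>\<epsilon>. cls (convolution f (mollifying_net \<psi> \<epsilon>))) \<longlongrightarrow> cls f) (at_right 0)"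
proof (rule tendsto_norm_diff_sq)
  have "((\<lambda>\<epsilon>. LINT x|lborel. (norm (convolution f (mollifying_net \<psi> \<epsilon>) x - f x))\<^sup>2) \<longlongrightarrow> 0) (at_right 0)"
    using convolution_tendsto_Lp[OF _ f \<psi>] by simp
  moreover have "\<forall>\<^sub>F \<epsilon> in at_right 0. (LINT x|lborel. (norm (convolution f (mollifying_net \<psi> \<epsilon>) x - f x))\<^sup>2) =
      (norm (cls (convolution f (mollifying_net \<psi> \<epsilon>)) - cls f))\<^sup>2"
    using eventually_at_right_less[of 0]
    by eventually_elim (simp add: cls_diff[symmetric] norm_cls_sq L2_diff convolution_L2 f \<psi>)
  ultimately show "((\<lambda>\<epsilon>. (norm (cls (convolution f (mollifying_net \<psi> \<epsilon>)) - cls f))\<^sup>2) \<longlongrightarrow> 0) (at_right 0)"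
    by (rule Lim_transform_eventually)
qed

text \<open>The identity holds for the integrable truncations of \<open>f\<close>; both sides are bounded in $L^2$ by \<open>f\<close> and by \<open>F\<close>,
  and the transform is closed.\<close>

lemma has_ft_convolution:
  fixes f :: "'a::euclidean_space \<Rightarrow> complex"
  assumes ft: "has_fourier_transform f F" and \<psi>: "mollifying_kernel \<psi>" and e: "\<epsilon> > 0"
  shows "has_fourier_transform (convolution f (mollifying_net \<psi> \<epsilon>))
    (\<lambda>\<xi>. fourier_integral (\<lambda>z. complex_of_real (\<psi> z)) (\<epsilon> *\<^sub>R \<xi>) * F \<xi>)"
proof -
  note f = has_ft_L2(1)[OF ft] and F = has_ft_L2(2)[OF ft]
  define m where "m \<xi> = fourier_integral (\<lambda>z. complex_of_real (\<psi> z)) (\<epsilon> *\<^sub>R \<xi>)" for \<xi>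
  have [measurable]: "\<psi> \<in> borel_measurable borel" using \<psi> by (simp add: mollifying_kernel_def)
  have m: "m \<in> borel_measurable borel" "norm (m \<xi>) \<le> 1" for \<xi>
    using fourier_integral_bound[of "\<lambda>z. complex_of_real (\<psi> z)"] \<psi>
    by (auto simp: m_def[abs_def] mollifying_kernel_def)
  let ?C = "\<lambda>f. convolution f (mollifying_net \<psi> \<epsilon>)" and ?f = "\<lambda>n::nat. truncate (real n) f"
  have seq: "(\<lambda>n. X (real n)) \<longlonglongrightarrow> L" if "(X \<longlongrightarrow> L) at_top" for X and L :: "'a l2"
    using filterlim_compose[OF that filterlim_real_sequentially] .
  have "has_fourier_transform (?C f) (\<lambda>\<xi>. m \<xi> * F \<xi>)"
  proof (rule has_ft_closed[where f'="\<lambda>n. ?C (?f n)" and F'="\<lambda>n \<xi>. m \<xi> * fourier_integral (?f n) \<xi>"])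
    fix n
    have i: "integrable lborel (?f n)" and t: "?f n \<in> Lp_space 2"
      using f by (simp_all add: truncate_integrable truncate_L2)
    have iC: "integrable lborel (?C (?f n))"
    proof -
      have "?f n \<in> Lp_space 1" using i by (simp add: Lp_space_def)
      from convolution_Lp[OF _ this \<psi> e] show ?thesis by (simp add: Lp_space_def integrable_iff_bounded)
    qed
    show "has_fourier_transform (?C (?f n)) (\<lambda>\<xi>. m \<xi> * fourier_integral (?f n) \<xi>)"
    proof -
      have "fourier_integral (?C (?f n)) = (\<lambda>\<xi>. m \<xi> * fourier_integral (?f n) \<xi>)"
        by (rule ext) (simp only: fourier_integral_convolution[OF i \<psi> e] m_def)
      with has_ft_L1_L2[OF iC convolution_L2[OF t \<psi> e]] show ?thesis by simp
    qed
  next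
    show "?C f \<in> Lp_space 2" by (rule convolution_L2[OF f \<psi> e])
    show "(\<lambda>\<xi>. m \<xi> * F \<xi>) \<in> Lp_space 2" by (rule L2_multiplier[OF F m])
    have l1: "(\<lambda>n. cls (?f n)) \<longlonglongrightarrow> cls f" by (rule seq[OF cls_truncate_tendsto[OF f]])
    have "((\<lambda>R. cls (fourier_integral (truncate R f))) \<longlongrightarrow> cls F) at_top"
      using ft by (simp add: has_fourier_transform_iff)
    then have l2: "(\<lambda>n. cls (fourier_integral (?f n))) \<longlonglongrightarrow> cls F" by (rule seq)
    show "(\<lambda>n. cls (?C (?f n))) \<longlonglongrightarrow> cls (?C f)"
    proof (rule metric_tendsto_imp_tendsto[OF l1])
      show "\<forall>\<^sub>F n in sequentially. dist (cls (?C (?f n))) (cls (?C f)) \<le> dist (cls (?f n)) (cls f)"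
      proof (intro always_eventually allI)
        fix n :: nat
        note t = truncate_L2[OF f, of "real n"]
        have "dist (cls (?C (?f n))) (cls (?C f)) = norm (cls (?C (\<lambda>x. ?f n x - f x)))"
          by (simp only: dist_norm cls_convolution_diff[OF t f \<psi> e])
        also have "\<dots> \<le> norm (cls (\<lambda>x. ?f n x - f x))"
          by (rule norm_cls_convolution_le[OF L2_diff[OF t f] \<psi> e])
        also have "\<dots> = dist (cls (?f n)) (cls f)" by (simp only: dist_norm cls_diff[OF t f])
        finally show "dist (cls (?C (?f n))) (cls (?C f)) \<le> dist (cls (?f n)) (cls f)" .
      qed
    qed
    show "(\<lambda>n. cls (\<lambda>\<xi>. m \<xi> * fourier_integral (?f n) \<xi>)) \<longlonglongrightarrow> cls (\<lambda>\<xi>. m \<xi> * F \<xi>)"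
    proof (rule metric_tendsto_imp_tendsto[OF l2])
      show "\<forall>\<^sub>F n in sequentially. dist (cls (\<lambda>\<xi>. m \<xi> * fourier_integral (?f n) \<xi>)) (cls (\<lambda>\<xi>. m \<xi> * F \<xi>))
         \<le> dist (cls (fourier_integral (?f n))) (cls F)"
      proof (intro always_eventually allI)
        fix n :: nat
        note t = fourier_truncate_L2[OF f, of "real n"]
        have "dist (cls (\<lambda>\<xi>. m \<xi> * fourier_integral (?f n) \<xi>)) (cls (\<lambda>\<xi>. m \<xi> * F \<xi>)) =
            norm (cls (\<lambda>\<xi>. m \<xi> * (fourier_integral (?f n) \<xi> - F \<xi>)))"
          unfolding dist_norm right_diff_distrib
          by (simp only: cls_diff[OF L2_multiplier(1)[OF t m] L2_multiplier(1)[OF F m]])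
        also have "\<dots> \<le> norm (cls (\<lambda>\<xi>. fourier_integral (?f n) \<xi> - F \<xi>))"
          by (rule L2_multiplier[OF L2_diff[OF t F] m])
        also have "\<dots> = dist (cls (fourier_integral (?f n))) (cls F)"
          by (simp only: dist_norm cls_diff[OF t F])
        finally show "dist (cls (\<lambda>\<xi>. m \<xi> * fourier_integral (?f n) \<xi>)) (cls (\<lambda>\<xi>. m \<xi> * F \<xi>))
         \<le> dist (cls (fourier_integral (?f n))) (cls F)" .
      qed
    qed
  qed
  then show ?thesis by (simp add: m_def)
qed

lemma has_frac_laplacianE:
  assumes "has_frac_laplacian r f g"
  obtains F where "has_fourier_transform f F"
    "has_fourier_transform g (\<lambda>\<xi>. complex_of_real (norm \<xi> powr (2 * r)) * F \<xi>)"
  using assms unfolding has_frac_laplacian_def by (elim exE conjE)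

lemma has_frac_laplacian_half:
  assumes "has_frac_laplacian (s / 2) f g"
  obtains F where "has_fourier_transform f F"
    "has_fourier_transform g (\<lambda>\<xi>. complex_of_real (norm \<xi> powr s) * F \<xi>)"
  by (rule has_frac_laplacianE[OF assms]) (simp add: that)

lemma has_frac_laplacian_L2:
  assumes "has_frac_laplacian r f g"
  shows "f \<in> Lp_space 2" "g \<in> Lp_space 2"
  by (rule has_frac_laplacianE[OF assms], erule has_ft_L2)+

lemma has_frac_laplacian_add:
  assumes "has_frac_laplacian r f g" "has_frac_laplacian r f' g'"
  shows "has_frac_laplacian r (\<lambda>x. f x + f' x) (\<lambda>x. g x + g' x)"
proof -
  obtain F where F1: "has_fourier_transform f F"
      "has_fourier_transform g (\<lambda>\<xi>. complex_of_real (norm \<xi> powr (2 * r)) * F \<xi>)"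
    by (rule has_frac_laplacianE[OF assms(1)])
  obtain F' where F2: "has_fourier_transform f' F'"
      "has_fourier_transform g' (\<lambda>\<xi>. complex_of_real (norm \<xi> powr (2 * r)) * F' \<xi>)"
    by (rule has_frac_laplacianE[OF assms(2)])
  note F = F1(1) F2(1) F1(2) F2(2)
  show ?thesis
    unfolding has_frac_laplacian_def
    using has_ft_add[OF F(1,2)] has_ft_add[OF F(3,4)] unfolding distrib_left[symmetric] by (intro exI conjI)
qed

lemma has_frac_laplacian_scaleR:
  assumes "has_frac_laplacian r f g"
  shows "has_frac_laplacian r (\<lambda>x. c *\<^sub>R f x) (\<lambda>x. c *\<^sub>R g x)"
proof -
  obtain F where F: "has_fourier_transform f F"
      "has_fourier_transform g (\<lambda>\<xi>. complex_of_real (norm \<xi> powr (2 * r)) * F \<xi>)"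
    by (rule has_frac_laplacianE[OF assms(1)])
  show ?thesis
    unfolding has_frac_laplacian_def
    using has_ft_scaleR[OF F(1), of c] has_ft_scaleR[OF F(2), of c] unfolding mult_scaleR_right[symmetric]
    by (intro exI conjI)
qed

lemma has_frac_laplacian_diff:
  assumes "has_frac_laplacian r f g" "has_frac_laplacian r f' g'"
  shows "has_frac_laplacian r (\<lambda>x. f x - f' x) (\<lambda>x. g x - g' x)"
  using has_frac_laplacian_add[OF assms(1) has_frac_laplacian_scaleR[OF assms(2), of "-1"]] by simp

lemma has_frac_laplacian_unique:
  assumes fg: "has_frac_laplacian r f g" and fg': "has_frac_laplacian r f' g'" and eq: "cls f = cls f'"
  shows "cls g = cls g'"
proof -
  obtain F where F1: "has_fourier_transform f F"
      "has_fourier_transform g (\<lambda>\<xi>. complex_of_real (norm \<xi> powr (2 * r)) * F \<xi>)"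
    by (rule has_frac_laplacianE[OF assms(1)])
  obtain F' where F2: "has_fourier_transform f' F'"
      "has_fourier_transform g' (\<lambda>\<xi>. complex_of_real (norm \<xi> powr (2 * r)) * F' \<xi>)"
    by (rule has_frac_laplacianE[OF assms(2)])
  note F = F1(1) F2(1) F1(2) F2(2)
  have "cls F = cls F'" by (rule has_ft_unique[OF F(1,2) eq])
  then have "AE \<xi> in lborel. F \<xi> = F' \<xi>" using F(1,2)[THEN has_ft_L2(2)] by (simp add: cls_eq_iff)
  then have "cls (\<lambda>\<xi>. complex_of_real (norm \<xi> powr (2 * r)) * F \<xi>) =
      cls (\<lambda>\<xi>. complex_of_real (norm \<xi> powr (2 * r)) * F' \<xi>)"
    using F(3,4)[THEN has_ft_L2(2)] by (subst cls_eq_iff) auto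
  then show ?thesis by (rule has_ft_injective[OF F(3,4)])
qed

text \<open>Both operators are Fourier multipliers, hence commute.\<close>

lemma has_frac_laplacian_convolution:
  assumes fg: "has_frac_laplacian r f g" and \<psi>: "mollifying_kernel \<psi>" and e: "\<epsilon> > 0"
  shows "has_frac_laplacian r (convolution f (mollifying_net \<psi> \<epsilon>)) (convolution g (mollifying_net \<psi> \<epsilon>))"
proof -
  obtain F where F: "has_fourier_transform f F"
      "has_fourier_transform g (\<lambda>\<xi>. complex_of_real (norm \<xi> powr (2 * r)) * F \<xi>)"
    by (rule has_frac_laplacianE[OF assms(1)])
  show ?thesis
    unfolding has_frac_laplacian_def
    using has_ft_convolution[OF F(1) \<psi> e] has_ft_convolution[OF F(2) \<psi> e]
    unfolding mult.left_commute[of "fourier_integral (\<lambda>z. complex_of_real (\<psi> z)) (\<epsilon> *\<^sub>R \<xi>)"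
      "complex_of_real (norm \<xi> powr (2 * r))" for \<xi>]
    by (intro exI conjI)
qed

text \<open>The form identity behind the energy: on the Fourier side both sides are the integral of
  $|\xi|^{2s}$ times the inner product of the transforms.\<close>

lemma has_frac_laplacian_inner:
  fixes f :: "'a::euclidean_space \<Rightarrow> complex"
  assumes fg: "has_frac_laplacian s f g" and fp: "has_frac_laplacian (s / 2) f p"
    and hq: "has_frac_laplacian (s / 2) h q"
  shows "inner (cls g) (cls h) = inner (cls p) (cls q)"
proof -
  obtain F where F: "has_fourier_transform f F"
      "has_fourier_transform g (\<lambda>\<xi>. complex_of_real (norm \<xi> powr (2 * s)) * F \<xi>)"
    by (rule has_frac_laplacianE[OF fg])
  obtain F' where F': "has_fourier_transform f F'"
      "has_fourier_transform p (\<lambda>\<xi>. complex_of_real (norm \<xi> powr s) * F' \<xi>)"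
    by (rule has_frac_laplacian_half[OF fp])
  obtain H where H: "has_fourier_transform h H"
      "has_fourier_transform q (\<lambda>\<xi>. complex_of_real (norm \<xi> powr s) * H \<xi>)"
    by (rule has_frac_laplacian_half[OF hq])
  note L = F[THEN has_ft_L2(2)] F'[THEN has_ft_L2(2)] H[THEN has_ft_L2(2)]
  have "cls F = cls F'" by (rule has_ft_unique[OF F(1) F'(1) refl])
  then have ae: "AE \<xi> in lborel. F \<xi> = F' \<xi>" using L by (simp add: cls_eq_iff)
  have "(2 * pi) ^ DIM('a) * inner (cls g) (cls h) =
      (LINT \<xi>|lborel. (complex_of_real (norm \<xi> powr (2 * s)) * F \<xi>) \<bullet> H \<xi>)"
    using has_ft_inner[OF F(2) H(1)] by (simp add: inner_cls L)
  also have "\<dots> = (LINT \<xi>|lborel. (complex_of_real (norm \<xi> powr s) * F' \<xi>) \<bullet> (complex_of_real (norm \<xi> powr s) * H \<xi>))"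
  proof (rule integral_cong_AE)
    show "AE \<xi> in lborel. (complex_of_real (norm \<xi> powr (2 * s)) * F \<xi>) \<bullet> H \<xi> =
        (complex_of_real (norm \<xi> powr s) * F' \<xi>) \<bullet> (complex_of_real (norm \<xi> powr s) * H \<xi>)"
      using ae
    proof eventually_elim
      case (elim \<xi>)
      have "norm \<xi> powr (2 * s) = norm \<xi> powr s * norm \<xi> powr s" by (simp add: powr_add[symmetric])
      then show ?case
        unfolding elim scaleR_conv_of_real[symmetric] by simp
    qed
  qed (use L in \<open>auto simp: L2_iff\<close>)
  also have "\<dots> = (2 * pi) ^ DIM('a) * inner (cls p) (cls q)"
    using has_ft_inner[OF F'(2) H(2)] by (simp add: inner_cls L)
  finally show ?thesis by simp
qed

lemma sobolev_spaceD:
  assumes "f \<in> sobolev_space \<sigma>"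
  shows "f \<in> Lp_space 2" "has_frac_laplacian (\<sigma> / 2) f (frac_laplacian (\<sigma> / 2) f)"
    "frac_laplacian (\<sigma> / 2) f \<in> Lp_space 2"
proof -
  show "f \<in> Lp_space 2" using assms by (simp add: sobolev_space_def)
  have "\<exists>g. has_frac_laplacian (\<sigma> / 2) f g" using assms by (auto simp: sobolev_space_def)
  then show h: "has_frac_laplacian (\<sigma> / 2) f (frac_laplacian (\<sigma> / 2) f)"
    unfolding frac_laplacian_def by (rule someI_ex)
  then show "frac_laplacian (\<sigma> / 2) f \<in> Lp_space 2" by (rule has_frac_laplacian_L2)
qed

lemma sobolev_space_iff: "f \<in> sobolev_space \<sigma> \<longleftrightarrow> (\<exists>g. has_frac_laplacian (\<sigma> / 2) f g)"
proof
  assume "\<exists>g. has_frac_laplacian (\<sigma> / 2) f g"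
  then obtain g where "has_frac_laplacian (\<sigma> / 2) f g" by (rule exE)
  with has_frac_laplacian_L2[OF this] show "f \<in> sobolev_space \<sigma>" unfolding sobolev_space_def by blast
qed (unfold sobolev_space_def, blast)

text \<open>The operator $(-\Delta)^{\sigma/2}$ with values in classes. As a map into \<open>l2\<close> it is independent of the
  representative that \<open>frac_laplacian\<close> selects, and linear on the Sobolev space.\<close>

definition Lambda :: "real \<Rightarrow> ('a::euclidean_space \<Rightarrow> complex) \<Rightarrow> 'a l2"
  where "Lambda \<sigma> f = cls (frac_laplacian (\<sigma> / 2) f)"

lemma Lambda_eqI: "has_frac_laplacian (\<sigma> / 2) f g \<Longrightarrow> Lambda \<sigma> f = cls g"
  unfolding Lambda_def
  by (rule has_frac_laplacian_unique[OF _ _ refl], rule sobolev_spaceD) (unfold sobolev_space_iff, rule exI)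

lemma sobolev_diff: "f \<in> sobolev_space \<sigma> \<Longrightarrow> g \<in> sobolev_space \<sigma> \<Longrightarrow> (\<lambda>x. f x - g x) \<in> sobolev_space \<sigma>"
  unfolding sobolev_space_iff by (elim exE, rule exI, rule has_frac_laplacian_diff)

lemma sobolev_scaleR: "f \<in> sobolev_space \<sigma> \<Longrightarrow> (\<lambda>x. c *\<^sub>R f x) \<in> sobolev_space \<sigma>"
  unfolding sobolev_space_iff by (elim exE, rule exI, rule has_frac_laplacian_scaleR)

lemma Lambda_diff:
  assumes "f \<in> sobolev_space \<sigma>" "g \<in> sobolev_space \<sigma>"
  shows "Lambda \<sigma> (\<lambda>x. f x - g x) = Lambda \<sigma> f - Lambda \<sigma> g"
  using Lambda_eqI[OF has_frac_laplacian_diff[OF sobolev_spaceD(2)[OF assms(1)] sobolev_spaceD(2)[OF assms(2)]]]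
  by (simp add: Lambda_def cls_diff sobolev_spaceD(3)[OF assms(1)] sobolev_spaceD(3)[OF assms(2)])

lemma Lambda_scaleR:
  assumes "f \<in> sobolev_space \<sigma>"
  shows "Lambda \<sigma> (\<lambda>x. c *\<^sub>R f x) = c *\<^sub>R Lambda \<sigma> f"
  using Lambda_eqI[OF has_frac_laplacian_scaleR[OF sobolev_spaceD(2)[OF assms]]]
  by (simp add: Lambda_def cls_scaleR sobolev_spaceD(3)[OF assms])

lemma sobolev_norm_eq: "f \<in> sobolev_space \<sigma> \<Longrightarrow> sobolev_norm \<sigma> f = norm (cls f) + norm (Lambda \<sigma> f)"
  by (simp add: sobolev_norm_def Lambda_def norm_cls sobolev_spaceD)



section \<open>The fractional Sobolev inequality\<close>

lemma cball_sets_borel [measurable]: "cball c r \<in> sets borel"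
  by simp

text \<open>The layer-cake weight: integrated over all levels \<open>t\<close> below \<open>y\<close> it gives $y^p$.\<close>

lemma nn_integral_powr_layer:
  fixes p y :: real
  assumes p: "0 < p" and y: "0 \<le> y"
  shows "(\<integral>\<^sup>+t. ennreal (indicator {0<..<y} t * (p * t powr (p - 1))) \<partial>lborel) = ennreal (y powr p)"
proof -
  have "((\<lambda>t. p * t powr (p - 1)) has_integral (p * (y powr (p - 1 + 1) / (p - 1 + 1)))) {0..y}"
    using p y by (intro has_integral_mult_right has_integral_powr_from_0) auto
  then have "((\<lambda>t. p * t powr (p - 1)) has_integral (y powr p)) {0<..<y}"
    using p by (simp add: has_integral_Icc_iff_Ioo)
  then have I: "((\<lambda>t. if t \<in> {0<..<y} then p * t powr (p - 1) else 0) has_integral (y powr p)) UNIV"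
    by (simp only: has_integral_restrict_UNIV)
  have eq: "(\<lambda>t. if t \<in> {0<..<y} then p * t powr (p - 1) else 0) = (\<lambda>t. indicator {0<..<y} t * (p * t powr (p - 1)))"
    by (intro ext) (simp split: split_indicator)
  show ?thesis
    by (rule nn_integral_has_integral_lborel[OF _ _ I[unfolded eq]])
       (use p in \<open>auto split: split_indicator\<close>)
qed

lemma ex_dyadic:
  fixes x :: real
  assumes "0 < x" "x \<le> 1"
  obtains k :: nat where "(1/2) ^ Suc k < x" "x \<le> (1/2) ^ k"
proof -
  define P where "P n \<longleftrightarrow> (1/2::real) ^ n < x" for n :: nat
  obtain n where "P n" using real_arch_pow_inv[of x "1/2"] assms by (auto simp: P_def)
  then have L: "P (Least P)" by (rule LeastI)
  have "Least P \<noteq> 0"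
  proof
    assume "Least P = 0"
    then show False using L assms by (simp add: P_def)
  qed
  then obtain k where k: "Least P = Suc k" using not0_implies_Suc by blast
  have "\<not> P k" using not_less_Least[of k P] k by simp
  then show thesis using that[of k] L unfolding k by (simp add: P_def)
qed

text \<open>On the dyadic shell around radius $2^{-k}$ the function $|\xi|^{-2s}$ is at most
  $2^{2s(k+1)}$, and the volumes $2^{-kd}$ of the balls make the sum a geometric series exactly
  because $2s < d$.\<close>

lemma riesz_potential_unit_ball:
  fixes s :: real
  assumes s: "0 < s" "2 * s < real DIM('a::euclidean_space)"
  obtains w :: real where "w > 0"
    "(\<integral>\<^sup>+\<xi>. ennreal (indicator (cball 0 1) \<xi> * norm (\<xi>::'a) powr (- 2 * s)) \<partial>lborel) \<le> ennreal w"
proof -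
  let ?d = "DIM('a)"
  define v where "v = unit_ball_vol (real ?d)"
  have v: "v > 0" by (simp add: v_def)
  define r where "r = 2 powr (2 * s) * (1/2) ^ ?d"
  have r0: "r > 0" by (simp add: r_def)
  have "r = 2 powr (2 * s - real ?d)"
    by (simp add: r_def powr_diff powr_realpow power_one_over)
  also have "\<dots> < 2 powr 0" using s by (intro powr_less_mono) auto
  finally have r1: "r < 1" by simp
  define g :: "nat \<Rightarrow> 'a \<Rightarrow> real" where "g k \<xi> = 2 powr (2 * s * real (Suc k)) * indicator (cball 0 ((1/2) ^ k)) \<xi>" for k \<xi>
  have [measurable]: "g k \<in> borel_measurable borel" for k
    unfolding g_def by (intro borel_measurable_times borel_measurable_indicator borel_measurable_const) auto
  have ptw: "ennreal (indicator (cball 0 1) \<xi> * norm \<xi> powr (- 2 * s)) \<le> (\<Sum>k. ennreal (g k \<xi>))" for \<xi> :: 'a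
  proof (cases "\<xi> = 0 \<or> norm \<xi> > 1")
    case False
    then have "0 < norm \<xi>" "norm \<xi> \<le> 1" by simp_all
    then obtain k where k: "(1/2) ^ Suc k < norm \<xi>" "norm \<xi> \<le> (1/2) ^ k"
      by (rule ex_dyadic)
    have "norm \<xi> powr (- 2 * s) \<le> ((1/2) ^ Suc k) powr (- 2 * s)"
      using k s by (intro powr_mono2') auto
    also have "((1/2::real) ^ Suc k) powr (- 2 * s) = 2 powr (2 * s * real (Suc k))"
    proof -
      have p: "(1/2::real) ^ Suc k = 2 powr (- real (Suc k))"
        by (simp add: powr_minus_divide powr_realpow power_one_over del: power_Suc of_nat_Suc)
      have e: "- real (Suc k) * (- 2 * s) = 2 * s * real (Suc k)" by (simp add: algebra_simps)
      show ?thesis by (simp only: p powr_powr e)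
    qed
    finally have "norm \<xi> powr (- 2 * s) \<le> g k \<xi>" using k by (simp add: g_def)
    then have "ennreal (indicator (cball 0 1) \<xi> * norm \<xi> powr (- 2 * s)) \<le> ennreal (g k \<xi>)"
      using False by (intro ennreal_leI) simp
    also have "\<dots> = (\<Sum>i\<in>{k}. ennreal (g i \<xi>))" by simp
    also have "\<dots> \<le> (\<Sum>i. ennreal (g i \<xi>))" by (rule sum_le_suminf) auto
    finally show ?thesis .
  qed auto
  have int: "(\<integral>\<^sup>+\<xi>. ennreal (g k \<xi>) \<partial>lborel) = ennreal (v * 2 powr (2 * s) * r ^ k)" for k
  proof -
    have "(\<integral>\<^sup>+\<xi>. ennreal (g k \<xi>) \<partial>lborel) =
        (\<integral>\<^sup>+\<xi>. ennreal (2 powr (2 * s * real (Suc k))) * indicator (cball 0 ((1/2) ^ k)) (\<xi>::'a) \<partial>lborel)"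
      by (intro nn_integral_cong) (simp add: g_def split: split_indicator)
    also have "\<dots> = ennreal (2 powr (2 * s * real (Suc k))) * emeasure lborel (cball (0::'a) ((1/2) ^ k))"
      by (rule nn_integral_cmult_indicator) auto
    also have "\<dots> = ennreal (2 powr (2 * s * real (Suc k)) * (v * ((1/2) ^ k) ^ ?d))"
      by (simp add: emeasure_cball v_def ennreal_mult)
    also have "2 powr (2 * s * real (Suc k)) * (v * ((1/2) ^ k) ^ ?d) = v * 2 powr (2 * s) * r ^ k"
    proof -
      have "2 powr (2 * s * real (Suc k)) = 2 powr (2 * s) * (2 powr (2 * s)) ^ k"
        by (simp add: powr_powr powr_realpow[symmetric] powr_add[symmetric] algebra_simps)
      then show ?thesis by (simp add: r_def power_mult_distrib power_mult[symmetric] mult_ac)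
    qed
    finally show ?thesis .
  qed
  have "(\<integral>\<^sup>+\<xi>. ennreal (indicator (cball 0 1) \<xi> * norm (\<xi>::'a) powr (- 2 * s)) \<partial>lborel) \<le>
      (\<integral>\<^sup>+\<xi>. (\<Sum>k. ennreal (g k \<xi>)) \<partial>lborel)"
    by (intro nn_integral_mono ptw)
  also have "\<dots> = (\<Sum>k. ennreal (v * 2 powr (2 * s) * r ^ k))"
    by (subst nn_integral_suminf) (simp_all add: int)
  also have "\<dots> = ennreal (v * 2 powr (2 * s) * (1 / (1 - r)))"
    using r0 r1 v by (intro suminf_ennreal_eq sums_mult geometric_sums) auto
  finally have "(\<integral>\<^sup>+\<xi>. ennreal (indicator (cball 0 1) \<xi> * norm (\<xi>::'a) powr (- 2 * s)) \<partial>lborel) \<le>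
      ennreal (v * 2 powr (2 * s) * (1 / (1 - r)))" .
  moreover have "v * 2 powr (2 * s) * (1 / (1 - r)) > 0" using v r1 by simp
  ultimately show thesis by (rule that[rotated])
qed

text \<open>Scaling from the unit ball; the exponent $d - 2s$ is what determines the critical Sobolev exponent.\<close>

lemma riesz_potential_ball:
  fixes s A w :: real
  assumes s: "0 < s" and A: "A > 0"
    and w: "(\<integral>\<^sup>+\<xi>. ennreal (indicator (cball 0 1) \<xi> * norm (\<xi>::'a::euclidean_space) powr (- 2 * s)) \<partial>lborel) \<le> ennreal w"
      "w > 0"
  shows "integrable lborel (\<lambda>\<xi>::'a. indicator (cball 0 A) \<xi> * norm \<xi> powr (- 2 * s))"
    and "(LINT \<xi>|lborel. indicator (cball 0 A) (\<xi>::'a) * norm \<xi> powr (- 2 * s)) \<le> w * A powr (real DIM('a) - 2 * s)"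
proof -
  let ?f = "\<lambda>\<xi>::'a. indicator (cball 0 A) \<xi> * norm \<xi> powr (- 2 * s)"
  let ?B = "w * A powr (real DIM('a) - 2 * s)"
  have B: "?B \<ge> 0" using w by simp
  have [measurable]: "?f \<in> borel_measurable borel" by measurable
  have scale: "?f (0 + A *\<^sub>R \<xi>) = A powr (- 2 * s) * (indicator (cball 0 1) \<xi> * norm \<xi> powr (- 2 * s))" for \<xi>
  proof -
    have "A *\<^sub>R \<xi> \<in> cball 0 A \<longleftrightarrow> \<xi> \<in> cball 0 1" using A by simp
    then have "indicator (cball 0 A) (A *\<^sub>R \<xi>) = (indicator (cball 0 1) \<xi> :: real)" by (simp only: indicator_def)
    moreover have "norm (A *\<^sub>R \<xi>) powr (- 2 * s) = A powr (- 2 * s) * norm \<xi> powr (- 2 * s)"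
      using A by (simp add: powr_mult)
    ultimately show ?thesis by simp
  qed
  have "(\<integral>\<^sup>+\<xi>. ennreal (?f \<xi>) \<partial>lborel) = ennreal (\<bar>A\<bar> ^ DIM('a)) * (\<integral>\<^sup>+\<xi>. ennreal (?f (0 + A *\<^sub>R \<xi>)) \<partial>lborel)"
    using A by (intro nn_integral_lborel_affine) auto
  also have "(\<integral>\<^sup>+\<xi>. ennreal (?f (0 + A *\<^sub>R \<xi>)) \<partial>lborel) =
      (\<integral>\<^sup>+\<xi>. ennreal (A powr (- 2 * s)) * ennreal (indicator (cball 0 1) \<xi> * norm (\<xi>::'a) powr (- 2 * s)) \<partial>lborel)"
    unfolding scale by (intro nn_integral_cong ennreal_mult) auto
  also have "\<dots> = ennreal (A powr (- 2 * s)) * (\<integral>\<^sup>+\<xi>. ennreal (indicator (cball 0 1) \<xi> * norm (\<xi>::'a) powr (- 2 * s)) \<partial>lborel)"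
    by (rule nn_integral_cmult) measurable
  also have "ennreal (\<bar>A\<bar> ^ DIM('a)) * \<dots> \<le> ennreal (\<bar>A\<bar> ^ DIM('a)) * (ennreal (A powr (- 2 * s)) * ennreal w)"
    by (intro mult_left_mono w) auto
  also have "\<dots> = ennreal ?B"
  proof -
    have "A powr (real DIM('a) - 2 * s) = A ^ DIM('a) * A powr (- 2 * s)"
      using A by (simp add: powr_realpow[symmetric] powr_add[symmetric])
    then show ?thesis using A w by (simp add: ennreal_mult[symmetric] mult_ac)
  qed
  finally have nn: "(\<integral>\<^sup>+\<xi>. ennreal (?f \<xi>) \<partial>lborel) \<le> ennreal ?B" .
  show i: "integrable lborel ?f"
    using nn by (auto simp: integrable_iff_bounded abs_mult intro: le_less_trans)
  have "ennreal (LINT \<xi>|lborel. ?f \<xi>) \<le> ennreal ?B"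
    using nn by (subst nn_integral_eq_integral[symmetric, OF i]) auto
  then show "(LINT \<xi>|lborel. ?f \<xi>) \<le> ?B" using B by (simp add: ennreal_le_iff)
qed

lemma cauchy_schwarz_integral:
  fixes f g :: "'a::euclidean_space \<Rightarrow> real"
  assumes [measurable]: "f \<in> borel_measurable borel" "g \<in> borel_measurable borel"
    and f: "integrable lborel (\<lambda>x. (f x)\<^sup>2)" and g: "integrable lborel (\<lambda>x. (g x)\<^sup>2)"
  shows "integrable lborel (\<lambda>x. f x * g x)"
    and "(LINT x|lborel. f x * g x) \<le> sqrt (LINT x|lborel. (f x)\<^sup>2) * sqrt (LINT x|lborel. (g x)\<^sup>2)"
proof -
  let ?f = "\<lambda>x. complex_of_real (f x)" and ?g = "\<lambda>x. complex_of_real (g x)"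
  have L: "?f \<in> Lp_space 2" "?g \<in> Lp_space 2" using f g by (simp_all add: L2_iff)
  have eq: "?f x \<bullet> ?g x = f x * g x" for x by (simp add: inner_complex_def)
  show "integrable lborel (\<lambda>x. f x * g x)" using L2_inner_integrable[OF L] by (simp only: eq)
  have "inner (cls ?f) (cls ?g) \<le> norm (cls ?f) * norm (cls ?g)" by (rule norm_cauchy_schwarz)
  then show "(LINT x|lborel. f x * g x) \<le> sqrt (LINT x|lborel. (f x)\<^sup>2) * sqrt (LINT x|lborel. (g x)\<^sup>2)"
    unfolding inner_cls[OF L] eq norm_cls[OF L(1)] norm_cls[OF L(2)] Lp_norm_2 by simp
qed

text \<open>The size of a level set of \<open>f\<close> is controlled by the frequencies above \<open>A\<close> alone. Pair \<open>f\<close> with its phase \<open>h\<close> on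
  the level set \<open>E\<close> and pass to the Fourier side. For $|\xi| \le A$ use $|\hat h| \le |E|$ and the
  Cauchy-Schwarz inequality with weight $|\xi|^s$: by the choice of \<open>A\<close> this part is at most half of the left-hand
  side $(2\pi)^d \tau |E|$ and can be absorbed. For $|\xi| > A$ use Cauchy-Schwarz with
  $\|\hat h\|^2 = (2\pi)^d |E|$.\<close>

lemma frequency_splitting:
  fixes f F :: "'a::euclidean_space \<Rightarrow> complex" and s w N \<tau> A :: real
  defines "c \<equiv> (2 * pi) ^ DIM('a)"
  assumes ft: "has_fourier_transform f F" and s: "0 < s" "2 * s < real DIM('a)"
    and w: "(\<integral>\<^sup>+\<xi>. ennreal (indicator (cball 0 1) \<xi> * norm (\<xi>::'a) powr (- 2 * s)) \<partial>lborel) \<le> ennreal w" "w > 0"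
    and N: "N > 0" "integrable lborel (\<lambda>\<xi>. (norm \<xi> powr s * norm (F \<xi>))\<^sup>2)"
      "(LINT \<xi>|lborel. (norm \<xi> powr s * norm (F \<xi>))\<^sup>2) \<le> N\<^sup>2"
    and \<tau>: "\<tau> > 0" and A: "A > 0" "sqrt w * A powr ((real DIM('a) - 2 * s) / 2) * N = c * \<tau> / 2"
  shows "emeasure lborel {x. \<tau> < norm (f x)} < \<infinity>"
    and "\<tau>\<^sup>2 * measure lborel {x. \<tau> < norm (f x)} \<le>
      4 / c * (LINT \<xi>|lborel. indicator {\<xi>. A < norm \<xi>} \<xi> * (norm (F \<xi>))\<^sup>2)"
proof -
  note L = has_ft_L2[OF ft]
  have [measurable]: "f \<in> borel_measurable borel" "F \<in> borel_measurable borel"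
    and if2: "integrable lborel (\<lambda>x. (norm (f x))\<^sup>2)" and iF2: "integrable lborel (\<lambda>\<xi>. (norm (F \<xi>))\<^sup>2)"
    using L by (simp_all add: L2_iff)
  have c: "c > 0" by (simp add: c_def)
  let ?E = "{x. \<tau> < norm (f x)}"
  have E[measurable]: "?E \<in> sets borel" by measurable
  have "(\<integral>\<^sup>+x. ennreal (\<tau>\<^sup>2) * indicator ?E x \<partial>lborel) \<le> (\<integral>\<^sup>+x. ennreal ((norm (f x))\<^sup>2) \<partial>lborel)"
    using \<tau> by (intro nn_integral_mono) (auto split: split_indicator intro!: ennreal_leI power_mono)
  also have "\<dots> < \<infinity>" using if2 by (simp add: nn_integral_eq_integral)
  finally have "ennreal (\<tau>\<^sup>2) * emeasure lborel ?E < \<infinity>" by (simp add: nn_integral_cmult_indicator)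
  then show fE: "emeasure lborel ?E < \<infinity>" using \<tau> by (auto simp: ennreal_mult_less_top)
  define m where "m = measure lborel ?E"
  have m0: "m \<ge> 0" by (simp add: m_def)
  have iE: "integrable lborel (indicator ?E :: 'a \<Rightarrow> real)" using fE by (intro integrable_real_indicator) auto
  have LE: "(LINT x|lborel. indicator ?E x :: real) = m" by (simp add: m_def)
  \<comment> \<open>The phase of \<open>f\<close> on the level set: pairing it with \<open>f\<close> gives the integral of \<open>norm f\<close> there.\<close>
  define h where "h x = (indicator ?E x / norm (f x)) *\<^sub>R f x" for x
  have [measurable]: "h \<in> borel_measurable borel" unfolding h_def by measurable
  have nh: "norm (h x) = indicator ?E x" for x
    using \<tau> by (auto simp: h_def split: split_indicator)
  have fh: "f x \<bullet> h x = indicator ?E x * norm (f x)" for x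
    using \<tau> by (auto simp: h_def power2_norm_eq_inner[symmetric] power2_eq_square split: split_indicator)
  have ih: "integrable lborel h"
    by (rule Bochner_Integration.integrable_bound[OF iE]) (auto simp: nh intro!: AE_I2)
  have nh2: "(norm (h x))\<^sup>2 = indicator ?E x" for x by (simp add: nh split: split_indicator)
  have Lh: "h \<in> Lp_space 2" using iE by (simp add: L2_iff nh2)
  let ?H = "fourier_integral h"
  have ftH: "has_fourier_transform h ?H" by (rule has_ft_L1_L2[OF ih Lh])
  note LH = has_ft_L2(2)[OF ftH]
  have [measurable]: "?H \<in> borel_measurable borel" by measurable
  have Hm: "norm (?H \<xi>) \<le> m" for \<xi> using fourier_integral_bound[of h \<xi>] by (simp only: nh LE)
  have iH2: "integrable lborel (\<lambda>\<xi>. (norm (?H \<xi>))\<^sup>2)" using LH by (simp add: L2_iff)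
  have H2: "(LINT \<xi>|lborel. (norm (?H \<xi>))\<^sup>2) = c * m"
    using plancherel_L1_L2(2)[OF ih Lh] by (simp only: nh2 LE c_def)
  let ?lo = "\<lambda>\<xi>. indicator (cball 0 A) \<xi> * norm (F \<xi>)" and ?hi = "\<lambda>\<xi>. indicator {\<xi>. A < norm \<xi>} \<xi> * norm (F \<xi>)"
  have [measurable]: "?lo \<in> borel_measurable borel"
    by measurable
  have [measurable]: "?hi \<in> borel_measurable borel" by measurable
  let ?Q = "LINT \<xi>|lborel. indicator {\<xi>. A < norm \<xi>} \<xi> * (norm (F \<xi>))\<^sup>2"
  have hi2: "(?hi \<xi>)\<^sup>2 = indicator {\<xi>. A < norm \<xi>} \<xi> * (norm (F \<xi>))\<^sup>2" for \<xi>
    by (simp split: split_indicator)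
  have ihi2: "integrable lborel (\<lambda>\<xi>. (?hi \<xi>)\<^sup>2)"
    by (rule Bochner_Integration.integrable_bound[OF iF2]) (measurable, auto intro!: AE_I2 split: split_indicator)
  have lo: "integrable lborel ?lo \<and> (LINT \<xi>|lborel. ?lo \<xi>) \<le> c * \<tau> / 2"
  proof -
    let ?u = "\<lambda>\<xi>::'a. indicator (cball 0 A) \<xi> * norm \<xi> powr (- s)" and ?v = "\<lambda>\<xi>. norm \<xi> powr s * norm (F \<xi>)"
    have [measurable]: "?u \<in> borel_measurable borel"
      by measurable
    have [measurable]: "?v \<in> borel_measurable borel" by measurable
    have u2: "(?u \<xi>)\<^sup>2 = indicator (cball 0 A) \<xi> * norm \<xi> powr (- 2 * s)" for \<xi>
      by (simp add: power2_eq_square powr_add[symmetric] split: split_indicator)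
    note riesz = riesz_potential_ball[OF s(1) A(1) w]
    have iu2: "integrable lborel (\<lambda>\<xi>. (?u \<xi>)\<^sup>2)" unfolding u2 by (rule riesz)
    note cs = cauchy_schwarz_integral[OF _ _ iu2 N(2)]
    have "AE \<xi> in lborel. \<xi> \<noteq> (0::'a)" by (rule AE_lborel_singleton)
    then have ae: "AE \<xi> in lborel. ?u \<xi> * ?v \<xi> = ?lo \<xi>"
      by eventually_elim (simp add: powr_minus)
    have i: "integrable lborel ?lo"
    proof (rule integrable_cong_AE_imp)
      show "integrable lborel (\<lambda>\<xi>. ?u \<xi> * ?v \<xi>)" by (rule cs(1)) measurable
      show "AE \<xi> in lborel. ?u \<xi> * ?v \<xi> = ?lo \<xi>" by (rule ae)
    qed measurable
    have "(LINT \<xi>|lborel. ?lo \<xi>) = (LINT \<xi>|lborel. ?u \<xi> * ?v \<xi>)"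
    proof (rule integral_cong_AE)
      show "AE \<xi> in lborel. ?lo \<xi> = ?u \<xi> * ?v \<xi>" using ae by eventually_elim (rule sym)
    qed measurable
    also have "\<dots> \<le> sqrt (LINT \<xi>|lborel. (?u \<xi>)\<^sup>2) * sqrt (LINT \<xi>|lborel. (?v \<xi>)\<^sup>2)"
      by (rule cs(2)) measurable
    also have "\<dots> \<le> sqrt (w * A powr (real DIM('a) - 2 * s)) * sqrt (N\<^sup>2)"
    proof (intro mult_mono)
      show "sqrt (LINT \<xi>|lborel. (?u \<xi>)\<^sup>2) \<le> sqrt (w * A powr (real DIM('a) - 2 * s))"
        unfolding u2 by (intro real_sqrt_le_mono riesz)
      show "sqrt (LINT \<xi>|lborel. (?v \<xi>)\<^sup>2) \<le> sqrt (N\<^sup>2)" by (rule real_sqrt_le_mono[OF N(3)])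
    qed (use N w in auto)
    also have "\<dots> = c * \<tau> / 2"
      using A N by (simp add: real_sqrt_mult powr_half_sqrt[symmetric] powr_powr)
    finally show ?thesis using i by simp
  qed
  have hiH: "integrable lborel (\<lambda>\<xi>. ?hi \<xi> * norm (?H \<xi>))"
      "(LINT \<xi>|lborel. ?hi \<xi> * norm (?H \<xi>)) \<le> sqrt ?Q * sqrt (c * m)"
    using cauchy_schwarz_integral[OF _ _ ihi2, of "\<lambda>\<xi>. norm (?H \<xi>)"] iH2 unfolding H2 hi2 by simp_all
  have ilom: "integrable lborel (\<lambda>\<xi>. ?lo \<xi> * m)" using lo by simp
  have "c * (\<tau> * m) \<le> c * (LINT x|lborel. f x \<bullet> h x)"
  proof -
    have "\<tau> * m = (LINT x|lborel. \<tau> * indicator ?E x)" by (simp add: m_def)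
    also have "\<dots> \<le> (LINT x|lborel. f x \<bullet> h x)"
    proof (rule integral_mono)
      show "integrable lborel (\<lambda>x. \<tau> * indicator ?E x)" using iE by simp
      show "integrable lborel (\<lambda>x. f x \<bullet> h x)" by (rule L2_inner_integrable[OF L(1) Lh])
      show "\<tau> * indicator ?E x \<le> f x \<bullet> h x" for x
        unfolding fh by (simp split: split_indicator)
    qed
    finally show ?thesis using c by simp
  qed
  also have "\<dots> = (LINT \<xi>|lborel. F \<xi> \<bullet> ?H \<xi>)"
    using has_ft_inner[OF ft ftH] by (simp add: inner_cls L Lh LH c_def)
  also have "\<dots> \<le> (LINT \<xi>|lborel. ?lo \<xi> * m + ?hi \<xi> * norm (?H \<xi>))"
  proof (rule integral_mono)
    show "integrable lborel (\<lambda>\<xi>. F \<xi> \<bullet> ?H \<xi>)" by (rule L2_inner_integrable[OF L(2) LH])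
    show "integrable lborel (\<lambda>\<xi>. ?lo \<xi> * m + ?hi \<xi> * norm (?H \<xi>))"
      by (intro Bochner_Integration.integrable_add ilom hiH)
    show "F \<xi> \<bullet> ?H \<xi> \<le> ?lo \<xi> * m + ?hi \<xi> * norm (?H \<xi>)" for \<xi>
    proof -
      have "F \<xi> \<bullet> ?H \<xi> \<le> norm (F \<xi>) * norm (?H \<xi>)" by (rule norm_cauchy_schwarz)
      moreover have "norm (F \<xi>) * norm (?H \<xi>) \<le> norm (F \<xi>) * m" by (intro mult_left_mono Hm) simp
      ultimately show ?thesis by (simp split: split_indicator)
    qed
  qed
  also have "\<dots> = (LINT \<xi>|lborel. ?lo \<xi>) * m + (LINT \<xi>|lborel. ?hi \<xi> * norm (?H \<xi>))"
    using ilom hiH(1) by simp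
  also have "\<dots> \<le> c * \<tau> / 2 * m + sqrt ?Q * sqrt (c * m)"
    using lo hiH(2) m0 by (intro add_mono mult_right_mono) auto
  finally have "c * \<tau> * m / 2 \<le> sqrt ?Q * sqrt (c * m)" by simp
  then have "(c * \<tau> * m / 2)\<^sup>2 \<le> (sqrt ?Q * sqrt (c * m))\<^sup>2"
    using c \<tau> m0 by (intro power_mono) auto
  also have "\<dots> = ?Q * (c * m)"
  proof -
    have "?Q \<ge> 0" by (intro integral_nonneg_AE) auto
    then show ?thesis using c m0 by (simp add: power_mult_distrib)
  qed
  finally have *: "(c * m) * (c * (\<tau>\<^sup>2 * m)) \<le> (c * m) * (4 * ?Q)"
    by (simp add: power2_eq_square field_simps)
  show "\<tau>\<^sup>2 * measure lborel ?E \<le> 4 / c * ?Q"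
  proof (cases "m = 0")
    case True
    have "?Q \<ge> 0" by (intro integral_nonneg_AE) auto
    then show ?thesis using True c by (simp add: m_def[symmetric])
  next
    case False
    then have "c * m > 0" using c m0 by simp
    then have "c * (\<tau>\<^sup>2 * m) \<le> 4 * ?Q" using * by (simp only: mult_le_cancel_left_pos)
    then show ?thesis using c by (simp add: m_def[symmetric] field_simps)
  qed
qed


text \<open>Chemin and Xu's argument, run by duality: the frequency threshold at which \<open>f\<close> is split depends on the
  level \<open>\<tau>\<close>, so that the low frequencies account for at most half of the level; integrating the resulting
  bound over all levels gives the strong-type inequality at the critical exponent.\<close>

lemma sobolev_inequality:
  fixes s :: real
  assumes s: "0 < s" "2 * s < real DIM('a::euclidean_space)"
  defines "q \<equiv> 2 * real DIM('a) / (real DIM('a) - 2 * s)"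
  obtains K :: real where "K > 0"
    "\<And>(f :: 'a \<Rightarrow> complex) F N. has_fourier_transform f F \<Longrightarrow> N > 0 \<Longrightarrow>
      integrable lborel (\<lambda>\<xi>. (norm \<xi> powr s * norm (F \<xi>))\<^sup>2) \<Longrightarrow>
      (LINT \<xi>|lborel. (norm \<xi> powr s * norm (F \<xi>))\<^sup>2) \<le> N\<^sup>2 \<Longrightarrow>
      (\<integral>\<^sup>+x. ennreal (norm (f x) powr q) \<partial>lborel) \<le> ennreal (K * N powr q)"
proof -
  let ?d = "real DIM('a)"
  define e where "e = (?d - 2 * s) / 2"
  have e: "e > 0" using s by (simp add: e_def)
  have q2: "q - 2 = 2 * s / e" and q: "q > 2"
    using s e by (auto simp: q_def e_def field_simps)
  obtain w where w0: "w > 0"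
    and w: "(\<integral>\<^sup>+\<xi>. ennreal (indicator (cball 0 1) \<xi> * norm (\<xi>::'a) powr (- 2 * s)) \<partial>lborel) \<le> ennreal w"
    by (rule riesz_potential_unit_ball[OF s])
  define c where "c = (2 * pi) ^ DIM('a)"
  have c: "c > 0" by (simp add: c_def)
  define K where "K = 4 * q / (c * (q - 2)) * (2 * sqrt w / c) powr (q - 2)"
  have K: "K > 0" using q c w0 by (simp add: K_def)
  have bound: "(\<integral>\<^sup>+x. ennreal (norm (f x) powr q) \<partial>lborel) \<le> ennreal (K * N powr q)"
    if ft: "has_fourier_transform f F" and N: "N > 0" "integrable lborel (\<lambda>\<xi>. (norm \<xi> powr s * norm (F \<xi>))\<^sup>2)"
      "(LINT \<xi>|lborel. (norm \<xi> powr s * norm (F \<xi>))\<^sup>2) \<le> N\<^sup>2" for f F :: "'a \<Rightarrow> complex" and N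
  proof -
    note L = has_ft_L2[OF ft]
    have [measurable]: "f \<in> borel_measurable borel" "F \<in> borel_measurable borel"
      and iF2: "integrable lborel (\<lambda>\<xi>. (norm (F \<xi>))\<^sup>2)" using L by (simp_all add: L2_iff)
    define B where "B = 2 * sqrt w * N / c"
    have B: "B > 0" using w0 N c by (simp add: B_def)
    define A where "A \<tau> = (\<tau> / B) powr (1 / e)" for \<tau>
    have [measurable]: "A \<in> borel_measurable borel" unfolding A_def[abs_def] by measurable
    have A_less: "\<tau> < B * norm \<xi> powr e" if "0 < \<tau>" "A \<tau> < norm \<xi>" for \<tau> and \<xi> :: 'a
    proof -
      have "A \<tau> powr e < norm \<xi> powr e" using that e by (intro powr_less_mono2) (auto simp: A_def)
      moreover have "A \<tau> powr e = \<tau> / B" using e B that by (simp add: A_def powr_powr)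
      ultimately show ?thesis using B by (simp add: field_simps)
    qed
    let ?Q = "\<lambda>\<tau>. LINT \<xi>|lborel. indicator {\<xi>. A \<tau> < norm \<xi>} \<xi> * (norm (F \<xi>))\<^sup>2"
    have split: "emeasure lborel {x. \<tau> < norm (f x)} \<le> ennreal (4 / c / \<tau>\<^sup>2 * ?Q \<tau>)" if \<tau>: "\<tau> > 0" for \<tau>
    proof -
      have A0: "A \<tau> > 0" using \<tau> B by (simp add: A_def)
      have "A \<tau> powr ((?d - 2 * s) / 2) = \<tau> / B" using e B \<tau> by (simp add: A_def powr_powr e_def[symmetric])
      then have A1: "sqrt w * A \<tau> powr ((?d - 2 * s) / 2) * N = (2 * pi) ^ DIM('a) * \<tau> / 2"
        unfolding c_def[symmetric] using B w0 N c by (simp add: B_def field_simps)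
      note fs = frequency_splitting[OF ft s w w0 N \<tau> A0 A1, folded c_def]
      have "measure lborel {x. \<tau> < norm (f x)} \<le> 4 / c / \<tau>\<^sup>2 * ?Q \<tau>"
        using fs(2) \<tau> c by (simp add: field_simps)
      then show ?thesis
        using fs(1) by (subst emeasure_eq_ennreal_measure) (auto intro: ennreal_leI)
    qed
    have iQ: "integrable lborel (\<lambda>\<xi>. indicator {\<xi>. A \<tau> < norm \<xi>} \<xi> * (norm (F \<xi>))\<^sup>2)" for \<tau>
      by (rule Bochner_Integration.integrable_bound[OF iF2]) (measurable, auto intro!: AE_I2 split: split_indicator)
    have Qnn: "ennreal (?Q \<tau>) = (\<integral>\<^sup>+\<xi>. ennreal (indicator {\<xi>. A \<tau> < norm \<xi>} \<xi> * (norm (F \<xi>))\<^sup>2) \<partial>lborel)" for \<tau>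
      by (rule nn_integral_eq_integral[symmetric, OF iQ]) simp
    have "(\<integral>\<^sup>+x. ennreal (norm (f x) powr q) \<partial>lborel) =
        (\<integral>\<^sup>+x. \<integral>\<^sup>+\<tau>. ennreal (indicator {0<..<norm (f x)} \<tau> * (q * \<tau> powr (q - 1))) \<partial>lborel \<partial>lborel)"
      using q by (intro nn_integral_cong nn_integral_powr_layer[symmetric]) auto
    also have "\<dots> = (\<integral>\<^sup>+\<tau>. \<integral>\<^sup>+x. ennreal (indicator {0<..<norm (f x)} \<tau> * (q * \<tau> powr (q - 1))) \<partial>lborel \<partial>lborel)"
    proof (rule lborel_pair.Fubini')
      have "(\<lambda>(\<tau>, x). ennreal ((if 0 < \<tau> \<and> \<tau> < norm (f x) then 1 else 0) * (q * \<tau> powr (q - 1))))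
          \<in> borel_measurable (lborel \<Otimes>\<^sub>M lborel)" by measurable
      moreover have "(\<lambda>(\<tau>, x). ennreal ((if 0 < \<tau> \<and> \<tau> < norm (f x) then 1 else 0) * (q * \<tau> powr (q - 1)))) =
          (\<lambda>(\<tau>, x). ennreal (indicator {0<..<norm (f x)} \<tau> * (q * \<tau> powr (q - 1))))"
        by (intro ext) (auto split: split_indicator)
      ultimately show "(\<lambda>(\<tau>, x). ennreal (indicator {0<..<norm (f x)} \<tau> * (q * \<tau> powr (q - 1))))
          \<in> borel_measurable (lborel \<Otimes>\<^sub>M lborel)" by (simp only:)
    qed
    also have "\<dots> \<le> (\<integral>\<^sup>+\<tau>. \<integral>\<^sup>+\<xi>. ennreal (4 * q / c * (indicator {0<..<B * norm \<xi> powr e} \<tau> * \<tau> powr (q - 3)) * (norm (F \<xi>))\<^sup>2)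
        \<partial>lborel \<partial>lborel)"
    proof (rule nn_integral_mono)
      fix \<tau> :: real
      show "(\<integral>\<^sup>+x. ennreal (indicator {0<..<norm (f x)} \<tau> * (q * \<tau> powr (q - 1))) \<partial>lborel) \<le>
        (\<integral>\<^sup>+\<xi>. ennreal (4 * q / c * (indicator {0<..<B * norm \<xi> powr e} \<tau> * \<tau> powr (q - 3)) * (norm (F \<xi>))\<^sup>2) \<partial>lborel)"
      proof (cases "\<tau> > 0")
        case True
        have "(\<integral>\<^sup>+x. ennreal (indicator {0<..<norm (f x)} \<tau> * (q * \<tau> powr (q - 1))) \<partial>lborel) =
            (\<integral>\<^sup>+x. ennreal (q * \<tau> powr (q - 1)) * indicator {x. \<tau> < norm (f x)} x \<partial>lborel)"
          using True by (intro nn_integral_cong) (auto split: split_indicator)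
        also have "\<dots> = ennreal (q * \<tau> powr (q - 1)) * emeasure lborel {x. \<tau> < norm (f x)}"
          by (rule nn_integral_cmult_indicator) measurable
        also have "\<dots> \<le> ennreal (q * \<tau> powr (q - 1)) * ennreal (4 / c / \<tau>\<^sup>2 * ?Q \<tau>)"
          by (intro mult_left_mono split True) simp
        also have "\<dots> = ennreal (4 * q / c * \<tau> powr (q - 3)) * ennreal (?Q \<tau>)"
        proof -
          have "?Q \<tau> \<ge> 0" by (intro integral_nonneg_AE) auto
          moreover have pw: "\<tau> powr (q - 1) / \<tau>\<^sup>2 = \<tau> powr (q - 3)"
            using True powr_diff[of \<tau> "q - 1" 2] by simp
          have alg: "q * X * (4 / c / T * Y) = 4 * q / c * (X / T) * Y" for X T Y :: real by simp
          have "q * \<tau> powr (q - 1) * (4 / c / \<tau>\<^sup>2 * ?Q \<tau>) = 4 * q / c * \<tau> powr (q - 3) * ?Q \<tau>"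
            unfolding alg pw ..
          ultimately show ?thesis using q c True by (simp add: ennreal_mult[symmetric])
        qed
        also have "\<dots> = (\<integral>\<^sup>+\<xi>. ennreal (4 * q / c * \<tau> powr (q - 3)) *
            ennreal (indicator {\<xi>. A \<tau> < norm \<xi>} \<xi> * (norm (F \<xi>))\<^sup>2) \<partial>lborel)"
          unfolding Qnn by (rule nn_integral_cmult[symmetric]) measurable
        also have "\<dots> \<le> (\<integral>\<^sup>+\<xi>. ennreal (4 * q / c * (indicator {0<..<B * norm \<xi> powr e} \<tau> * \<tau> powr (q - 3)) * (norm (F \<xi>))\<^sup>2) \<partial>lborel)"
        proof (rule nn_integral_mono)
          fix \<xi> :: 'a
          show "ennreal (4 * q / c * \<tau> powr (q - 3)) * ennreal (indicator {\<xi>. A \<tau> < norm \<xi>} \<xi> * (norm (F \<xi>))\<^sup>2) \<le>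
            ennreal (4 * q / c * (indicator {0<..<B * norm \<xi> powr e} \<tau> * \<tau> powr (q - 3)) * (norm (F \<xi>))\<^sup>2)"
          proof (cases "A \<tau> < norm \<xi>")
            case less: True
            then show ?thesis using A_less[OF True less] True q c by (simp add: ennreal_mult[symmetric])
          qed simp
        qed
        finally show ?thesis .
      qed simp
    qed
    also have "\<dots> = (\<integral>\<^sup>+\<xi>. \<integral>\<^sup>+\<tau>. ennreal (4 * q / c * (indicator {0<..<B * norm \<xi> powr e} \<tau> * \<tau> powr (q - 3)) * (norm (F \<xi>))\<^sup>2)
        \<partial>lborel \<partial>lborel)"
    proof (rule lborel_pair.Fubini'[symmetric])
      have "(\<lambda>(\<tau>, \<xi>). ennreal (4 * q / c * ((if 0 < \<tau> \<and> \<tau> < B * norm \<xi> powr e then 1 else 0) * \<tau> powr (q - 3)) * (norm (F \<xi>))\<^sup>2))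
          \<in> borel_measurable (lborel \<Otimes>\<^sub>M lborel)" by measurable
      moreover have "(\<lambda>(\<tau>, \<xi>). ennreal (4 * q / c * ((if 0 < \<tau> \<and> \<tau> < B * norm \<xi> powr e then 1 else 0) * \<tau> powr (q - 3)) * (norm (F \<xi>))\<^sup>2)) =
          (\<lambda>(\<tau>, \<xi>). ennreal (4 * q / c * (indicator {0<..<B * norm \<xi> powr e} \<tau> * \<tau> powr (q - 3)) * (norm (F \<xi>))\<^sup>2))"
        by (intro ext) (auto split: split_indicator)
      ultimately show "(\<lambda>(\<tau>, \<xi>). ennreal (4 * q / c * (indicator {0<..<B * norm \<xi> powr e} \<tau> * \<tau> powr (q - 3)) * (norm (F \<xi>))\<^sup>2))
          \<in> borel_measurable (lborel \<Otimes>\<^sub>M lborel)" by (simp only:)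
    qed
    also have "\<dots> = (\<integral>\<^sup>+\<xi>. ennreal (K * N powr (q - 2)) * ennreal ((norm \<xi> powr s * norm (F \<xi>))\<^sup>2) \<partial>lborel)"
    proof (rule nn_integral_cong)
      fix \<xi> :: 'a
      have "(\<integral>\<^sup>+\<tau>. ennreal (4 * q / c * (indicator {0<..<B * norm \<xi> powr e} \<tau> * \<tau> powr (q - 3)) * (norm (F \<xi>))\<^sup>2) \<partial>lborel) =
         (\<integral>\<^sup>+\<tau>. ennreal (4 * q / (c * (q - 2)) * (norm (F \<xi>))\<^sup>2) *
           ennreal (indicator {0<..<B * norm \<xi> powr e} \<tau> * ((q - 2) * \<tau> powr (q - 2 - 1))) \<partial>lborel)"
      proof (rule nn_integral_cong)
        fix \<tau> :: real
        have r: "q - 2 - 1 = q - 3" by simp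
        have alg: "4 * q / c * (a * X) * G = (4 * q / (c * (q - 2)) * G) * (a * ((q - 2) * X))" for a X G :: real
          using q c by (simp add: divide_simps)
        show "ennreal (4 * q / c * (indicator {0<..<B * norm \<xi> powr e} \<tau> * \<tau> powr (q - 3)) * (norm (F \<xi>))\<^sup>2) =
          ennreal (4 * q / (c * (q - 2)) * (norm (F \<xi>))\<^sup>2) *
            ennreal (indicator {0<..<B * norm \<xi> powr e} \<tau> * ((q - 2) * \<tau> powr (q - 2 - 1)))"
          unfolding r alg using q c by (intro ennreal_mult) auto
      qed
      also have "\<dots> = ennreal (4 * q / (c * (q - 2)) * (norm (F \<xi>))\<^sup>2) * ennreal ((B * norm \<xi> powr e) powr (q - 2))"
        using q B by (subst nn_integral_cmult) (measurable, subst nn_integral_powr_layer, auto)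
      also have "(B * norm \<xi> powr e) powr (q - 2) = B powr (q - 2) * (norm \<xi> powr s)\<^sup>2"
      proof -
        have "(norm \<xi> powr e) powr (q - 2) = norm \<xi> powr (2 * s)" using e by (simp add: powr_powr q2)
        also have "\<dots> = (norm \<xi> powr s)\<^sup>2" by (simp add: power2_eq_square powr_add[symmetric])
        finally show ?thesis using B by (simp add: powr_mult)
      qed
      also have "ennreal (4 * q / (c * (q - 2)) * (norm (F \<xi>))\<^sup>2) * ennreal (B powr (q - 2) * (norm \<xi> powr s)\<^sup>2) =
         ennreal (K * N powr (q - 2)) * ennreal ((norm \<xi> powr s * norm (F \<xi>))\<^sup>2)"
      proof -
        have "B powr (q - 2) = (2 * sqrt w / c) powr (q - 2) * N powr (q - 2)"
          unfolding B_def using w0 c N by (subst powr_mult[symmetric]) (auto simp: mult_ac)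
        then have "4 * q / (c * (q - 2)) * (norm (F \<xi>))\<^sup>2 * (B powr (q - 2) * (norm \<xi> powr s)\<^sup>2) =
          K * N powr (q - 2) * (norm \<xi> powr s * norm (F \<xi>))\<^sup>2"
          by (simp add: K_def power_mult_distrib mult_ac)
        then show ?thesis using q c K by (simp add: ennreal_mult[symmetric])
      qed
      finally show "(\<integral>\<^sup>+\<tau>. ennreal (4 * q / c * (indicator {0<..<B * norm \<xi> powr e} \<tau> * \<tau> powr (q - 3)) * (norm (F \<xi>))\<^sup>2) \<partial>lborel) =
        ennreal (K * N powr (q - 2)) * ennreal ((norm \<xi> powr s * norm (F \<xi>))\<^sup>2)" .
    qed
    also have "\<dots> = ennreal (K * N powr (q - 2)) * (\<integral>\<^sup>+\<xi>. ennreal ((norm \<xi> powr s * norm (F \<xi>))\<^sup>2) \<partial>lborel)"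
      by (rule nn_integral_cmult) measurable
    also have "(\<integral>\<^sup>+\<xi>. ennreal ((norm \<xi> powr s * norm (F \<xi>))\<^sup>2) \<partial>lborel) =
        ennreal (LINT \<xi>|lborel. (norm \<xi> powr s * norm (F \<xi>))\<^sup>2)"
      by (rule nn_integral_eq_integral[OF N(2)]) simp
    also have "ennreal (K * N powr (q - 2)) * \<dots> \<le> ennreal (K * N powr (q - 2)) * ennreal (N\<^sup>2)"
      by (intro mult_left_mono ennreal_leI N(3)) simp
    also have "\<dots> = ennreal (K * N powr q)"
    proof -
      have "N powr (q - 2) * N\<^sup>2 = N powr q" using N(1) powr_diff[of N q 2] by simp
      then show ?thesis using K by (simp add: ennreal_mult[symmetric] mult.assoc)
    qed
    finally show ?thesis .
  qed
  show thesis by (rule that[OF K bound])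
qed


text \<open>Young's inequality applied pointwise to the normalised functions. Positive upper bounds in place
  of the norms themselves keep the normalisation meaningful when a function vanishes.\<close>

lemma holder_nn_integral:
  fixes u v :: "'a::euclidean_space \<Rightarrow> real" and P Q \<alpha> \<beta> :: real
  assumes [measurable]: "u \<in> borel_measurable borel" "v \<in> borel_measurable borel"
    and nonneg: "\<And>x. 0 \<le> u x" "\<And>x. 0 \<le> v x"
    and PQ: "P > 1" "Q > 1" "1 / P + 1 / Q = 1" and pos: "\<alpha> > 0" "\<beta> > 0"
    and u: "(\<integral>\<^sup>+x. ennreal (u x powr P) \<partial>lborel) \<le> ennreal \<alpha>"
    and v: "(\<integral>\<^sup>+x. ennreal (v x powr Q) \<partial>lborel) \<le> ennreal \<beta>"
  shows "(\<integral>\<^sup>+x. ennreal (u x * v x) \<partial>lborel) \<le> ennreal (\<alpha> powr (1 / P) * \<beta> powr (1 / Q))"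
proof -
  define A where "A = \<alpha> powr (1 / P)"
  define B where "B = \<beta> powr (1 / Q)"
  have AB: "A > 0" "B > 0" using pos by (simp_all add: A_def B_def)
  have AP: "A powr P = \<alpha>" and BQ: "B powr Q = \<beta>" using pos PQ by (simp_all add: A_def B_def powr_powr)
  have ptw: "u x * v x \<le> A * B / (P * \<alpha>) * u x powr P + A * B / (Q * \<beta>) * v x powr Q" for x
  proof -
    have "u x / A * (v x / B) \<le> (u x / A) powr P / P + (v x / B) powr Q / Q"
      using PQ nonneg AB by (intro Youngs_inequality) auto
    also have "\<dots> = u x powr P / (P * \<alpha>) + v x powr Q / (Q * \<beta>)"
      using nonneg[of x] AB by (simp add: powr_divide AP BQ mult.commute)
    finally have "A * B * (u x / A * (v x / B)) \<le> A * B * (u x powr P / (P * \<alpha>) + v x powr Q / (Q * \<beta>))"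
      using AB by (intro mult_left_mono) auto
    then show ?thesis using AB by (simp add: distrib_left)
  qed
  have "(\<integral>\<^sup>+x. ennreal (u x * v x) \<partial>lborel) \<le>
      (\<integral>\<^sup>+x. ennreal (A * B / (P * \<alpha>)) * ennreal (u x powr P) + ennreal (A * B / (Q * \<beta>)) * ennreal (v x powr Q) \<partial>lborel)"
  proof (rule nn_integral_mono)
    fix x
    have "ennreal (u x * v x) \<le> ennreal (A * B / (P * \<alpha>) * u x powr P + A * B / (Q * \<beta>) * v x powr Q)"
      by (rule ennreal_leI[OF ptw])
    then show "ennreal (u x * v x) \<le> ennreal (A * B / (P * \<alpha>)) * ennreal (u x powr P) + ennreal (A * B / (Q * \<beta>)) * ennreal (v x powr Q)"
      using AB PQ pos by (simp add: ennreal_mult[symmetric] ennreal_plus[symmetric] del: ennreal_plus)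
  qed
  also have "\<dots> = ennreal (A * B / (P * \<alpha>)) * (\<integral>\<^sup>+x. ennreal (u x powr P) \<partial>lborel) +
      ennreal (A * B / (Q * \<beta>)) * (\<integral>\<^sup>+x. ennreal (v x powr Q) \<partial>lborel)"
    by (simp add: nn_integral_add nn_integral_cmult)
  also have "\<dots> \<le> ennreal (A * B / (P * \<alpha>)) * ennreal \<alpha> + ennreal (A * B / (Q * \<beta>)) * ennreal \<beta>"
    by (intro add_mono mult_left_mono u v) auto
  also have "\<dots> = ennreal (A * B / (P * \<alpha>) * \<alpha> + A * B / (Q * \<beta>) * \<beta>)"
    using AB PQ pos by (simp add: ennreal_mult[symmetric] ennreal_plus[symmetric] del: ennreal_plus)
  also have "A * B / (P * \<alpha>) * \<alpha> + A * B / (Q * \<beta>) * \<beta> = A * B * (1 / P + 1 / Q)"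
    using pos by (simp add: distrib_left)
  finally show ?thesis using PQ by (simp add: A_def B_def)
qed

text \<open>Hoelder's inequality with the exponents $d/s$ and $2d/(d-2s)$, whose reciprocals add up to $1/2$:
  multiplication by a coefficient in $L^{d/s}$ maps the homogeneous Sobolev space of order \<open>s\<close> to $L^2$.\<close>

lemma multiplication_bound:
  fixes s :: real
  assumes s: "0 < s" "2 * s < real DIM('a::euclidean_space)"
  obtains K :: real where "K > 0"
    "\<And>(a :: 'a \<Rightarrow> real) \<alpha> f g. a \<in> Lp_space (real DIM('a) / s) \<Longrightarrow> \<alpha> > 0 \<Longrightarrow>
      (LINT x|lborel. norm (a x) powr (real DIM('a) / s)) \<le> \<alpha> \<Longrightarrow> has_frac_laplacian (s / 2) f g \<Longrightarrow>
      (\<lambda>x. a x *\<^sub>R f x) \<in> Lp_space 2 \<and>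
      norm (cls (\<lambda>x. a x *\<^sub>R f x)) \<le> K * \<alpha> powr (s / real DIM('a)) * norm (cls g)"
proof -
  let ?d = "real DIM('a)"
  define q where "q = 2 * ?d / (?d - 2 * s)"
  define P where "P = ?d / (2 * s)"
  define Q where "Q = ?d / (?d - 2 * s)"
  have PQ: "P > 1" "Q > 1" "1 / P + 1 / Q = 1"
    using s by (simp_all add: P_def Q_def add_divide_distrib[symmetric])
  have qQ: "q = 2 * Q" by (simp add: q_def Q_def)
  obtain K0 where K0: "K0 > 0"
    and sob0: "\<And>(f :: 'a \<Rightarrow> complex) F N. has_fourier_transform f F \<Longrightarrow> N > 0 \<Longrightarrow>
      integrable lborel (\<lambda>\<xi>. (norm \<xi> powr s * norm (F \<xi>))\<^sup>2) \<Longrightarrow>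
      (LINT \<xi>|lborel. (norm \<xi> powr s * norm (F \<xi>))\<^sup>2) \<le> N\<^sup>2 \<Longrightarrow>
      (\<integral>\<^sup>+x. ennreal (norm (f x) powr (2 * ?d / (?d - 2 * s))) \<partial>lborel) \<le>
        ennreal (K0 * N powr (2 * ?d / (?d - 2 * s)))"
    by (rule sobolev_inequality[OF s]) (rule that; blast)
  note sob = sob0[folded q_def]
  define c where "c = sqrt ((2 * pi) ^ DIM('a))"
  have c: "c > 0" by (simp add: c_def)
  define M where "M = sqrt (K0 powr (1 / Q))"
  have M: "M > 0" using K0 by (simp add: M_def)
  have bound: "(\<lambda>x. a x *\<^sub>R f x) \<in> Lp_space 2 \<and>
      norm (cls (\<lambda>x. a x *\<^sub>R f x)) \<le> (M * c) * \<alpha> powr (s / ?d) * norm (cls g)"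
    if a: "a \<in> Lp_space (?d / s)" and \<alpha>: "\<alpha> > 0" "(LINT x|lborel. norm (a x) powr (?d / s)) \<le> \<alpha>"
      and fg: "has_frac_laplacian (s / 2) f g" for a :: "'a \<Rightarrow> real" and \<alpha> f g
  proof -
    obtain F where F: "has_fourier_transform f F"
        "has_fourier_transform g (\<lambda>\<xi>. complex_of_real (norm \<xi> powr s) * F \<xi>)"
      by (rule has_frac_laplacian_half[OF fg])
    note L = has_ft_L2[OF F(1)] has_ft_L2[OF F(2)]
    have [measurable]: "f \<in> borel_measurable borel" using L by (simp add: L2_iff)
    have [measurable]: "a \<in> borel_measurable borel" by (rule Lp_space_measurable[OF a])
    have eq: "(norm (complex_of_real (norm \<xi> powr s) * F \<xi>))\<^sup>2 = (norm \<xi> powr s * norm (F \<xi>))\<^sup>2" for \<xi>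
      by (simp add: norm_mult)
    have iF: "integrable lborel (\<lambda>\<xi>. (norm \<xi> powr s * norm (F \<xi>))\<^sup>2)"
      using L(4) by (simp only: L2_iff eq)
    have "(LINT \<xi>|lborel. (norm \<xi> powr s * norm (F \<xi>))\<^sup>2) = (norm (cls (\<lambda>\<xi>. complex_of_real (norm \<xi> powr s) * F \<xi>)))\<^sup>2"
      by (simp only: norm_cls_sq[OF L(4)] eq)
    also have "\<dots> = (c * norm (cls g))\<^sup>2" by (simp only: has_ft_norm[OF F(2)] c_def)
    finally have F2: "(LINT \<xi>|lborel. (norm \<xi> powr s * norm (F \<xi>))\<^sup>2) = (c * norm (cls g))\<^sup>2" .
    have main: "(\<integral>\<^sup>+x. ennreal ((norm (a x *\<^sub>R f x))\<^sup>2) \<partial>lborel) \<le> ennreal ((M * \<alpha> powr (s / ?d) * N)\<^sup>2)"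
      if N: "N > 0" "c * norm (cls g) \<le> N" for N
    proof -
      have "(c * norm (cls g))\<^sup>2 \<le> N\<^sup>2" using N c by (intro power_mono) auto
      then have f: "(\<integral>\<^sup>+x. ennreal (norm (f x) powr q) \<partial>lborel) \<le> ennreal (K0 * N powr q)"
        using F2 by (intro sob[OF F(1) N(1) iF]) simp
      have ap: "((norm (a x))\<^sup>2) powr P = norm (a x) powr (?d / s)" for x
      proof -
        have "((norm (a x))\<^sup>2) powr P = (norm (a x) powr 2) powr P" by simp
        then show ?thesis by (simp only: powr_powr) (simp add: P_def)
      qed
      have fq: "((norm (f x))\<^sup>2) powr Q = norm (f x) powr q" for x
      proof -
        have "((norm (f x))\<^sup>2) powr Q = (norm (f x) powr 2) powr Q" by simp
        then show ?thesis by (simp only: powr_powr qQ)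
      qed
      have aL: "(\<integral>\<^sup>+x. ennreal (((norm (a x))\<^sup>2) powr P) \<partial>lborel) \<le> ennreal \<alpha>"
        unfolding ap using nn_integral_eq_integral[OF Lp_space_integrable[OF a]] \<alpha> by (simp add: ennreal_leI)
      have "(\<integral>\<^sup>+x. ennreal ((norm (a x))\<^sup>2 * (norm (f x))\<^sup>2) \<partial>lborel) \<le>
          ennreal (\<alpha> powr (1 / P) * (K0 * N powr q) powr (1 / Q))"
        by (rule holder_nn_integral[OF _ _ _ _ PQ \<alpha>(1) _ aL]) (use f K0 N in \<open>simp_all add: fq\<close>)
      also have "\<alpha> powr (1 / P) * (K0 * N powr q) powr (1 / Q) = (M * \<alpha> powr (s / ?d) * N)\<^sup>2"
      proof -
        have "(K0 * N powr q) powr (1 / Q) = K0 powr (1 / Q) * N powr 2"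
          using K0 N PQ by (simp add: powr_mult powr_powr qQ)
        also have "\<dots> = M\<^sup>2 * N\<^sup>2" using K0 N by (simp add: M_def)
        finally have 1: "(K0 * N powr q) powr (1 / Q) = M\<^sup>2 * N\<^sup>2" .
        have "\<alpha> powr (1 / P) = \<alpha> powr (s / ?d + s / ?d)" by (simp add: P_def)
        then have 2: "\<alpha> powr (1 / P) = (\<alpha> powr (s / ?d))\<^sup>2" by (simp only: powr_add power2_eq_square)
        show ?thesis unfolding 1 2 by (simp add: power_mult_distrib mult_ac)
      qed
      finally show ?thesis by (simp add: power_mult_distrib)
    qed
    have "0 \<le> c * norm (cls g)" using c by simp
    then have pos: "c * norm (cls g) + e > 0" if "e > 0" for e using that by simp
    have "(\<integral>\<^sup>+x. ennreal ((norm (a x *\<^sub>R f x))\<^sup>2) \<partial>lborel) < \<infinity>"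
      using main[OF pos[of 1]] by (simp add: le_less_trans)
    then have i: "integrable lborel (\<lambda>x. (norm (a x *\<^sub>R f x))\<^sup>2)"
      by (simp add: integrable_iff_bounded)
    then have af: "(\<lambda>x. a x *\<^sub>R f x) \<in> Lp_space 2" by (simp add: L2_iff)
    have "norm (cls (\<lambda>x. a x *\<^sub>R f x)) \<le> (M * c) * \<alpha> powr (s / ?d) * norm (cls g)"
    proof (rule field_le_epsilon)
      fix e :: real assume e: "e > 0"
      define k where "k = M * \<alpha> powr (s / ?d)"
      have k: "k > 0" using M \<alpha> by (simp add: k_def)
      define N where "N = c * norm (cls g) + e / k"
      have N: "N > 0" "c * norm (cls g) \<le> N" using pos[of "e / k"] e k by (simp_all add: N_def)
      have "ennreal ((norm (cls (\<lambda>x. a x *\<^sub>R f x)))\<^sup>2) \<le> ennreal ((k * N)\<^sup>2)"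
        unfolding norm_cls_sq[OF af] k_def
        using main[OF N] nn_integral_eq_integral[OF i] by simp
      then have "(norm (cls (\<lambda>x. a x *\<^sub>R f x)))\<^sup>2 \<le> (k * N)\<^sup>2" by (simp add: ennreal_le_iff)
      then have "norm (cls (\<lambda>x. a x *\<^sub>R f x)) \<le> k * N"
        by (rule power2_le_imp_le) (use k N in simp)
      also have "\<dots> = k * (c * norm (cls g)) + e"
        using k by (simp add: N_def distrib_left)
      also have "k * (c * norm (cls g)) = (M * c) * \<alpha> powr (s / ?d) * norm (cls g)"
        by (simp add: k_def mult_ac)
      finally show "norm (cls (\<lambda>x. a x *\<^sub>R f x)) \<le> (M * c) * \<alpha> powr (s / ?d) * norm (cls g) + e" .
    qed
    with af show ?thesis by simp
  qed
  have "M * c > 0" using M c by simp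
  then show thesis by (rule that[OF _ bound])
qed



section \<open>Completeness\<close>

text \<open>Riesz and Fischer: along a subsequence with summable increments the representatives converge almost
  everywhere, and Fatou's lemma turns this into convergence in norm.\<close>

lemma l2_Cauchy_convergent:
  fixes X :: "nat \<Rightarrow> 'a::euclidean_space l2"
  assumes "Cauchy X"
  shows "convergent X"
proof -
  have "\<exists>N. \<forall>m\<ge>N. \<forall>n\<ge>N. dist (X m) (X n) < (1/2) ^ k" for k :: nat
    by (rule metric_CauchyD[OF assms]) simp
  then obtain N where N: "\<And>k m n. m \<ge> N k \<Longrightarrow> n \<ge> N k \<Longrightarrow> dist (X m) (X n) < (1/2) ^ k" by metis
  define r where "r k = (\<Sum>j\<le>k. N j)" for k
  have rN: "r m \<ge> N n" if "n \<le> m" for m n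
    unfolding r_def using that by (intro member_le_sum) auto
  have "\<exists>f. f \<in> Lp_space 2 \<and> X (r k) = cls f" for k
  proof -
    obtain f where "f \<in> Lp_space 2" "X (r k) = cls f" by (rule cls_surj)
    then show ?thesis by (intro exI conjI)
  qed
  then obtain f where f: "f k \<in> Lp_space 2" and Xf: "X (r k) = cls (f k)" for k by metis
  have [measurable]: "f k \<in> borel_measurable borel" for k using f[of k] by (simp add: L2_iff)
  have close: "norm (cls (f m) - cls (f n)) < (1/2) ^ n" if "n \<le> m" for m n
    using N[OF rN[OF that] rN[OF order_refl]] by (simp add: Xf dist_norm)
  define d where "d k x = norm (f (Suc k) x - f k x)" for k x
  have [measurable]: "d k \<in> borel_measurable borel" for k unfolding d_def[abs_def] by measurable
  let ?d = "\<lambda>k x. complex_of_real (d k x)"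
  have d2: "?d k \<in> Lp_space 2" for k
    using L2_diff[OF f[of "Suc k"] f[of k]] by (simp add: L2_iff d_def)
  have nd: "norm (cls (?d k)) \<le> (1/2) ^ k" for k
  proof -
    have "norm (cls (?d k)) = norm (cls (\<lambda>x. f (Suc k) x - f k x))"
      unfolding norm_cls[OF d2] norm_cls[OF L2_diff[OF f f]] Lp_norm_2 by (simp add: d_def)
    also have "\<dots> = norm (cls (f (Suc k)) - cls (f k))" by (simp only: cls_diff[OF f f])
    finally show ?thesis using close[of k "Suc k"] by simp
  qed
  define S where "S n x = (\<Sum>k<n. d k x)" for n x
  have [measurable]: "S n \<in> borel_measurable borel" for n unfolding S_def[abs_def] by measurable
  have S: "(\<lambda>x. complex_of_real (S n x)) \<in> Lp_space 2 \<and> norm (cls (\<lambda>x. complex_of_real (S n x))) \<le> (\<Sum>k<n. (1/2) ^ k)" for n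
  proof (induction n)
    case 0
    then show ?case by (simp add: S_def L2_zero)
  next
    case (Suc n)
    have eq: "(\<lambda>x. complex_of_real (S (Suc n) x)) = (\<lambda>x. complex_of_real (S n x) + ?d n x)"
      by (simp add: S_def)
    have "norm (cls (\<lambda>x. complex_of_real (S n x)) + cls (?d n)) \<le> (\<Sum>k<n. (1/2) ^ k) + (1/2) ^ n"
      using Suc nd[of n] by (intro norm_triangle_mono) auto
    then show ?case unfolding eq using Suc d2[of n] by (simp add: L2_add cls_add)
  qed
  have geo: "(\<Sum>k<n. (1/2::real) ^ k) \<le> 2" for n
    by (simp add: sum_gp_strict)
  have Sn: "(\<integral>\<^sup>+x. ennreal ((S n x)\<^sup>2) \<partial>lborel) \<le> ennreal 4" for n
  proof -
    have i: "integrable lborel (\<lambda>x. (S n x)\<^sup>2)" using S[of n] by (simp add: L2_iff)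
    have "(LINT x|lborel. (S n x)\<^sup>2) = (norm (cls (\<lambda>x. complex_of_real (S n x))))\<^sup>2"
      using S[of n] by (simp add: norm_cls_sq)
    also have "\<dots> \<le> 2\<^sup>2" using S[of n] geo[of n] by (intro power_mono) auto
    finally have "ennreal (LINT x|lborel. (S n x)\<^sup>2) \<le> ennreal 4" by (intro ennreal_leI) simp
    moreover have "(\<integral>\<^sup>+x. ennreal ((S n x)\<^sup>2) \<partial>lborel) = ennreal (LINT x|lborel. (S n x)\<^sup>2)"
      by (rule nn_integral_eq_integral[OF i]) simp
    ultimately show ?thesis by (simp only:)
  qed
  have d0: "0 \<le> d k x" for k x by (simp add: d_def)
  have S0: "0 \<le> S n x" for n x by (simp add: S_def sum_nonneg d0)
  have Smono: "S m x \<le> S n x" if "m \<le> n" for m n x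
    unfolding S_def using that by (intro sum_mono2) (auto simp: d0)
  have "(\<integral>\<^sup>+x. (SUP n. ennreal ((S n x)\<^sup>2)) \<partial>lborel) = (SUP n. \<integral>\<^sup>+x. ennreal ((S n x)\<^sup>2) \<partial>lborel)"
    by (rule nn_integral_monotone_convergence_SUP)
       (auto simp: incseq_def le_fun_def S0 intro!: ennreal_leI power_mono Smono)
  also have "\<dots> \<le> ennreal 4" by (intro SUP_least Sn)
  finally have "(\<integral>\<^sup>+x. (SUP n. ennreal ((S n x)\<^sup>2)) \<partial>lborel) \<noteq> \<infinity>" by (auto simp: top_unique)
  then have "AE x in lborel. (SUP n. ennreal ((S n x)\<^sup>2)) \<noteq> \<infinity>"
    by (intro nn_integral_PInf_AE) auto
  then have conv: "AE x in lborel. (\<lambda>n. f n x) \<longlonglongrightarrow> lim (\<lambda>n. f n x)"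
  proof eventually_elim
    case (elim x)
    define B where "B = enn2real (SUP n. ennreal ((S n x)\<^sup>2))"
    have "(SUP n. ennreal ((S n x)\<^sup>2)) < top" using elim by (simp only: infinity_ennreal_def less_top)
    then have B: "ennreal B = (SUP n. ennreal ((S n x)\<^sup>2))" unfolding B_def by (rule ennreal_enn2real)
    have SB: "(S n x)\<^sup>2 \<le> B" for n
    proof -
      have "ennreal ((S n x)\<^sup>2) \<le> ennreal B" unfolding B by (rule SUP_upper) simp
      moreover have "0 \<le> B" by (simp add: B_def)
      ultimately show ?thesis by (simp only: ennreal_le_iff)
    qed
    have "S n x \<le> B + 1" for n
    proof -
      have "0 \<le> (S n x - 1/2)\<^sup>2" by simp
      then have "S n x \<le> (S n x)\<^sup>2 + 1" by (simp add: power2_eq_square algebra_simps)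
      with SB[of n] show ?thesis by simp
    qed
    then have "summable (\<lambda>k. d k x)"
      by (intro summableI_nonneg_bounded[where x="B + 1"]) (auto simp: d0 S_def[symmetric])
    then have "summable (\<lambda>k. f (Suc k) x - f k x)"
      unfolding d_def by (rule summable_norm_cancel)
    then have "convergent (\<lambda>n. \<Sum>k<n. f (Suc k) x - f k x)" by (simp add: summable_iff_convergent)
    then have "convergent (\<lambda>n. f n x - f 0 x)" by (simp only: sum_lessThan_telescope[of "\<lambda>n. f n x"])
    then have "convergent (\<lambda>n. (f n x - f 0 x) + f 0 x)" by (intro convergent_add convergent_const)
    then show ?case by (simp add: convergent_LIMSEQ_iff)
  qed
  define G where "G x = lim (\<lambda>n. f n x)" for x
  have [measurable]: "G \<in> borel_measurable borel"
    unfolding G_def[abs_def] by (rule borel_measurable_lim_metric) measurable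
  have fatou: "(\<integral>\<^sup>+x. ennreal ((norm (G x - f n x))\<^sup>2) \<partial>lborel) \<le> ennreal (((1/2) ^ n)\<^sup>2)" for n
  proof -
    have "(\<integral>\<^sup>+x. ennreal ((norm (G x - f n x))\<^sup>2) \<partial>lborel) \<le>
        (\<integral>\<^sup>+x. liminf (\<lambda>m. ennreal ((norm (f m x - f n x))\<^sup>2)) \<partial>lborel)"
    proof (rule nn_integral_mono_AE)
      show "AE x in lborel. ennreal ((norm (G x - f n x))\<^sup>2) \<le> liminf (\<lambda>m. ennreal ((norm (f m x - f n x))\<^sup>2))"
        using conv
      proof eventually_elim
        case (elim x)
        have "(\<lambda>m. ennreal ((norm (f m x - f n x))\<^sup>2)) \<longlonglongrightarrow> ennreal ((norm (G x - f n x))\<^sup>2)"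
          by (intro tendsto_intros tendsto_ennrealI elim[folded G_def])
        from lim_imp_Liminf[OF sequentially_bot this]
        show ?case by (simp only: order_refl)
      qed
    qed
    also have "\<dots> \<le> liminf (\<lambda>m. \<integral>\<^sup>+x. ennreal ((norm (f m x - f n x))\<^sup>2) \<partial>lborel)"
      by (rule nn_integral_liminf) measurable
    also have "\<dots> \<le> ennreal (((1/2) ^ n)\<^sup>2)"
    proof (rule Liminf_le, simp)
      show "\<forall>\<^sub>F m in sequentially. (\<integral>\<^sup>+x. ennreal ((norm (f m x - f n x))\<^sup>2) \<partial>lborel) \<le> ennreal (((1/2) ^ n)\<^sup>2)"
        using eventually_ge_at_top[of n]
      proof eventually_elim
        case (elim m)
        have L: "(\<lambda>x. f m x - f n x) \<in> Lp_space 2" by (rule L2_diff[OF f f])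
        then have i: "integrable lborel (\<lambda>x. (norm (f m x - f n x))\<^sup>2)" by (simp add: L2_iff)
        have "(norm (cls (f m) - cls (f n)))\<^sup>2 \<le> ((1/2) ^ n)\<^sup>2"
          using close[OF elim] by (intro power_mono) auto
        then have "(LINT x|lborel. (norm (f m x - f n x))\<^sup>2) \<le> ((1/2) ^ n)\<^sup>2"
          by (simp only: norm_cls_sq[OF L, symmetric] cls_diff[OF f f])
        then have "ennreal (LINT x|lborel. (norm (f m x - f n x))\<^sup>2) \<le> ennreal (((1/2) ^ n)\<^sup>2)"
          by (rule ennreal_leI)
        moreover have "(\<integral>\<^sup>+x. ennreal ((norm (f m x - f n x))\<^sup>2) \<partial>lborel) =
            ennreal (LINT x|lborel. (norm (f m x - f n x))\<^sup>2)"
          by (rule nn_integral_eq_integral[OF i]) simp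
        ultimately show ?case by (simp only:)
      qed
    qed
    finally show ?thesis .
  qed
  have Gf: "(\<lambda>x. G x - f n x) \<in> Lp_space 2" for n
    using fatou[of n] by (auto simp: L2_iff integrable_iff_bounded intro: le_less_trans)
  have GL: "G \<in> Lp_space 2" using L2_add[OF Gf[of 0] f[of 0]] by simp
  have lim: "norm (cls G - cls (f n)) \<le> (1/2) ^ n" for n
  proof (rule power2_le_imp_le)
    have i: "integrable lborel (\<lambda>x. (norm (G x - f n x))\<^sup>2)" using Gf[of n] by (simp add: L2_iff)
    have "(\<integral>\<^sup>+x. ennreal ((norm (G x - f n x))\<^sup>2) \<partial>lborel) = ennreal (LINT x|lborel. (norm (G x - f n x))\<^sup>2)"
      by (rule nn_integral_eq_integral[OF i]) simp
    also have "(LINT x|lborel. (norm (G x - f n x))\<^sup>2) = (norm (cls G - cls (f n)))\<^sup>2"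
      by (simp only: cls_diff[OF GL f, symmetric] norm_cls_sq[OF Gf])
    finally have "ennreal ((norm (cls G - cls (f n)))\<^sup>2) \<le> ennreal (((1/2) ^ n)\<^sup>2)"
      using fatou[of n] by (simp only:)
    then show "(norm (cls G - cls (f n)))\<^sup>2 \<le> ((1/2) ^ n)\<^sup>2" by (simp add: ennreal_le_iff)
  qed simp
  have "X \<longlonglongrightarrow> cls G"
  proof (rule metric_LIMSEQ_I)
    fix e :: real assume e: "e > 0"
    obtain k where k: "(1/2::real) ^ k < e / 2" using real_arch_pow_inv[of "e/2" "1/2"] e by auto
    have "dist (X n) (cls G) < e" if n: "n \<ge> N k" for n
    proof -
      have "dist (X n) (cls G) \<le> dist (X n) (X (r k)) + dist (X (r k)) (cls G)" by (rule dist_triangle)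
      moreover have "dist (X n) (X (r k)) < (1/2) ^ k" by (rule N[OF n rN[OF order_refl]])
      moreover have "dist (X (r k)) (cls G) \<le> (1/2) ^ k"
        using lim[of k] by (simp add: Xf dist_norm norm_minus_commute)
      ultimately show ?thesis using k by simp
    qed
    then show "\<exists>n0. \<forall>n\<ge>n0. dist (X n) (cls G) < e" by (intro exI allI impI)
  qed
  then show ?thesis by (rule convergentI)
qed

text \<open>Completeness is what allows continuous curves in \<open>l2\<close> to be integrated.\<close>

instance l2 :: (euclidean_space) banach
  by standard (rule l2_Cauchy_convergent)

section \<open>Smooth test functions\<close>

lemma frechet_derivative_eqI: "(f has_derivative f') (at x) \<Longrightarrow> frechet_derivative f (at x) = f'"
  by (rule frechet_derivative_at[symmetric])

lemma Ck_SucD: "Ck (Suc k) f \<Longrightarrow> Ck k f"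
proof (induction k arbitrary: f)
  case 0
  then show ?case
    by (simp add: continuous_on_eq_continuous_at differentiable_imp_continuous_within)
next
  case (Suc k)
  have "\<forall>x. f differentiable (at x)" and *: "\<forall>v. Ck (Suc k) (\<lambda>x. frechet_derivative f (at x) v)"
    using Suc.prems unfolding Ck.simps(2)[of "Suc k" f] by blast+
  moreover have "\<forall>v. Ck k (\<lambda>x. frechet_derivative f (at x) v)"
  proof
    fix v
    show "Ck k (\<lambda>x. frechet_derivative f (at x) v)" by (rule Suc.IH[OF spec[OF *]])
  qed
  ultimately show ?case unfolding Ck.simps(2)[of k f] by (intro conjI)
qed

text \<open>The recursion of \<open>Ck\<close> mentions the Frechet derivative; in inductions any explicit derivative is more convenient.\<close>

lemma Ck_SucI:
  assumes "\<And>x. (f has_derivative f' x) (at x)" "\<And>v. Ck k (\<lambda>x. f' x v)"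
  shows "Ck (Suc k) f"
proof -
  have "frechet_derivative f (at x) = f' x" for x by (rule frechet_derivative_eqI[OF assms(1)])
  then show ?thesis using assms by (auto simp: differentiable_def)
qed

lemma Ck_SucE:
  assumes "Ck (Suc k) f"
  obtains f' where "\<forall>x. (f has_derivative f' x) (at x)" "\<forall>v. Ck k (\<lambda>x. f' x v)"
proof (rule that)
  show "\<forall>x. (f has_derivative frechet_derivative f (at x)) (at x)"
    using assms by (simp add: frechet_derivative_works[symmetric])
  show "\<forall>v. Ck k (\<lambda>x. frechet_derivative f (at x) v)" using assms by simp
qed

lemma Ck_bounded_linear: "bounded_linear h \<Longrightarrow> Ck k f \<Longrightarrow> Ck k (\<lambda>x. h (f x))"
proof (induction k arbitrary: f)
  case 0
  then show ?case using bounded_linear.continuous_on by fastforce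
next
  case (Suc k)
  obtain f' where "\<forall>x. (f has_derivative f' x) (at x)" "\<forall>v. Ck k (\<lambda>x. f' x v)"
    by (rule Ck_SucE[OF Suc.prems(2)])
  note f' = this[rule_format]
  show ?case
    by (rule Ck_SucI[where f'="\<lambda>x v. h (f' x v)"])
       (intro bounded_linear.has_derivative[OF Suc.prems(1)] f', rule Suc.IH[OF Suc.prems(1) f'(2)])
qed

lemma Ck_add: "Ck k f \<Longrightarrow> Ck k g \<Longrightarrow> Ck k (\<lambda>x. f x + g x)"
proof (induction k arbitrary: f g)
  case 0
  then show ?case by (simp add: continuous_on_add)
next
  case (Suc k)
  obtain f' where "\<forall>x. (f has_derivative f' x) (at x)" "\<forall>v. Ck k (\<lambda>x. f' x v)"
    by (rule Ck_SucE[OF Suc.prems(1)])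
  note f' = this[rule_format]
  obtain g' where "\<forall>x. (g has_derivative g' x) (at x)" "\<forall>v. Ck k (\<lambda>x. g' x v)"
    by (rule Ck_SucE[OF Suc.prems(2)])
  note g' = this[rule_format]
  show ?case
    by (rule Ck_SucI[where f'="\<lambda>x v. f' x v + g' x v"]) (intro has_derivative_add f' g', rule Suc.IH[OF f'(2) g'(2)])
qed

lemma Ck_mult:
  fixes f g :: "'a::real_normed_vector \<Rightarrow> real"
  shows "Ck k f \<Longrightarrow> Ck k g \<Longrightarrow> Ck k (\<lambda>x. f x * g x)"
proof (induction k arbitrary: f g)
  case 0
  then show ?case by (simp add: continuous_on_mult)
next
  case (Suc k)
  obtain f' where "\<forall>x. (f has_derivative f' x) (at x)" "\<forall>v. Ck k (\<lambda>x. f' x v)"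
    by (rule Ck_SucE[OF Suc.prems(1)])
  note f' = this[rule_format]
  obtain g' where "\<forall>x. (g has_derivative g' x) (at x)" "\<forall>v. Ck k (\<lambda>x. g' x v)"
    by (rule Ck_SucE[OF Suc.prems(2)])
  note g' = this[rule_format]
  show ?case
    by (rule Ck_SucI[where f'="\<lambda>x v. f x * g' x v + f' x v * g x"])
       (intro has_derivative_mult f' g',
        intro Ck_add Suc.IH f' g' Ck_SucD[OF Suc.prems(1)] Ck_SucD[OF Suc.prems(2)])
qed

lemma Ck_affine: "bounded_linear L \<Longrightarrow> Ck k f \<Longrightarrow> Ck k (\<lambda>x. f (c + L x))"
proof (induction k arbitrary: f)
  case 0
  have "continuous_on UNIV (\<lambda>x. c + L x)"
    by (intro continuous_intros bounded_linear.continuous_on[OF 0(1)])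
  then show ?case using 0(2) by (simp add: continuous_on_compose2[of UNIV f])
next
  case (Suc k)
  obtain f' where "\<forall>x. (f has_derivative f' x) (at x)" "\<forall>v. Ck k (\<lambda>x. f' x v)"
    by (rule Ck_SucE[OF Suc.prems(2)])
  note f' = this[rule_format]
  show ?case
  proof (rule Ck_SucI[where f'="\<lambda>x v. f' (c + L x) (L v)"])
    fix x
    have "((\<lambda>x. c + L x) has_derivative L) (at x)"
      by (rule has_derivative_eq_rhs[OF has_derivative_add[OF has_derivative_const
            bounded_linear_imp_has_derivative[OF Suc.prems(1)]]]) simp
    from has_derivative_compose[OF this f'(1)]
    show "((\<lambda>x. f (c + L x)) has_derivative (\<lambda>v. f' (c + L x) (L v))) (at x)" .
  next
    fix v
    show "Ck k (\<lambda>x. f' (c + L x) (L v))" by (rule Suc.IH[OF Suc.prems(1) f'(2)])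
  qed
qed

lemma Ck_primitive:
  fixes R \<rho> :: "real \<Rightarrow> real"
  assumes R: "\<And>t. (R has_real_derivative \<rho> t) (at t)" and \<rho>: "Ck k \<rho>"
  shows "Ck (Suc k) R"
  by (rule Ck_SucI[where f'="\<lambda>x v. \<rho> x * v"])
     (use R in \<open>simp add: has_field_derivative_def\<close>, rule Ck_bounded_linear[OF bounded_linear_mult_left \<rho>])

lemma Ck_real_derivative:
  fixes \<rho> :: "real \<Rightarrow> real"
  assumes "\<And>k. Ck k \<rho>"
  obtains \<rho>' where "\<And>t. (\<rho> has_real_derivative \<rho>' t) (at t)" "\<And>k. Ck k \<rho>'"
proof (rule that)
  show "(\<rho> has_real_derivative frechet_derivative \<rho> (at t) 1) (at t)" for t
  proof -
    have d: "(\<rho> has_derivative frechet_derivative \<rho> (at t)) (at t)"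
      using assms[of 1] by (simp add: frechet_derivative_works[symmetric])
    then have "bounded_linear (frechet_derivative \<rho> (at t))" by (rule has_derivative_bounded_linear)
    then have "frechet_derivative \<rho> (at t) v = frechet_derivative \<rho> (at t) 1 * v" for v
      using linear_simps(5)[of "frechet_derivative \<rho> (at t)" v 1] by (simp add: mult.commute)
    then have "frechet_derivative \<rho> (at t) = (*) (frechet_derivative \<rho> (at t) 1)" by (intro ext)
    with d show ?thesis by (simp add: has_field_derivative_def)
  qed
  show "Ck k (\<lambda>t. frechet_derivative \<rho> (at t) 1)" for k using assms[of "Suc k"] by simp
qed

lemma integral_zero_on:
  fixes f :: "real \<Rightarrow> real"
  shows "(\<And>x. x \<in> S \<Longrightarrow> f x = 0) \<Longrightarrow> integral S f = 0"
  using integral_cong[of S f "\<lambda>_. 0"] by simp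

text \<open>Restrict the mollifier to a line through a point where it is positive, integrate, and normalise. The step
  serves to build test functions in time from the mollifier in space.\<close>

lemma smooth_step:
  fixes \<psi> :: "'a::euclidean_space \<Rightarrow> real"
  assumes \<psi>: "test_function UNIV \<psi>" "\<And>x. 0 \<le> \<psi> x" and x0: "\<psi> x0 > 0"
  obtains R \<rho> :: "real \<Rightarrow> real" and b :: real where
    "b > 0" "\<And>k. Ck k \<rho>" "\<And>t. (R has_real_derivative \<rho> t) (at t)" "\<And>t. 0 \<le> \<rho> t"
    "\<And>t. \<bar>t\<bar> \<ge> b \<Longrightarrow> \<rho> t = 0" "\<And>t. t \<le> - b \<Longrightarrow> R t = 0" "\<And>t. t \<ge> b \<Longrightarrow> R t = 1"
proof -
  obtain e :: 'a where e: "e \<in> Basis" using nonempty_Basis by blast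
  define \<rho>0 where "\<rho>0 r = \<psi> (x0 + r *\<^sub>R e)" for r
  have Ck0: "Ck k \<rho>0" for k
    unfolding \<rho>0_def using \<psi>(1) by (intro Ck_affine bounded_linear_scaleR_left) (simp add: test_function_def)
  have cont: "continuous_on S \<rho>0" for S
    using Ck0[of 0] by (auto intro: continuous_on_subset)
  have pos: "0 \<le> \<rho>0 r" for r by (simp add: \<rho>0_def \<psi>)
  have "bounded (closure {x. \<psi> x \<noteq> 0})" using \<psi>(1) by (intro compact_imp_bounded) (simp add: test_function_def)
  then obtain B where B0: "\<forall>x\<in>closure {x. \<psi> x \<noteq> 0}. norm x \<le> B"
    unfolding bounded_iff by (elim exE)
  have B: "norm x \<le> B" if "\<psi> x \<noteq> 0" for x
    using bspec[OF B0, of x] subsetD[OF closure_subset, of x "{x. \<psi> x \<noteq> 0}"] that by simp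
  define b where "b = \<bar>B\<bar> + norm x0 + 1"
  have b: "b > 0" by (simp add: b_def add_nonneg_pos)
  have zero: "\<rho>0 r = 0" if "\<bar>r\<bar> > b - 1" for r
  proof (rule ccontr)
    assume "\<rho>0 r \<noteq> 0"
    then have "norm (x0 + r *\<^sub>R e) \<le> B" by (intro B) (simp add: \<rho>0_def)
    moreover have "norm (r *\<^sub>R e) \<le> norm (x0 + r *\<^sub>R e) + norm x0"
      using norm_triangle_ineq4[of "x0 + r *\<^sub>R e" x0] by simp
    ultimately show False using that e by (simp add: b_def)
  qed
  define R0 where "R0 x = integral {-b..x} \<rho>0" for x
  have R0z: "R0 x = 0" if "x < 1 - b" for x
    unfolding R0_def using zero that by (intro integral_zero_on) auto
  have der: "(R0 has_real_derivative \<rho>0 t) (at t)" for t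
  proof (cases "t > - b")
    case True
    have "((\<lambda>x. integral {-b..x} \<rho>0) has_real_derivative \<rho>0 t) (at t within {-b..t + 1})"
      using True by (intro integral_has_real_derivative cont) auto
    moreover have "at t within {-b..t + 1} = at t"
      using True by (intro at_within_interior) auto
    ultimately show ?thesis by (simp add: R0_def[abs_def])
  next
    case False
    have "((\<lambda>_. 0) has_real_derivative 0) (at t)" by simp
    then have "(R0 has_real_derivative 0) (at t)"
      by (rule has_field_derivative_transform_within_open[of _ _ _ "{..<1 - b}"]) (use False R0z in auto)
    moreover have "\<rho>0 t = 0" using False b by (intro zero) simp
    ultimately show ?thesis by simp
  qed
  define K where "K = R0 b"
  have "K \<noteq> 0"
  proof
    assume "K = 0"
    then have "\<forall>x\<in>{-b..b}. \<rho>0 x = 0"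
      unfolding K_def R0_def using b pos by (subst (asm) integral_eq_0_iff) (auto intro: cont)
    then show False using b x0 by (auto simp: \<rho>0_def dest!: bspec[of _ _ 0])
  qed
  moreover have "K \<ge> 0" unfolding K_def R0_def by (intro integral_nonneg integrable_continuous_interval cont pos)
  ultimately have K: "K > 0" by simp
  have R0b: "R0 t = K" if "t \<ge> b" for t
  proof -
    have "integral {-b..b} \<rho>0 + integral {b..t} \<rho>0 = integral {-b..t} \<rho>0"
      using b that by (intro Henstock_Kurzweil_Integration.integral_combine integrable_continuous_interval cont) auto
    moreover have "integral {b..t} \<rho>0 = 0" using zero b by (intro integral_zero_on) auto
    ultimately show ?thesis by (simp add: K_def R0_def)
  qed
  show thesis
  proof (rule that[of b "\<lambda>t. \<rho>0 t * inverse K" "\<lambda>t. R0 t * inverse K"])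
    show "Ck k (\<lambda>t. \<rho>0 t * inverse K)" for k
      by (rule Ck_bounded_linear[OF bounded_linear_mult_left Ck0])
    show "((\<lambda>t. R0 t * inverse K) has_real_derivative \<rho>0 t * inverse K) (at t)" for t
      by (rule DERIV_cmult_right[OF der])
  qed (use b K pos zero R0z R0b in auto)
qed



section \<open>The weak equation in time\<close>

lemma DERIV_rescale:
  fixes R \<rho> :: "real \<Rightarrow> real"
  assumes R: "\<And>t. (R has_real_derivative \<rho> t) (at t)"
  shows "((\<lambda>t. R ((t - \<tau>) / \<delta>)) has_real_derivative \<rho> ((t - \<tau>) / \<delta>) / \<delta>) (at t)"
proof -
  have "((\<lambda>t. t - \<tau>) has_real_derivative 1) (at t)" by (auto intro!: derivative_eq_intros)
  then have "((\<lambda>t. (t - \<tau>) / \<delta>) has_real_derivative 1 / \<delta>) (at t)" by (rule DERIV_cdivide)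
  from DERIV_chain2[OF R this] show ?thesis by simp
qed

text \<open>The weight is a non-negative bump of integral one, being the derivative of a step from 0 to 1.\<close>

lemma bump_average:
  fixes q :: "real \<Rightarrow> complex" and R \<rho> :: "real \<Rightarrow> real"
  assumes R: "\<And>t. (R has_real_derivative \<rho> t) (at t)" and \<rho>0: "\<And>t. 0 \<le> \<rho> t" and \<rho>c: "continuous_on UNIV \<rho>"
    and \<rho>z: "\<And>t. \<bar>t\<bar> \<ge> b \<Longrightarrow> \<rho> t = 0" and Rl: "\<And>t. t \<le> - b \<Longrightarrow> R t = 0" and Rr: "\<And>t. t \<ge> b \<Longrightarrow> R t = 1"
    and d: "\<delta> > 0" "b > 0" "\<delta> * b \<le> \<tau>" "\<tau> + \<delta> * b \<le> T"
    and q: "continuous_on {0..T} q"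
    and e: "\<And>t. t \<in> {0..T} \<Longrightarrow> \<bar>t - \<tau>\<bar> \<le> \<delta> * b \<Longrightarrow> norm (q t - q \<tau>) \<le> e" "e \<ge> 0"
  shows "norm (integral {0..T} (\<lambda>t. complex_of_real (\<rho> ((t - \<tau>) / \<delta>) / \<delta>) * q t) - q \<tau>) \<le> e"
proof -
  have db: "0 < \<delta> * b" using d by simp
  then have T: "0 < \<tau>" "0 \<le> T" using d by linarith+
  define w where "w t = \<rho> ((t - \<tau>) / \<delta>) / \<delta>" for t
  have wc: "continuous_on {0..T} w"
    unfolding w_def using d by (intro continuous_intros continuous_on_compose2[OF \<rho>c]) auto
  have "((\<lambda>t. R ((t - \<tau>) / \<delta>)) has_real_derivative w t) (at t)" for t
    unfolding w_def by (rule DERIV_rescale[OF R])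
  then have "(w has_integral (R ((T - \<tau>) / \<delta>) - R ((0 - \<tau>) / \<delta>))) {0..T}"
    using T by (intro fundamental_theorem_of_calculus)
      (auto simp: has_real_derivative_iff_has_vector_derivative[symmetric] intro: has_field_derivative_at_within)
  moreover have "R ((T - \<tau>) / \<delta>) = 1" using d by (intro Rr) (simp add: field_simps)
  moreover have "R ((0 - \<tau>) / \<delta>) = 0" using d by (intro Rl) (simp add: field_simps)
  ultimately have w1: "(w has_integral 1) {0..T}" by simp
  have "((\<lambda>t. complex_of_real (w t) * q \<tau>) has_integral (complex_of_real 1 * q \<tau>)) {0..T}"
    by (intro has_integral_mult_left has_integral_of_real w1)
  then have c1: "((\<lambda>t. complex_of_real (w t) * q \<tau>) has_integral q \<tau>) {0..T}" by simp
  have c2: "(\<lambda>t. complex_of_real (w t) * q t) integrable_on {0..T}"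
    by (intro integrable_continuous_interval continuous_intros wc q)
  have "integral {0..T} (\<lambda>t. complex_of_real (w t) * q t) - q \<tau> =
      integral {0..T} (\<lambda>t. complex_of_real (w t) * (q t - q \<tau>))"
    using integral_diff[OF c2 has_integral_integrable[OF c1]] integral_unique[OF c1]
    by (simp add: right_diff_distrib)
  also have "norm \<dots> \<le> integral {0..T} (\<lambda>t. w t * e)"
  proof (rule integral_norm_bound_integral)
    show "(\<lambda>t. complex_of_real (w t) * (q t - q \<tau>)) integrable_on {0..T}"
      by (intro integrable_continuous_interval continuous_intros wc q)
    show "(\<lambda>t. w t * e) integrable_on {0..T}"
      by (intro integrable_continuous_interval continuous_intros wc)
    fix t assume t: "t \<in> {0..T}"
    show "norm (complex_of_real (w t) * (q t - q \<tau>)) \<le> w t * e"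
    proof (cases "\<bar>t - \<tau>\<bar> \<le> \<delta> * b")
      case True
      have w0: "0 \<le> w t" using \<rho>0 d by (simp add: w_def)
      show ?thesis using mult_left_mono[OF e(1)[OF t True] w0] w0 by (simp add: norm_mult)
    next
      case False
      then have "\<bar>(t - \<tau>) / \<delta>\<bar> \<ge> b" using d by (simp add: field_simps)
      then have "w t = 0" by (simp add: w_def \<rho>z)
      then show ?thesis by simp
    qed
  qed
  also have "\<dots> = e" using integral_unique[OF has_integral_mult_left[OF w1, of e]] by simp
  finally show ?thesis by (simp add: w_def)
qed

text \<open>The function $q = n + \int_0^t h$ is continuous and has vanishing distributional derivative, hence is
  constant: with \<open>\<theta>\<close> a step up near \<open>t1\<close> followed by a step down near \<open>t2\<close>, the derivative of \<open>\<theta>\<close> is a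
  difference of two bumps of mass one, and integration by parts turns the weak equation into the
  equality of the averages of \<open>q\<close> over the two bumps.\<close>

lemma weak_second_derivative:
  fixes m n h :: "real \<Rightarrow> complex" and R \<rho> :: "real \<Rightarrow> real"
  assumes T: "T > 0" and b: "b > 0" and Ck\<rho>: "\<And>k. Ck k \<rho>"
    and R: "\<And>t. (R has_real_derivative \<rho> t) (at t)" and \<rho>0: "\<And>t. 0 \<le> \<rho> t"
    and \<rho>z: "\<And>t. \<bar>t\<bar> \<ge> b \<Longrightarrow> \<rho> t = 0" and Rl: "\<And>t. t \<le> - b \<Longrightarrow> R t = 0" and Rr: "\<And>t. t \<ge> b \<Longrightarrow> R t = 1"
    and m: "\<And>t. t \<in> {0..T} \<Longrightarrow> (m has_vector_derivative n t) (at t within {0..T})"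
    and n: "continuous_on {0..T} n" and h: "continuous_on {0..T} h"
    and weak: "\<And>\<theta> \<theta>1 \<theta>2 \<alpha> \<beta>. (\<forall>k. Ck k \<theta>) \<Longrightarrow> (\<forall>t. (\<theta> has_real_derivative \<theta>1 t) (at t)) \<Longrightarrow>
      (\<forall>t. (\<theta>1 has_real_derivative \<theta>2 t) (at t)) \<Longrightarrow> continuous_on UNIV \<theta>2 \<Longrightarrow> 0 < \<alpha> \<Longrightarrow> \<beta> < T \<Longrightarrow>
      (\<forall>t. t \<notin> {\<alpha>..\<beta>} \<longrightarrow> \<theta> t = 0) \<Longrightarrow>
      integral {0..T} (\<lambda>t. complex_of_real (\<theta>2 t) * m t) + integral {0..T} (\<lambda>t. complex_of_real (\<theta> t) * h t) = 0"
    and t: "t \<in> {0..T}"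
  shows "n t + integral {0..t} h = n 0"
proof -
  define H where "H t = integral {0..t} h" for t
  have H': "(H has_vector_derivative h t) (at t within {0..T})" if "t \<in> {0..T}" for t
    unfolding H_def[abs_def] by (rule integral_has_vector_derivative[OF h that])
  have Hc: "continuous_on {0..T} H"
    unfolding continuous_on_eq_continuous_within by (intro ballI has_vector_derivative_continuous[OF H'])
  have mc: "continuous_on {0..T} m"
    unfolding continuous_on_eq_continuous_within by (intro ballI has_vector_derivative_continuous[OF m])
  define q where "q t = n t + H t" for t
  have qc: "continuous_on {0..T} q" unfolding q_def by (intro continuous_intros n Hc)
  have \<rho>c: "continuous_on UNIV \<rho>" using Ck\<rho>[of 0] by simp
  obtain \<rho>' where "\<forall>t. (\<rho> has_real_derivative \<rho>' t) (at t)" and \<rho>'c: "continuous_on UNIV \<rho>'"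
  proof (rule Ck_real_derivative[OF Ck\<rho>])
    fix \<rho>' :: "real \<Rightarrow> real"
    assume A: "\<And>t. (\<rho> has_real_derivative \<rho>' t) (at t)" and C: "\<And>k. Ck k \<rho>'"
    have "continuous_on UNIV \<rho>'" using C[of 0] by simp
    then show thesis by (intro that[of \<rho>'] allI A)
  qed
  note \<rho>' = this(1)[rule_format]
  have eq: "q t1 = q t2" if t12: "0 < t1" "t1 < t2" "t2 < T" for t1 t2
  proof -
    have "norm (q t1 - q t2) \<le> 0"
    proof (rule field_le_epsilon)
      fix e' :: real assume "e' > 0"
      define e where "e = e' / 2"
      have e: "e > 0" using \<open>e' > 0\<close> by (simp add: e_def)
      obtain d1 where d1: "d1 > 0" "\<forall>t\<in>{0..T}. dist t t1 < d1 \<longrightarrow> dist (q t) (q t1) < e"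
        using qc[unfolded continuous_on_iff, rule_format, of t1 e] t12 e by auto
      obtain d2 where d2: "d2 > 0" "\<forall>t\<in>{0..T}. dist t t2 < d2 \<longrightarrow> dist (q t) (q t2) < e"
        using qc[unfolded continuous_on_iff, rule_format, of t2 e] t12 e by auto
      define \<gamma> where "\<gamma> = min (min d1 d2) (min t1 (T - t2)) / 2"
      have \<gamma>: "\<gamma> > 0" "\<gamma> < d1" "\<gamma> < d2" "\<gamma> < t1" "\<gamma> < T - t2"
        using d1(1) d2(1) t12 by (auto simp: \<gamma>_def min_def)
      define \<delta> where "\<delta> = \<gamma> / b"
      have \<delta>: "\<delta> > 0" "\<delta> * b = \<gamma>" using \<gamma> b by (simp_all add: \<delta>_def)
      define w where "w \<tau> t = \<rho> ((t - \<tau>) / \<delta>) / \<delta>" for \<tau> t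
      define \<theta> where "\<theta> t = R ((t - t1) / \<delta>) - R ((t - t2) / \<delta>)" for t
      define \<theta>1 where "\<theta>1 t = w t1 t - w t2 t" for t
      define \<theta>2 where "\<theta>2 t = \<rho>' ((t - t1) / \<delta>) / \<delta> / \<delta> - \<rho>' ((t - t2) / \<delta>) / \<delta> / \<delta>" for t
      have \<theta>d: "(\<theta> has_real_derivative \<theta>1 t) (at t)" for t
        unfolding \<theta>_def \<theta>1_def w_def by (intro DERIV_diff DERIV_rescale[OF R])
      have \<theta>1d: "(\<theta>1 has_real_derivative \<theta>2 t) (at t)" for t
        unfolding \<theta>2_def \<theta>1_def w_def by (intro DERIV_diff DERIV_cdivide DERIV_rescale[OF \<rho>'])
      have \<theta>2c: "continuous_on S \<theta>2" for S
        unfolding \<theta>2_def using \<delta> by (intro continuous_intros continuous_on_compose2[OF \<rho>'c]) auto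
      have \<theta>1c: "continuous_on S \<theta>1" for S
        unfolding continuous_on_eq_continuous_within
        by (rule ballI, rule continuous_at_imp_continuous_within, rule DERIV_isCont[OF \<theta>1d])
      have \<theta>c: "continuous_on S \<theta>" for S
        unfolding continuous_on_eq_continuous_within
        by (rule ballI, rule continuous_at_imp_continuous_within, rule DERIV_isCont[OF \<theta>d])
      have Ck\<theta>: "Ck k \<theta>" for k
      proof -
        have CR: "Ck k R" by (rule Ck_SucD[OF Ck_primitive[OF R Ck\<rho>]])
        have "Ck k (\<lambda>t. R (- \<tau> / \<delta> + t / \<delta>))" for \<tau>
          by (rule Ck_affine[OF bounded_linear_divide CR])
        moreover have "(t - \<tau>) / \<delta> = - \<tau> / \<delta> + t / \<delta>" for t \<tau> by (simp add: diff_divide_distrib)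
        ultimately have sh: "Ck k (\<lambda>t. R ((t - \<tau>) / \<delta>))" for \<tau> by simp
        have "Ck k (\<lambda>t. R ((t - t1) / \<delta>) + - R ((t - t2) / \<delta>))"
          by (intro Ck_add Ck_bounded_linear[OF bounded_linear_minus[OF bounded_linear_ident]] sh)
        then show ?thesis by (simp add: \<theta>_def[abs_def])
      qed
      have \<theta>z: "\<theta> t = 0" if "t \<notin> {t1 - \<gamma>..t2 + \<gamma>}" for t
      proof (cases "t < t1 - \<gamma>")
        case True
        then have "R ((t - t1) / \<delta>) = 0" "R ((t - t2) / \<delta>) = 0"
          using \<delta> t12 by (auto intro!: Rl simp: field_simps)
        then show ?thesis by (simp add: \<theta>_def)
      next
        case False
        then have "R ((t - t1) / \<delta>) = 1" "R ((t - t2) / \<delta>) = 1"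
          using \<delta> t12 that by (auto intro!: Rr simp: field_simps)
        then show ?thesis by (simp add: \<theta>_def)
      qed
      have wz: "w t1 0 = 0" "w t2 0 = 0" "w t1 T = 0" "w t2 T = 0"
        using \<delta> \<gamma> t12 by (auto simp: w_def intro!: \<rho>z) (auto simp: field_simps abs_if)
      have bd: "\<theta> 0 = 0" "\<theta> T = 0" "\<theta>1 0 = 0" "\<theta>1 T = 0"
        using \<theta>z[of 0] \<theta>z[of T] \<gamma> t12 wz by (auto simp: \<theta>1_def)
      let ?c = complex_of_real
      have der: "((\<lambda>t. ?c (\<theta>1 t) * m t + ?c (\<theta> t) * H t) has_vector_derivative
          (?c (\<theta>1 t) * n t + ?c (\<theta>2 t) * m t) + (?c (\<theta> t) * h t + ?c (\<theta>1 t) * H t)) (at t within {0..T})"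
        if "t \<in> {0..T}" for t
        using \<theta>d[of t] \<theta>1d[of t] m[OF that] H'[OF that]
        by (intro has_vector_derivative_add has_vector_derivative_mult has_vector_derivative_of_real)
           (auto simp: has_real_derivative_iff_has_vector_derivative[symmetric] intro: has_field_derivative_at_within)
      have "((\<lambda>t. (?c (\<theta>1 t) * n t + ?c (\<theta>2 t) * m t) + (?c (\<theta> t) * h t + ?c (\<theta>1 t) * H t)) has_integral
          ((?c (\<theta>1 T) * m T + ?c (\<theta> T) * H T) - (?c (\<theta>1 0) * m 0 + ?c (\<theta> 0) * H 0))) {0..T}"
        using T by (intro fundamental_theorem_of_calculus der) auto
      then have "integral {0..T} (\<lambda>t. (?c (\<theta>1 t) * n t + ?c (\<theta>2 t) * m t) + (?c (\<theta> t) * h t + ?c (\<theta>1 t) * H t)) = 0"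
        by (intro integral_unique) (simp add: bd)
      moreover have "integral {0..T} (\<lambda>t. (?c (\<theta>1 t) * n t + ?c (\<theta>2 t) * m t) + (?c (\<theta> t) * h t + ?c (\<theta>1 t) * H t)) =
          integral {0..T} (\<lambda>t. ?c (\<theta>1 t) * q t + (?c (\<theta>2 t) * m t + ?c (\<theta> t) * h t))"
        by (simp add: q_def algebra_simps)
      moreover have "\<dots> = integral {0..T} (\<lambda>t. ?c (\<theta>1 t) * q t) +
          (integral {0..T} (\<lambda>t. ?c (\<theta>2 t) * m t) + integral {0..T} (\<lambda>t. ?c (\<theta> t) * h t))"
        by (subst integral_add, (intro integrable_continuous_interval continuous_intros \<theta>c \<theta>1c \<theta>2c qc mc h)+)+ simp
      moreover have "integral {0..T} (\<lambda>t. ?c (\<theta>2 t) * m t) + integral {0..T} (\<lambda>t. ?c (\<theta> t) * h t) = 0"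
        by (rule weak[of \<theta> \<theta>1 \<theta>2 "t1 - \<gamma>" "t2 + \<gamma>"]) (use Ck\<theta> \<theta>d \<theta>1d \<theta>2c \<gamma> \<theta>z in auto)
      ultimately have z: "integral {0..T} (\<lambda>t. ?c (\<theta>1 t) * q t) = 0" by simp
      have wc: "continuous_on {0..T} (w \<tau>)" for \<tau>
        unfolding w_def using \<delta> by (intro continuous_intros continuous_on_compose2[OF \<rho>c]) auto
      have "integral {0..T} (\<lambda>t. ?c (\<theta>1 t) * q t) =
          integral {0..T} (\<lambda>t. ?c (w t1 t) * q t) - integral {0..T} (\<lambda>t. ?c (w t2 t) * q t)"
        unfolding \<theta>1_def of_real_diff left_diff_distrib
        by (intro integral_diff integrable_continuous_interval continuous_intros wc qc)
      with z have ww: "integral {0..T} (\<lambda>t. ?c (w t1 t) * q t) = integral {0..T} (\<lambda>t. ?c (w t2 t) * q t)" by simp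
      have a1: "norm (integral {0..T} (\<lambda>t. ?c (w t1 t) * q t) - q t1) \<le> e"
        unfolding w_def
      proof (rule bump_average[OF R \<rho>0 \<rho>c \<rho>z Rl Rr \<delta>(1) b])
        show "\<delta> * b \<le> t1" "t1 + \<delta> * b \<le> T" using \<delta>(2) \<gamma> t12 by linarith+
        show "norm (q t - q t1) \<le> e" if "t \<in> {0..T}" "\<bar>t - t1\<bar> \<le> \<delta> * b" for t
        proof -
          have "dist t t1 < d1" using that(2) \<delta>(2) \<gamma> by (simp add: dist_real_def)
          then have "dist (q t) (q t1) < e" using bspec[OF d1(2) that(1)] by (rule rev_mp)
          then show ?thesis by (simp add: dist_norm)
        qed
      qed (use qc e in simp_all)
      have a2: "norm (integral {0..T} (\<lambda>t. ?c (w t2 t) * q t) - q t2) \<le> e"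
        unfolding w_def
      proof (rule bump_average[OF R \<rho>0 \<rho>c \<rho>z Rl Rr \<delta>(1) b])
        show "\<delta> * b \<le> t2" "t2 + \<delta> * b \<le> T" using \<delta>(2) \<gamma> t12 by linarith+
        show "norm (q t - q t2) \<le> e" if "t \<in> {0..T}" "\<bar>t - t2\<bar> \<le> \<delta> * b" for t
        proof -
          have "dist t t2 < d2" using that(2) \<delta>(2) \<gamma> by (simp add: dist_real_def)
          then have "dist (q t) (q t2) < e" using bspec[OF d2(2) that(1)] by (rule rev_mp)
          then show ?thesis by (simp add: dist_norm)
        qed
      qed (use qc e in simp_all)
      have "norm (q t1 - q t2) \<le> e + e"
        using norm_triangle_le_diff[of "integral {0..T} (\<lambda>t. ?c (w t2 t) * q t) - q t2"
            "integral {0..T} (\<lambda>t. ?c (w t1 t) * q t) - q t1" "e + e"] a1 a2 unfolding ww by simp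
      then show "norm (q t1 - q t2) \<le> 0 + e'" by (simp add: e_def)
    qed
    then show ?thesis by simp
  qed
  have const: "q x = q (T / 2)" if x: "x \<in> {0<..<T}" for x
  proof -
    consider "x < T / 2" | "x = T / 2" | "x > T / 2" by linarith
    then show ?thesis
    proof cases
      case 1
      then show ?thesis by (intro eq) (use x T in auto)
    next
      case 3
      then show ?thesis by (intro eq[symmetric]) (use x T in auto)
    next
      case 2
      then show ?thesis by (rule arg_cong)
    qed
  qed
  have cl: "closure {0<..<T} = {0..T}" using T by simp
  then have "continuous_on (closure {0<..<T}) q" using qc by (simp only:)
  from continuous_constant_on_closure[OF this const]
  have all: "q x = q (T / 2)" if "x \<in> {0..T}" for x using that by (simp only: cl)
  have "q t = q 0" by (rule trans[OF all[OF t] all[symmetric]]) (use T in simp)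
  then show ?thesis by (simp add: q_def H_def)
qed

section \<open>Time-dependent functions with values in Sobolev spaces\<close>

text \<open>This is the form in which differentiability in a Sobolev space is given.\<close>

lemma has_vector_derivative_iff_quotient:
  fixes f :: "real \<Rightarrow> 'a::real_normed_vector"
  shows "(f has_vector_derivative f') (at t within S) \<longleftrightarrow>
    ((\<lambda>\<tau>. norm ((f \<tau> - f t) /\<^sub>R (\<tau> - t) - f')) \<longlongrightarrow> 0) (at t within S)"
proof -
  have "(f has_vector_derivative f') (at t within S) \<longleftrightarrow>
      ((\<lambda>\<tau>. (1 / norm (\<tau> - t)) *\<^sub>R (f \<tau> - (f t + (\<tau> - t) *\<^sub>R f'))) \<longlongrightarrow> 0) (at t within S)"
    unfolding has_vector_derivative_def has_derivative_within by (simp add: bounded_linear_scaleR_left)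
  also have "\<dots> \<longleftrightarrow> ((\<lambda>\<tau>. norm ((1 / norm (\<tau> - t)) *\<^sub>R (f \<tau> - (f t + (\<tau> - t) *\<^sub>R f')))) \<longlongrightarrow> 0) (at t within S)"
    by (rule tendsto_norm_zero_iff[symmetric])
  also have "\<dots> \<longleftrightarrow> ((\<lambda>\<tau>. norm ((f \<tau> - f t) /\<^sub>R (\<tau> - t) - f')) \<longlongrightarrow> 0) (at t within S)"
  proof (rule Lim_cong_within)
    fix \<tau> assume "\<tau> \<noteq> t"
    then have "(f \<tau> - f t) /\<^sub>R (\<tau> - t) - f' = (f \<tau> - (f t + (\<tau> - t) *\<^sub>R f')) /\<^sub>R (\<tau> - t)"
      by (simp add: scaleR_diff_right scaleR_add_right)
    then show "norm ((1 / norm (\<tau> - t)) *\<^sub>R (f \<tau> - (f t + (\<tau> - t) *\<^sub>R f'))) = norm ((f \<tau> - f t) /\<^sub>R (\<tau> - t) - f')"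
      by (simp add: divide_inverse)
  qed auto
  finally show ?thesis .
qed

lemma eventually_within_mem: "\<forall>\<^sub>F \<tau> in at t within S. \<tau> \<in> S"
  by (simp add: eventually_at_filter)

text \<open>The Sobolev norm controls a function and its image under $(-\Delta)^{\sigma/2}$, so continuity and
  differentiability in the Sobolev space amount to those of two curves in \<open>l2\<close>.\<close>

lemma continuous_in_sobolevD:
  assumes "continuous_in_sobolev \<sigma> T u"
  shows "\<And>t. t \<in> {0..T} \<Longrightarrow> u t \<in> sobolev_space \<sigma>"
    and "continuous_on {0..T} (\<lambda>t. cls (u t))" and "continuous_on {0..T} (\<lambda>t. Lambda \<sigma> (u t))"
proof -
  show mem: "\<And>t. t \<in> {0..T} \<Longrightarrow> u t \<in> sobolev_space \<sigma>" using assms by (simp add: continuous_in_sobolev_def)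
  have lim: "((\<lambda>\<tau>. norm (cls (u \<tau>) - cls (u t)) + norm (Lambda \<sigma> (u \<tau>) - Lambda \<sigma> (u t))) \<longlongrightarrow> 0) (at t within {0..T})"
    if t: "t \<in> {0..T}" for t
  proof -
    have "((\<lambda>\<tau>. sobolev_norm \<sigma> (\<lambda>x. u \<tau> x - u t x)) \<longlongrightarrow> 0) (at t within {0..T})"
      using assms t by (simp add: continuous_in_sobolev_def)
    moreover have "\<forall>\<^sub>F \<tau> in at t within {0..T}. sobolev_norm \<sigma> (\<lambda>x. u \<tau> x - u t x) =
        norm (cls (u \<tau>) - cls (u t)) + norm (Lambda \<sigma> (u \<tau>) - Lambda \<sigma> (u t))"
      using eventually_within_mem
    proof eventually_elim
      case (elim \<tau>)
      note a = mem[OF elim] and b = mem[OF t]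
      show ?case
        by (simp only: sobolev_norm_eq[OF sobolev_diff[OF a b]] Lambda_diff[OF a b]
            cls_diff[OF sobolev_spaceD(1)[OF a] sobolev_spaceD(1)[OF b]])
    qed
    ultimately show ?thesis by (rule Lim_transform_eventually)
  qed
  show "continuous_on {0..T} (\<lambda>t. cls (u t))"
    unfolding continuous_on_def
  proof
    fix t assume t: "t \<in> {0..T}"
    have "((\<lambda>\<tau>. norm (cls (u \<tau>) - cls (u t))) \<longlongrightarrow> 0) (at t within {0..T})"
      by (rule tendsto_sandwich[OF _ _ tendsto_const lim[OF t]]) auto
    then show "((\<lambda>t. cls (u t)) \<longlongrightarrow> cls (u t)) (at t within {0..T})"
      by (simp add: tendsto_norm_zero_iff LIM_zero_iff)
  qed
  show "continuous_on {0..T} (\<lambda>t. Lambda \<sigma> (u t))"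
    unfolding continuous_on_def
  proof
    fix t assume t: "t \<in> {0..T}"
    have "((\<lambda>\<tau>. norm (Lambda \<sigma> (u \<tau>) - Lambda \<sigma> (u t))) \<longlongrightarrow> 0) (at t within {0..T})"
      by (rule tendsto_sandwich[OF _ _ tendsto_const lim[OF t]]) auto
    then show "((\<lambda>t. Lambda \<sigma> (u t)) \<longlongrightarrow> Lambda \<sigma> (u t)) (at t within {0..T})"
      by (simp add: tendsto_norm_zero_iff LIM_zero_iff)
  qed
qed

lemma C1_in_sobolevD:
  assumes "C1_in_sobolev \<sigma> T u v" and t: "t \<in> {0..T}"
  shows "((\<lambda>t. cls (u t)) has_vector_derivative cls (v t)) (at t within {0..T})"
    and "((\<lambda>t. Lambda \<sigma> (u t)) has_vector_derivative Lambda \<sigma> (v t)) (at t within {0..T})"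
proof -
  have u: "\<And>t. t \<in> {0..T} \<Longrightarrow> u t \<in> sobolev_space \<sigma>" and v: "\<And>t. t \<in> {0..T} \<Longrightarrow> v t \<in> sobolev_space \<sigma>"
    using assms(1) by (auto simp: C1_in_sobolev_def dest: continuous_in_sobolevD)
  have "((\<lambda>\<tau>. sobolev_norm \<sigma> (\<lambda>x. (u \<tau> x - u t x) /\<^sub>R (\<tau> - t) - v t x)) \<longlongrightarrow> 0) (at t within {0..T})"
    using assms by (simp add: C1_in_sobolev_def)
  moreover have "\<forall>\<^sub>F \<tau> in at t within {0..T}. sobolev_norm \<sigma> (\<lambda>x. (u \<tau> x - u t x) /\<^sub>R (\<tau> - t) - v t x) =
      norm ((cls (u \<tau>) - cls (u t)) /\<^sub>R (\<tau> - t) - cls (v t)) +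
      norm ((Lambda \<sigma> (u \<tau>) - Lambda \<sigma> (u t)) /\<^sub>R (\<tau> - t) - Lambda \<sigma> (v t))"
    using eventually_within_mem
  proof eventually_elim
    case (elim \<tau>)
    note a = u[OF elim] and b = u[OF t] and c = v[OF t]
    note ab = sobolev_diff[OF a b]
    note ab' = sobolev_scaleR[OF ab, of "inverse (\<tau> - t)"]
    show ?case
      by (simp only: sobolev_norm_eq[OF sobolev_diff[OF ab' c]] Lambda_diff[OF ab' c] Lambda_scaleR[OF ab] Lambda_diff[OF a b]
          cls_diff[OF sobolev_spaceD(1)[OF ab'] sobolev_spaceD(1)[OF c]] cls_scaleR[OF sobolev_spaceD(1)[OF ab]]
          cls_diff[OF sobolev_spaceD(1)[OF a] sobolev_spaceD(1)[OF b]])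
  qed
  ultimately have lim: "((\<lambda>\<tau>. norm ((cls (u \<tau>) - cls (u t)) /\<^sub>R (\<tau> - t) - cls (v t)) +
      norm ((Lambda \<sigma> (u \<tau>) - Lambda \<sigma> (u t)) /\<^sub>R (\<tau> - t) - Lambda \<sigma> (v t))) \<longlongrightarrow> 0) (at t within {0..T})"
    by (rule Lim_transform_eventually)
  show "((\<lambda>t. cls (u t)) has_vector_derivative cls (v t)) (at t within {0..T})"
    unfolding has_vector_derivative_iff_quotient
    by (rule tendsto_sandwich[OF _ _ tendsto_const lim]) auto
  show "((\<lambda>t. Lambda \<sigma> (u t)) has_vector_derivative Lambda \<sigma> (v t)) (at t within {0..T})"
    unfolding has_vector_derivative_iff_quotient
    by (rule tendsto_sandwich[OF _ _ tendsto_const lim]) auto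
qed



section \<open>Solutions as curves in the Hilbert space\<close>

text \<open>For a fixed coefficient. The constant grows with $\|c\|$; one is added to the integral so that it is
  positive also for \<open>c = 0\<close>.\<close>

lemma multiplication_operator:
  fixes c :: "'a::euclidean_space \<Rightarrow> real"
  assumes s: "0 < s" "2 * s < real DIM('a)" and c: "c \<in> Lp_space (real DIM('a) / s)"
  obtains C where "C > 0"
    "\<forall>f\<in>sobolev_space s. (\<lambda>x. c x *\<^sub>R f x) \<in> Lp_space 2 \<and> norm (cls (\<lambda>x. c x *\<^sub>R f x)) \<le> C * norm (Lambda s f)"
proof (rule multiplication_bound[OF s])
  fix K :: real
  assume K: "K > 0" and bound: "\<And>(a :: 'a \<Rightarrow> real) \<alpha> f g. a \<in> Lp_space (real DIM('a) / s) \<Longrightarrow> \<alpha> > 0 \<Longrightarrow>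
      (LINT x|lborel. norm (a x) powr (real DIM('a) / s)) \<le> \<alpha> \<Longrightarrow> has_frac_laplacian (s / 2) f g \<Longrightarrow>
      (\<lambda>x. a x *\<^sub>R f x) \<in> Lp_space 2 \<and>
      norm (cls (\<lambda>x. a x *\<^sub>R f x)) \<le> K * \<alpha> powr (s / real DIM('a)) * norm (cls g)"
  define \<alpha> where "\<alpha> = (LINT x|lborel. norm (c x) powr (real DIM('a) / s)) + 1"
  have "0 \<le> (LINT x|lborel. norm (c x) powr (real DIM('a) / s))" by simp
  then have \<alpha>: "\<alpha> > 0" unfolding \<alpha>_def by linarith
  show thesis
  proof (rule that[of "K * \<alpha> powr (s / real DIM('a))"])
    show "K * \<alpha> powr (s / real DIM('a)) > 0" using K \<alpha> by simp
    show "\<forall>f\<in>sobolev_space s. (\<lambda>x. c x *\<^sub>R f x) \<in> Lp_space 2 \<and>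
        norm (cls (\<lambda>x. c x *\<^sub>R f x)) \<le> K * \<alpha> powr (s / real DIM('a)) * norm (Lambda s f)"
      unfolding Lambda_def by (intro ballI bound c \<alpha> sobolev_spaceD) (simp_all add: \<alpha>_def)
  qed
qed

lemma cls_mult_diff:
  fixes c :: "'a::euclidean_space \<Rightarrow> real"
  assumes "(\<lambda>x. c x *\<^sub>R f x) \<in> Lp_space 2" "(\<lambda>x. c x *\<^sub>R g x) \<in> Lp_space 2"
  shows "cls (\<lambda>x. c x *\<^sub>R (f x - g x)) = cls (\<lambda>x. c x *\<^sub>R f x) - cls (\<lambda>x. c x *\<^sub>R g x)"
  using cls_diff[OF assms] by (simp add: scaleR_diff_right)

lemma cls_mult_scaleR:
  fixes c :: "'a::euclidean_space \<Rightarrow> real"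
  assumes "(\<lambda>x. c x *\<^sub>R f x) \<in> Lp_space 2"
  shows "cls (\<lambda>x. c x *\<^sub>R (r *\<^sub>R f x)) = r *\<^sub>R cls (\<lambda>x. c x *\<^sub>R f x)"
  using cls_scaleR[OF assms, of r] by (simp add: mult.commute)

lemma multiplication_continuous:
  fixes c :: "'a::euclidean_space \<Rightarrow> real"
  assumes op: "\<forall>f\<in>sobolev_space s. (\<lambda>x. c x *\<^sub>R f x) \<in> Lp_space 2 \<and> norm (cls (\<lambda>x. c x *\<^sub>R f x)) \<le> C * norm (Lambda s f)"
    and u: "continuous_in_sobolev s T u"
  shows "continuous_on {0..T} (\<lambda>t. cls (\<lambda>x. c x *\<^sub>R u t x))"
  unfolding continuous_on_def
proof
  fix t assume t: "t \<in> {0..T}"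
  note mem = continuous_in_sobolevD(1)[OF u]
  have "((\<lambda>\<tau>. Lambda s (u \<tau>)) \<longlongrightarrow> Lambda s (u t)) (at t within {0..T})"
    using continuous_in_sobolevD(3)[OF u] t by (simp add: continuous_on_def)
  then have lim: "((\<lambda>\<tau>. C * norm (Lambda s (u \<tau>) - Lambda s (u t))) \<longlongrightarrow> C * 0) (at t within {0..T})"
    by (intro tendsto_mult tendsto_const tendsto_norm_zero LIM_zero)
  have "((\<lambda>\<tau>. norm (cls (\<lambda>x. c x *\<^sub>R u \<tau> x) - cls (\<lambda>x. c x *\<^sub>R u t x))) \<longlongrightarrow> 0) (at t within {0..T})"
  proof (rule tendsto_sandwich[OF _ _ tendsto_const])
    show "((\<lambda>\<tau>. C * norm (Lambda s (u \<tau>) - Lambda s (u t))) \<longlongrightarrow> 0) (at t within {0..T})" using lim by simp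
    show "\<forall>\<^sub>F \<tau> in at t within {0..T}. norm (cls (\<lambda>x. c x *\<^sub>R u \<tau> x) - cls (\<lambda>x. c x *\<^sub>R u t x)) \<le>
        C * norm (Lambda s (u \<tau>) - Lambda s (u t))"
      using eventually_within_mem
    proof eventually_elim
      case (elim \<tau>)
      note a = mem[OF elim] and b = mem[OF t]
      show ?case
        using bspec[OF op sobolev_diff[OF a b]]
        by (simp only: cls_mult_diff[OF conjunct1[OF bspec[OF op a]] conjunct1[OF bspec[OF op b]]] Lambda_diff[OF a b])
    qed
  qed auto
  then show "((\<lambda>t. cls (\<lambda>x. c x *\<^sub>R u t x)) \<longlongrightarrow> cls (\<lambda>x. c x *\<^sub>R u t x)) (at t within {0..T})"
    by (simp add: tendsto_norm_zero_iff LIM_zero_iff)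
qed

lemma multiplication_has_vector_derivative:
  fixes c :: "'a::euclidean_space \<Rightarrow> real"
  assumes op: "\<forall>f\<in>sobolev_space s. (\<lambda>x. c x *\<^sub>R f x) \<in> Lp_space 2 \<and> norm (cls (\<lambda>x. c x *\<^sub>R f x)) \<le> C * norm (Lambda s f)"
    and C1: "C1_in_sobolev s T u v" and t: "t \<in> {0..T}"
  shows "((\<lambda>t. cls (\<lambda>x. c x *\<^sub>R u t x)) has_vector_derivative cls (\<lambda>x. c x *\<^sub>R v t x)) (at t within {0..T})"
  unfolding has_vector_derivative_iff_quotient
proof (rule tendsto_sandwich[OF _ _ tendsto_const])
  have u: "\<And>t. t \<in> {0..T} \<Longrightarrow> u t \<in> sobolev_space s" and v: "\<And>t. t \<in> {0..T} \<Longrightarrow> v t \<in> sobolev_space s"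
    using C1 by (auto simp: C1_in_sobolev_def dest: continuous_in_sobolevD)
  have "((\<lambda>\<tau>. C * norm ((Lambda s (u \<tau>) - Lambda s (u t)) /\<^sub>R (\<tau> - t) - Lambda s (v t))) \<longlongrightarrow> C * 0) (at t within {0..T})"
    using C1_in_sobolevD(2)[OF C1 t] unfolding has_vector_derivative_iff_quotient
    by (intro tendsto_mult tendsto_const)
  then show "((\<lambda>\<tau>. C * norm ((Lambda s (u \<tau>) - Lambda s (u t)) /\<^sub>R (\<tau> - t) - Lambda s (v t))) \<longlongrightarrow> 0) (at t within {0..T})"
    by simp
  show "\<forall>\<^sub>F \<tau> in at t within {0..T}.
      norm ((cls (\<lambda>x. c x *\<^sub>R u \<tau> x) - cls (\<lambda>x. c x *\<^sub>R u t x)) /\<^sub>R (\<tau> - t) - cls (\<lambda>x. c x *\<^sub>R v t x)) \<le>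
      C * norm ((Lambda s (u \<tau>) - Lambda s (u t)) /\<^sub>R (\<tau> - t) - Lambda s (v t))"
    using eventually_within_mem
  proof eventually_elim
    case (elim \<tau>)
    note a = u[OF elim] and b = u[OF t] and d = v[OF t]
    note ab = sobolev_diff[OF a b]
    note ab' = sobolev_scaleR[OF ab, of "inverse (\<tau> - t)"]
    note m = conjunct1[OF bspec[OF op]]
    show ?case
      using conjunct2[OF bspec[OF op sobolev_diff[OF ab' d]]]
      by (simp only: Lambda_diff[OF ab' d] Lambda_scaleR[OF ab] Lambda_diff[OF a b]
          cls_mult_diff[OF m[OF ab'] m[OF d]] cls_mult_scaleR[OF m[OF ab]] cls_mult_diff[OF m[OF a] m[OF b]])
  qed
qed auto

text \<open>Pairing with a real function \<open>\<eta>\<close> is a complex-valued functional, whereas \<open>l2\<close> has a real inner product: real and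
  imaginary part are the inner products with \<open>\<eta>\<close> and with \<open>\<i> * \<eta>\<close>.\<close>

lemma pairing_functional:
  fixes \<eta> :: "'a::euclidean_space \<Rightarrow> real"
  assumes \<eta>: "(\<lambda>x. complex_of_real (\<eta> x)) \<in> Lp_space 2"
  obtains E :: "'a l2 \<Rightarrow> complex" where "bounded_linear E"
    "\<forall>f\<in>Lp_space 2. E (cls f) = (LINT x|lborel. f x * complex_of_real (\<eta> x))"
proof -
  let ?r = "\<lambda>x. complex_of_real (\<eta> x)" and ?i = "\<lambda>x. \<i> * complex_of_real (\<eta> x)"
  have [measurable]: "?r \<in> borel_measurable borel" using \<eta> by (simp only: L2_iff)
  have "?i \<in> borel_measurable borel" by measurable
  then have i: "?i \<in> Lp_space 2" using \<eta> by (simp add: L2_iff norm_mult)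
  define E where "E F = complex_of_real (inner F (cls ?r)) + \<i> * complex_of_real (inner F (cls ?i))" for F
  have "bounded_linear E"
    unfolding E_def[abs_def]
    by (intro bounded_linear_add bounded_linear_compose[OF bounded_linear_mult_right]
        bounded_linear_compose[OF bounded_linear_of_real bounded_linear_inner_left])
  moreover have "\<forall>f\<in>Lp_space 2. E (cls f) = (LINT x|lborel. f x * ?r x)"
  proof
    fix f :: "'a \<Rightarrow> complex" assume f: "f \<in> Lp_space 2"
    have [measurable]: "f \<in> borel_measurable borel" "?r \<in> borel_measurable borel" using f \<eta> by (simp_all only: L2_iff)
    have int: "integrable lborel (\<lambda>x. f x * ?r x)"
      by (rule Bochner_Integration.integrable_bound[OF L2_mult_integrable[OF f \<eta>]])
         (measurable, intro AE_I2, simp add: norm_mult)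
    have "Re (LINT x|lborel. f x * ?r x) = (LINT x|lborel. f x \<bullet> ?r x)"
      using integral_Re[OF int] by (simp add: inner_complex_def)
    moreover have "Im (LINT x|lborel. f x * ?r x) = (LINT x|lborel. f x \<bullet> ?i x)"
      using integral_Im[OF int] by (simp add: inner_complex_def)
    ultimately show "E (cls f) = (LINT x|lborel. f x * ?r x)"
      unfolding E_def inner_cls[OF f \<eta>] inner_cls[OF f i] by (simp add: complex_eq_iff)
  qed
  ultimately show thesis by (rule that)
qed

lemma test_function_product:
  fixes \<theta> :: "real \<Rightarrow> real" and \<eta> :: "'a::euclidean_space \<Rightarrow> real"
  assumes \<theta>: "\<And>k. Ck k \<theta>" "0 < \<alpha>" "\<beta> < T" "\<And>t. t \<notin> {\<alpha>..\<beta>} \<Longrightarrow> \<theta> t = 0"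
    and \<eta>: "\<And>k. Ck k \<eta>" "\<And>x. x \<notin> cball 0 B \<Longrightarrow> \<eta> x = 0"
  shows "test_function ({0<..<T} \<times> UNIV) (\<lambda>(t, x). complex_of_real (\<theta> t * \<eta> x))"
proof -
  let ?\<phi> = "\<lambda>(t, x). complex_of_real (\<theta> t * \<eta> x)"
  have "Ck k (\<lambda>p. complex_of_real (\<theta> (0 + fst p) * \<eta> (0 + snd p)))" for k
    by (intro Ck_bounded_linear[OF bounded_linear_of_real] Ck_mult Ck_affine bounded_linear_fst bounded_linear_snd \<theta> \<eta>)
  then have Ck: "Ck k ?\<phi>" for k by (simp add: case_prod_beta')
  have "{p. ?\<phi> p \<noteq> 0} \<subseteq> {\<alpha>..\<beta>} \<times> cball 0 B"
  proof
    fix p assume "p \<in> {p. ?\<phi> p \<noteq> 0}"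
    then have "\<theta> (fst p) \<noteq> 0" "\<eta> (snd p) \<noteq> 0" by (auto simp: case_prod_beta')
    then have "fst p \<in> {\<alpha>..\<beta>}" "snd p \<in> cball 0 B"
      using \<theta>(4)[of "fst p"] \<eta>(2)[of "snd p"] by blast+
    then show "p \<in> {\<alpha>..\<beta>} \<times> cball 0 B" by (simp only: mem_Times_iff)
  qed
  then have cl: "closure {p. ?\<phi> p \<noteq> 0} \<subseteq> {\<alpha>..\<beta>} \<times> cball 0 B"
    by (rule closure_minimal) (intro closed_Times closed_cball closed_atLeastAtMost)
  have K: "compact ({\<alpha>..\<beta>} \<times> cball (0::'a) B)" by (intro compact_Times compact_cball compact_Icc)
  have "compact (({\<alpha>..\<beta>} \<times> cball (0::'a) B) \<inter> closure {p. ?\<phi> p \<noteq> 0})"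
    by (rule compact_Int_closed[OF K closed_closure])
  then have "compact (closure {p. ?\<phi> p \<noteq> 0})" using cl by (simp only: Int_absorb1)
  moreover have "{\<alpha>..\<beta>} \<times> cball (0::'a) B \<subseteq> {0<..<T} \<times> UNIV" using \<theta>(2,3) by auto
  ultimately show ?thesis using Ck cl unfolding test_function_def by blast
qed

lemma time_derivative_product:
  assumes "\<And>t. (\<theta> has_real_derivative \<theta>' t) (at t)"
  shows "time_derivative (\<lambda>(t, x). complex_of_real (\<theta> t * \<eta> x)) = (\<lambda>(t, x). complex_of_real (\<theta>' t * \<eta> x))"
proof -
  have "((\<lambda>\<tau>. complex_of_real (\<theta> \<tau> * \<eta> x)) has_vector_derivative complex_of_real (\<theta>' t * \<eta> x)) (at t)" for t x
    by (intro has_vector_derivative_of_real)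
       (use DERIV_cmult_right[OF assms] in \<open>simp add: has_real_derivative_iff_has_vector_derivative\<close>)
  then show ?thesis
    by (auto simp: time_derivative_def vector_derivative_at intro!: ext)
qed

text \<open>On products the distributional pairing separates: the space variable is absorbed into the
  functional \<open>E\<close>, and what is left is a scalar integral in time.\<close>

lemma dist_pairing_product:
  fixes g :: "real \<Rightarrow> 'a::euclidean_space \<Rightarrow> complex"
  assumes E: "bounded_linear E" "\<forall>f\<in>Lp_space 2. E (cls f) = (LINT x|lborel. f x * complex_of_real (\<eta> x))"
    and g: "\<And>t. t \<in> {0..T} \<Longrightarrow> g t \<in> Lp_space 2" "continuous_on {0..T} (\<lambda>t. cls (g t))"
    and \<theta>: "continuous_on UNIV \<theta>"
  shows "dist_pairing T g (\<lambda>(t, x). complex_of_real (\<theta> t * \<eta> x)) =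
    integral {0..T} (\<lambda>t. complex_of_real (\<theta> t) * E (cls (g t)))"
proof -
  let ?f = "\<lambda>t. complex_of_real (\<theta> t) * E (cls (g t))"
  have cont: "continuous_on {0..T} ?f"
    by (intro continuous_intros bounded_linear.continuous_on[OF E(1)] g(2) continuous_on_subset[OF \<theta>]) simp
  have "set_integrable lborel {0..T} ?f"
    using borel_integrable_compact[OF compact_Icc cont] unfolding set_integrable_def .
  then have int: "set_integrable lborel {0<..<T} ?f" by (rule set_integrable_subset) auto
  have "dist_pairing T g (\<lambda>(t, x). complex_of_real (\<theta> t * \<eta> x)) = (LINT t:{0<..<T}|lborel. ?f t)"
    unfolding dist_pairing_def
  proof (rule set_lebesgue_integral_cong)
    show "\<forall>t. t \<in> {0<..<T} \<longrightarrow>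
        (LINT x|lborel. g t x * (case (t, x) of (t, x) \<Rightarrow> complex_of_real (\<theta> t * \<eta> x))) = ?f t"
    proof (intro allI impI)
      fix t assume "t \<in> {0<..<T}"
      then have gt: "g t \<in> Lp_space 2" by (intro g) auto
      have "(LINT x|lborel. g t x * (case (t, x) of (t, x) \<Rightarrow> complex_of_real (\<theta> t * \<eta> x))) =
          (LINT x|lborel. complex_of_real (\<theta> t) * (g t x * complex_of_real (\<eta> x)))"
        by (simp add: mult_ac)
      also have "\<dots> = complex_of_real (\<theta> t) * (LINT x|lborel. g t x * complex_of_real (\<eta> x))"
        by (rule integral_mult_right_zero)
      also have "\<dots> = ?f t" by (simp only: bspec[OF E(2) gt])
      finally show "(LINT x|lborel. g t x * (case (t, x) of (t, x) \<Rightarrow> complex_of_real (\<theta> t * \<eta> x))) = ?f t" .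
    qed
  qed simp
  also have "\<dots> = integral {0<..<T} ?f" by (rule set_borel_integral_eq_integral[OF int])
  also have "\<dots> = integral {0..T} ?f"
  proof -
    have "(?f has_integral integral {0..T} ?f) {0..T}"
      by (intro integrable_integral integrable_continuous_interval cont)
    then show ?thesis by (intro integral_unique) (simp only: has_integral_Icc_iff_Ioo)
  qed
  finally show ?thesis .
qed

lemma friedrichs_mollifier_kernel:
  assumes "friedrichs_mollifier \<psi>"
  shows "mollifying_kernel \<psi>"
proof -
  have "continuous_on UNIV \<psi>"
    using assms Ck.simps(1)[of \<psi>] by (simp add: friedrichs_mollifier_def test_function_def del: Ck.simps)
  then have "\<psi> \<in> borel_measurable borel" by (rule borel_measurable_continuous_onI)
  moreover have "integrable lborel \<psi>"
    using assms not_integrable_integral_eq[of lborel \<psi>] by (auto simp: friedrichs_mollifier_def)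
  ultimately show ?thesis using assms by (simp add: mollifying_kernel_def friedrichs_mollifier_def)
qed

text \<open>The translates $\psi_\delta(y - \cdot)$ are admissible as spatial factors of test functions, and pairing with
  them evaluates the mollification at \<open>y\<close>.\<close>

lemma mollifying_net_shift:
  fixes \<psi> :: "'a::euclidean_space \<Rightarrow> real"
  assumes \<psi>: "test_function UNIV \<psi>" and d: "\<delta> > 0"
  obtains B where "\<And>k. Ck k (\<lambda>x. mollifying_net \<psi> \<delta> (y - x))"
    "\<And>x. x \<notin> cball 0 B \<Longrightarrow> mollifying_net \<psi> \<delta> (y - x) = 0"
    "(\<lambda>x. complex_of_real (mollifying_net \<psi> \<delta> (y - x))) \<in> Lp_space 2"
proof -
  let ?\<eta> = "\<lambda>x. mollifying_net \<psi> \<delta> (y - x)"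
  have "bounded (closure {x. \<psi> x \<noteq> 0})" using \<psi> by (intro compact_imp_bounded) (simp add: test_function_def)
  then obtain B where B0: "\<forall>x\<in>closure {x. \<psi> x \<noteq> 0}. norm x \<le> B"
    unfolding bounded_iff by (elim exE)
  have B: "norm x \<le> B" if "\<psi> x \<noteq> 0" for x
    using bspec[OF B0, of x] subsetD[OF closure_subset, of x "{x. \<psi> x \<noteq> 0}"] that by simp
  define B' where "B' = norm y + \<delta> * \<bar>B\<bar>"
  have zero: "?\<eta> x = 0" if "x \<notin> cball 0 B'" for x
  proof (rule ccontr)
    assume "?\<eta> x \<noteq> 0"
    then have "norm ((y - x) /\<^sub>R \<delta>) \<le> B" by (intro B) (simp add: mollifying_net_def)
    then have "\<delta> * (inverse \<delta> * norm (y - x)) \<le> \<delta> * B"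
      using d by (intro mult_left_mono) (simp_all only: norm_scaleR abs_of_pos positive_imp_inverse_positive less_imp_le)
    then have "norm (y - x) \<le> \<delta> * B" using d by (simp add: mult.assoc[symmetric])
    also have "\<dots> \<le> \<delta> * \<bar>B\<bar>" using d by (intro mult_left_mono) auto
    finally have "norm (y - x) \<le> \<delta> * \<bar>B\<bar>" .
    moreover have "norm x \<le> norm y + norm (y - x)"
      using norm_triangle_ineq4[of y "y - x"] by simp
    ultimately show False using that by (simp add: B'_def)
  qed
  have L: "bounded_linear (\<lambda>x::'a. - (x /\<^sub>R \<delta>))"
    by (intro bounded_linear_minus bounded_linear_scaleR_right)
  have "Ck k (\<lambda>x. \<psi> (y /\<^sub>R \<delta> + - (x /\<^sub>R \<delta>)) / \<delta> ^ DIM('a))" for k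
    using \<psi> by (intro Ck_bounded_linear[OF bounded_linear_divide] Ck_affine[OF L]) (simp add: test_function_def)
  moreover have "?\<eta> = (\<lambda>x. \<psi> (y /\<^sub>R \<delta> + - (x /\<^sub>R \<delta>)) / \<delta> ^ DIM('a))"
    by (simp add: mollifying_net_def[abs_def] scaleR_diff_right)
  ultimately have Ck: "Ck k ?\<eta>" for k by (simp only:)
  have cont: "continuous_on UNIV ?\<eta>" using Ck[of 0] by (simp only: Ck.simps)
  then have [measurable]: "?\<eta> \<in> borel_measurable borel" by (rule borel_measurable_continuous_onI)
  have "integrable lborel (\<lambda>x. indicator (cball 0 B') x *\<^sub>R (?\<eta> x)\<^sup>2)"
    by (intro borel_integrable_compact compact_cball continuous_intros continuous_on_subset[OF cont]) simp
  moreover have "(\<lambda>x. indicator (cball 0 B') x *\<^sub>R (?\<eta> x)\<^sup>2) = (\<lambda>x. (norm (complex_of_real (?\<eta> x)))\<^sup>2)"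
    using zero by (intro ext) (auto split: split_indicator simp del: mem_cball)
  ultimately have "integrable lborel (\<lambda>x. (norm (complex_of_real (?\<eta> x)))\<^sup>2)" by (simp only:)
  then have "(\<lambda>x. complex_of_real (?\<eta> x)) \<in> Lp_space 2" unfolding L2_iff by simp
  with Ck zero show thesis by (rule that)
qed


text \<open>A class all of whose mollifications vanish is zero, since the mollifications converge to it.\<close>

lemma cls_eq_0_if_mollifications_vanish:
  assumes w: "w \<in> Lp_space 2" and \<psi>: "mollifying_kernel \<psi>"
    and zero: "\<And>\<delta> y. \<delta> > 0 \<Longrightarrow> (LINT x|lborel. w x * complex_of_real (mollifying_net \<psi> \<delta> (y - x))) = 0"
  shows "cls w = 0"
proof -
  have "convolution w (mollifying_net \<psi> \<delta>) = (\<lambda>_. 0)" if "\<delta> > 0" for \<delta>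
    unfolding convolution_def scaleR_conv_of_real mult.commute[of "complex_of_real _"] using zero[OF that] by simp
  then have "\<forall>\<^sub>F \<delta> in at_right 0. cls (convolution w (mollifying_net \<psi> \<delta>)) = 0"
    using eventually_at_right_less[of 0] by (auto elim!: eventually_mono)
  then have "((\<lambda>\<delta>. cls (convolution w (mollifying_net \<psi> \<delta>))) \<longlongrightarrow> 0) (at_right 0)"
    by (rule tendsto_eventually)
  then show ?thesis
    by (rule tendsto_unique[OF trivial_limit_at_right_real cls_convolution_tendsto[OF w \<psi>]])
qed

text \<open>Fix $\eta = \psi_\delta(y - \cdot)$ and let \<open>E\<close> be the pairing with it. Tested with $\theta(t)\,\eta(x)$, the
  equation says that $E(u)$ satisfies a scalar equation weakly, and as $u_t = v$ already holds in $L^2$, it integrates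
  to $E(v(t)) + \int_0^t E(G) = E(v(0))$. The functional can be pulled out of the integral, and since $\delta$
  and \<open>y\<close> are arbitrary, $v(t) = v(0) - \int_0^t G$ in \<open>l2\<close>, with \<open>G\<close> continuous.\<close>

lemma wave_solution_curve:
  fixes a b \<psi> :: "'a::euclidean_space \<Rightarrow> real"
  assumes s: "0 < s" "2 * s < real DIM('a)" and T: "T > 0" and \<psi>: "friedrichs_mollifier \<psi>"
    and a: "a \<in> Lp_space (real DIM('a) / s)" and b: "b \<in> Lp_space (real DIM('a) / s)"
    and sol: "wave_solution s T a b u0 u1 u"
  shows "\<exists>v. continuous_in_sobolev (2 * s) T u \<and> C1_in_sobolev s T u v \<and>
    (AE x in lborel. u 0 x = u0 x) \<and> (AE x in lborel. v 0 x = u1 x) \<and>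
    (\<forall>t\<in>{0..T}. ((\<lambda>t. cls (v t)) has_vector_derivative
      - (Lambda (2 * s) (u t) + cls (\<lambda>x. a x *\<^sub>R u t x) + cls (\<lambda>x. b x *\<^sub>R v t x))) (at t within {0..T}))"
proof -
  have cu: "continuous_in_sobolev (2 * s) T u" using sol by (simp add: wave_solution_def)
  obtain v where C1: "C1_in_sobolev s T u v"
    and weak: "\<forall>\<phi>. test_function ({0<..<T} \<times> UNIV) \<phi> \<longrightarrow>
        dist_pairing T u (time_derivative (time_derivative \<phi>))
        + dist_pairing T (\<lambda>t. frac_laplacian s (u t)) \<phi>
        + dist_pairing T (\<lambda>t x. a x *\<^sub>R u t x) \<phi>
        + dist_pairing T (\<lambda>t x. b x *\<^sub>R v t x) \<phi> = 0"
    and ic: "AE x in lborel. u 0 x = u0 x" "AE x in lborel. v 0 x = u1 x"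
    using sol unfolding wave_solution_def by (elim conjE exE)
  have cs: "continuous_in_sobolev s T u" and cv: "continuous_in_sobolev s T v"
    using C1 by (simp_all add: C1_in_sobolev_def)
  obtain Ca where opa: "\<forall>f\<in>sobolev_space s. (\<lambda>x. a x *\<^sub>R f x) \<in> Lp_space 2 \<and> norm (cls (\<lambda>x. a x *\<^sub>R f x)) \<le> Ca * norm (Lambda s f)"
    by (rule multiplication_operator[OF s a])
  obtain Cb where opb: "\<forall>f\<in>sobolev_space s. (\<lambda>x. b x *\<^sub>R f x) \<in> Lp_space 2 \<and> norm (cls (\<lambda>x. b x *\<^sub>R f x)) \<le> Cb * norm (Lambda s f)"
    by (rule multiplication_operator[OF s b])
  let ?L = "\<lambda>t. Lambda (2 * s) (u t)" and ?A = "\<lambda>t. cls (\<lambda>x. a x *\<^sub>R u t x)" and ?B = "\<lambda>t. cls (\<lambda>x. b x *\<^sub>R v t x)"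
  have Lc: "continuous_on {0..T} ?L" by (rule continuous_in_sobolevD(3)[OF cu])
  have Ac: "continuous_on {0..T} ?A" by (rule multiplication_continuous[OF opa cs])
  have Bc: "continuous_on {0..T} ?B" by (rule multiplication_continuous[OF opb cv])
  have Vc: "continuous_on {0..T} (\<lambda>t. cls (v t))" by (rule continuous_in_sobolevD(2)[OF cv])
  have Uc: "continuous_on {0..T} (\<lambda>t. cls (u t))" by (rule continuous_in_sobolevD(2)[OF cs])
  define G where "G t = ?L t + ?A t + ?B t" for t
  have Gc: "continuous_on {0..T} G" unfolding G_def by (intro continuous_intros Lc Ac Bc)
  have kernel: "mollifying_kernel \<psi>" by (rule friedrichs_mollifier_kernel[OF \<psi>])
  have tf: "test_function UNIV \<psi>" and \<psi>0: "\<And>x. 0 \<le> \<psi> x" and \<psi>1: "(LINT x|lborel. \<psi> x) = 1"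
    using \<psi> by (auto simp: friedrichs_mollifier_def)
  obtain x0 where x0: "\<psi> x0 > 0"
  proof (rule ccontr)
    assume "\<not> thesis"
    then have "\<not> \<psi> x > 0" for x using that by blast
    then have "\<psi> x = 0" for x using \<psi>0[of x] by (simp add: order_less_le)
    then show False using \<psi>1 by simp
  qed
  have eq: "cls (v t) = cls (v 0) - integral {0..t} G" if t: "t \<in> {0..T}" for t
  proof -
    obtain w where w: "w \<in> Lp_space 2" "cls (v t) - cls (v 0) + integral {0..t} G = cls w"
      by (rule cls_surj)
    have "cls w = 0"
    proof (rule cls_eq_0_if_mollifications_vanish[OF w(1) kernel])
      fix \<delta> :: real and y :: 'a assume \<delta>: "\<delta> > 0"
      let ?\<eta> = "\<lambda>x. mollifying_net \<psi> \<delta> (y - x)"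
      show "(LINT x|lborel. w x * complex_of_real (?\<eta> x)) = 0"
      proof (rule mollifying_net_shift[OF tf \<delta>, of y], rule smooth_step[OF tf \<psi>0 x0])
        fix B and R \<rho> :: "real \<Rightarrow> real" and bd :: real
        assume \<eta>: "\<And>k. Ck k ?\<eta>" "\<And>x. x \<notin> cball 0 B \<Longrightarrow> ?\<eta> x = 0" "(\<lambda>x. complex_of_real (?\<eta> x)) \<in> Lp_space 2"
          and step: "bd > 0" "\<And>k. Ck k \<rho>" "\<And>t. (R has_real_derivative \<rho> t) (at t)" "\<And>t. 0 \<le> \<rho> t"
            "\<And>t. \<bar>t\<bar> \<ge> bd \<Longrightarrow> \<rho> t = 0" "\<And>t. t \<le> - bd \<Longrightarrow> R t = 0" "\<And>t. t \<ge> bd \<Longrightarrow> R t = 1"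
        obtain E :: "'a l2 \<Rightarrow> complex" where E: "bounded_linear E"
          "\<forall>f\<in>Lp_space 2. E (cls f) = (LINT x|lborel. f x * complex_of_real (?\<eta> x))"
          by (rule pairing_functional[OF \<eta>(3)])
        note Ec = bounded_linear.continuous_on[OF E(1)]
        have "E (cls (v t)) + integral {0..t} (\<lambda>t. E (G t)) = E (cls (v 0))"
        proof (rule weak_second_derivative[OF T step _ Ec[OF Vc] Ec[OF Gc] _ t])
          fix t assume "t \<in> {0..T}"
          then show "((\<lambda>t. E (cls (u t))) has_vector_derivative E (cls (v t))) (at t within {0..T})"
            by (intro bounded_linear.has_vector_derivative[OF E(1)] C1_in_sobolevD(1)[OF C1])
        next
          fix \<theta> \<theta>1 \<theta>2 :: "real \<Rightarrow> real" and \<alpha> \<beta> :: real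
          assume \<theta>: "\<forall>k. Ck k \<theta>" "\<forall>t. (\<theta> has_real_derivative \<theta>1 t) (at t)" "\<forall>t. (\<theta>1 has_real_derivative \<theta>2 t) (at t)"
            "continuous_on UNIV \<theta>2" "0 < \<alpha>" "\<beta> < T" "\<forall>t. t \<notin> {\<alpha>..\<beta>} \<longrightarrow> \<theta> t = 0"
          have \<theta>c: "continuous_on UNIV \<theta>" using spec[OF \<theta>(1), of 0] by (simp only: Ck.simps)
          let ?\<phi> = "\<lambda>(t, x). complex_of_real (\<theta> t * ?\<eta> x)"
          have test: "test_function ({0<..<T} \<times> UNIV) ?\<phi>"
            by (rule test_function_product[OF spec[OF \<theta>(1)] \<theta>(5,6) \<theta>(7)[rule_format] \<eta>(1,2)])
          have td: "time_derivative (time_derivative ?\<phi>) = (\<lambda>(t, x). complex_of_real (\<theta>2 t * ?\<eta> x))"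
            by (simp only: time_derivative_product[OF spec[OF \<theta>(2)]] time_derivative_product[OF spec[OF \<theta>(3)]])
          note dp = dist_pairing_product[OF E]
          have 1: "dist_pairing T u (time_derivative (time_derivative ?\<phi>)) =
              integral {0..T} (\<lambda>t. complex_of_real (\<theta>2 t) * E (cls (u t)))"
            unfolding td by (rule dp[OF _ Uc \<theta>(4)]) (rule sobolev_spaceD(1)[OF continuous_in_sobolevD(1)[OF cs]])
          have frac: "frac_laplacian s (u t) \<in> Lp_space 2" "Lambda (2 * s) (u t) = cls (frac_laplacian s (u t))"
            if "t \<in> {0..T}" for t
            using sobolev_spaceD(3)[OF continuous_in_sobolevD(1)[OF cu that]] by (simp_all add: Lambda_def)
          have "continuous_on {0..T} (\<lambda>t. cls (frac_laplacian s (u t)))"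
            using Lc by (simp add: Lambda_def)
          from dp[OF frac(1) this \<theta>c] have 2: "dist_pairing T (\<lambda>t. frac_laplacian s (u t)) ?\<phi> =
              integral {0..T} (\<lambda>t. complex_of_real (\<theta> t) * E (?L t))"
            by (simp add: Lambda_def)
          have 3: "dist_pairing T (\<lambda>t x. a x *\<^sub>R u t x) ?\<phi> = integral {0..T} (\<lambda>t. complex_of_real (\<theta> t) * E (?A t))"
            by (rule dp[OF _ Ac \<theta>c]) (rule conjunct1[OF bspec[OF opa continuous_in_sobolevD(1)[OF cs]]])
          have 4: "dist_pairing T (\<lambda>t x. b x *\<^sub>R v t x) ?\<phi> = integral {0..T} (\<lambda>t. complex_of_real (\<theta> t) * E (?B t))"
            by (rule dp[OF _ Bc \<theta>c]) (rule conjunct1[OF bspec[OF opb continuous_in_sobolevD(1)[OF cv]]])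
          have i: "(\<lambda>t. complex_of_real (\<theta> t) * E (X t)) integrable_on {0..T}" if "continuous_on {0..T} X" for X
            by (intro integrable_continuous_interval continuous_on_mult continuous_on_of_real
                continuous_on_subset[OF \<theta>c] Ec that) simp
          have "(\<lambda>t. complex_of_real (\<theta> t) * E (G t)) =
              (\<lambda>t. complex_of_real (\<theta> t) * E (?L t) + complex_of_real (\<theta> t) * E (?A t) + complex_of_real (\<theta> t) * E (?B t))"
            by (simp only: G_def linear_simps(1)[OF E(1)] distrib_left)
          then have "integral {0..T} (\<lambda>t. complex_of_real (\<theta> t) * E (G t)) =
              integral {0..T} (\<lambda>t. complex_of_real (\<theta> t) * E (?L t)) + integral {0..T} (\<lambda>t. complex_of_real (\<theta> t) * E (?A t)) +
              integral {0..T} (\<lambda>t. complex_of_real (\<theta> t) * E (?B t))"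
            by (simp only: integral_add[OF integrable_add[OF i[OF Lc] i[OF Ac]] i[OF Bc]] integral_add[OF i[OF Lc] i[OF Ac]])
          with mp[OF spec[OF weak] test]
          show "integral {0..T} (\<lambda>t. complex_of_real (\<theta>2 t) * E (cls (u t))) +
              integral {0..T} (\<lambda>t. complex_of_real (\<theta> t) * E (G t)) = 0"
            unfolding 1 2 3 4 by (simp only: add.assoc)
        qed
        moreover have "integral {0..t} (\<lambda>t. E (G t)) = E (integral {0..t} G)"
        proof -
          have "G integrable_on {0..t}"
            using t by (intro integrable_continuous_interval continuous_on_subset[OF Gc]) auto
          from integral_linear[OF this E(1)] show ?thesis by (simp only: o_def)
        qed
        ultimately have sum0: "E (cls (v t)) + E (integral {0..t} G) = E (cls (v 0))" by (simp only:)
        have "E (cls (v t) - cls (v 0) + integral {0..t} G) = (E (cls (v t)) + E (integral {0..t} G)) - E (cls (v 0))"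
          by (simp only: linear_simps(1,2)[OF E(1)]) simp
        then have "E (cls (v t) - cls (v 0) + integral {0..t} G) = 0" by (simp only: sum0 diff_self)
        then show ?thesis unfolding w(2) using E(2) w(1) by simp
      qed
    qed
    then have "cls (v t) - cls (v 0) + integral {0..t} G = 0" using w(2) by simp
    then show ?thesis by (simp add: algebra_simps eq_neg_iff_add_eq_0)
  qed
  have "((\<lambda>t. cls (v t)) has_vector_derivative - G t) (at t within {0..T})" if t: "t \<in> {0..T}" for t
  proof -
    have "((\<lambda>t. cls (v 0) - integral {0..t} G) has_vector_derivative (0 - G t)) (at t within {0..T})"
      by (intro has_vector_derivative_diff has_vector_derivative_const integral_has_vector_derivative Gc t)
    then show ?thesis
      by (intro has_vector_derivative_transform[OF t eq]) simp_all
  qed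
  then show ?thesis unfolding G_def using cu C1 ic by (intro exI[of _ v] conjI ballI)
qed

section \<open>The energy estimate\<close>

text \<open>The energy is $|W_1|^2 + |S|^2 + \langle A, W\rangle$, where \<open>S\<close> stands for $(-\Delta)^{s/2} W$. The
  hypotheses \<open>LS\<close> and \<open>AA\<close> make the conservative terms cancel in its derivative and \<open>B0\<close> gives the damping the
  right sign, so that the forcing \<open>F\<close> alone can increase the energy, at a rate of at most
  \<open>norm (W1)\<^sup>2 + norm F\<^sup>2\<close>; Gronwall's argument bounds \<open>W1\<close>, and integrating \<open>W1\<close> bounds \<open>W\<close>, to which the
  energy gives no direct access.\<close>

lemma energy_estimate:
  fixes W W1 S P A A1 B L F :: "real \<Rightarrow> 'h::real_inner"
  assumes T: "T > 0"
    and W': "\<And>t. t \<in> {0..T} \<Longrightarrow> (W has_vector_derivative W1 t) (at t within {0..T})"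
    and W1': "\<And>t. t \<in> {0..T} \<Longrightarrow> (W1 has_vector_derivative - (L t + A t + B t) + F t) (at t within {0..T})"
    and S': "\<And>t. t \<in> {0..T} \<Longrightarrow> (S has_vector_derivative P t) (at t within {0..T})"
    and A': "\<And>t. t \<in> {0..T} \<Longrightarrow> (A has_vector_derivative A1 t) (at t within {0..T})"
    and LS: "\<And>t. t \<in> {0..T} \<Longrightarrow> inner (L t) (W1 t) = inner (S t) (P t)"
    and AA: "\<And>t. t \<in> {0..T} \<Longrightarrow> inner (A1 t) (W t) = inner (A t) (W1 t)"
    and A0: "\<And>t. t \<in> {0..T} \<Longrightarrow> 0 \<le> inner (A t) (W t)"
    and B0: "\<And>t. t \<in> {0..T} \<Longrightarrow> 0 \<le> inner (B t) (W1 t)"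
    and Fd: "\<And>t. t \<in> {0..T} \<Longrightarrow> norm (F t) \<le> d"
    and t: "t \<in> {0..T}"
  shows "norm (W t) \<le> norm (W 0) +
    T * sqrt (exp T * ((norm (W1 0))\<^sup>2 + (norm (S 0))\<^sup>2 + inner (A 0) (W 0) + T * d\<^sup>2))"
proof -
  define E where "E t = inner (W1 t) (W1 t) + inner (S t) (S t) + inner (A t) (W t)" for t
  have E': "\<exists>y. (E has_real_derivative y) (at t within {0..T}) \<and> y \<le> E t + d\<^sup>2" if t: "t \<in> {0..T}" for t
  proof (intro exI conjI)
    have ip: "((\<lambda>t. inner (f t) (g t)) has_real_derivative (inner (f t) g' + inner f' (g t))) (at t within {0..T})"
      if "(f has_vector_derivative f') (at t within {0..T})" "(g has_vector_derivative g') (at t within {0..T})"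
      for f g :: "real \<Rightarrow> 'h" and f' g'
      using bounded_bilinear.has_vector_derivative[OF bounded_bilinear_inner that]
      by (simp add: has_real_derivative_iff_has_vector_derivative)
    let ?D = "- (L t + A t + B t) + F t"
    let ?y = "(inner (W1 t) ?D + inner ?D (W1 t)) + (inner (S t) (P t) + inner (P t) (S t)) +
        (inner (A t) (W1 t) + inner (A1 t) (W t))"
    show "(E has_real_derivative ?y) (at t within {0..T})"
      unfolding E_def[abs_def] by (intro DERIV_add ip W1'[OF t] S'[OF t] A'[OF t] W'[OF t])
    have "?y = 2 * inner (W1 t) (F t) - 2 * inner (B t) (W1 t)"
      using LS[OF t] AA[OF t]
      by (simp add: inner_add_left inner_add_right inner_diff_left inner_diff_right inner_commute)
    also have "\<dots> \<le> 2 * (norm (W1 t) * norm (F t))"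
      using B0[OF t] norm_cauchy_schwarz[of "W1 t" "F t"] by linarith
    also have "\<dots> \<le> (norm (W1 t))\<^sup>2 + (norm (F t))\<^sup>2"
      using sum_squares_bound[of "norm (W1 t)" "norm (F t)"] by (simp add: mult.assoc)
    also have "\<dots> \<le> E t + d\<^sup>2"
      using power_mono[OF Fd[OF t] norm_ge_zero, of 2] A0[OF t] inner_ge_zero[of "S t"]
      unfolding E_def power2_norm_eq_inner by linarith
    finally show "?y \<le> E t + d\<^sup>2" .
  qed
  obtain y where y: "(E has_real_derivative y t) (at t within {0..T})" "y t \<le> E t + d\<^sup>2" if "t \<in> {0..T}" for t
    using E' by metis
  define g where "g t = exp (- t) * E t - d\<^sup>2 * t" for t
  have g': "(g has_real_derivative (exp (- t) * (y t - E t) - d\<^sup>2)) (at t within {0..T})" if t: "t \<in> {0..T}" for t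
    unfolding g_def[abs_def]
    by (rule derivative_eq_intros y(1)[OF t] refl | simp add: algebra_simps)+
  have g_le: "g t \<le> g 0" if t: "t \<in> {0..T}" for t
  proof (cases "t = 0")
    case False
    then have t0: "0 < t" using t by simp
    show ?thesis
    proof (rule DERIV_nonpos_imp_decreasing_open[OF less_imp_le[OF t0]])
      fix x assume x: "0 < x" "x < t"
      then have x': "x \<in> {0..T}" using t by simp
      have "at x within {0..T} = at x" using x t by (intro at_within_interior) auto
      then have "(g has_real_derivative (exp (- x) * (y x - E x) - d\<^sup>2)) (at x)" using g'[OF x'] by simp
      moreover have "exp (- x) * (y x - E x) \<le> 1 * d\<^sup>2"
      proof -
        have "exp (- x) * (y x - E x) \<le> exp (- x) * d\<^sup>2" using y(2)[OF x'] by (intro mult_left_mono) auto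
        also have "\<dots> \<le> 1 * d\<^sup>2" using x by (intro mult_right_mono) auto
        finally show ?thesis .
      qed
      ultimately show "\<exists>y. (g has_real_derivative y) (at x) \<and> y \<le> 0"
        by (intro exI conjI) (assumption, simp)
    next
      have "continuous_on {0..T} g"
        unfolding continuous_on_eq_continuous_within using g' by (intro ballI DERIV_continuous)
      then show "continuous_on {0..t} g" by (rule continuous_on_subset) (use t in auto)
    qed
  qed simp
  define M where "M = sqrt (exp T * (E 0 + T * d\<^sup>2))"
  have E0: "0 \<le> E 0" using A0[of 0] T by (simp add: E_def)
  have W1M: "norm (W1 t) \<le> M" if t: "t \<in> {0..T}" for t
  proof -
    have "(norm (W1 t))\<^sup>2 \<le> E t" using A0[OF t] inner_ge_zero[of "S t"]
      unfolding E_def power2_norm_eq_inner by linarith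
    also have "E t = exp t * (exp (- t) * E t)" by (simp add: mult.assoc[symmetric] exp_add[symmetric])
    also have "\<dots> \<le> exp t * (E 0 + T * d\<^sup>2)"
    proof (rule mult_left_mono)
      have "exp (- t) * E t \<le> E 0 + t * d\<^sup>2" using g_le[OF t] by (simp add: g_def mult.commute)
      also have "t * d\<^sup>2 \<le> T * d\<^sup>2" using t by (intro mult_right_mono) auto
      finally show "exp (- t) * E t \<le> E 0 + T * d\<^sup>2" by simp
    qed simp
    also have "\<dots> \<le> exp T * (E 0 + T * d\<^sup>2)" using t E0 T by (intro mult_right_mono) auto
    finally show ?thesis unfolding M_def by (rule real_le_rsqrt)
  qed
  have "norm (W t - W 0) \<le> M * norm (t - 0)"
  proof (rule differentiable_bound[of "{0..T}" W "\<lambda>t h. h *\<^sub>R W1 t"])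
    show "(W has_derivative (\<lambda>h. h *\<^sub>R W1 x)) (at x within {0..T})" if "x \<in> {0..T}" for x
      using W'[OF that] by (simp add: has_vector_derivative_def)
    show "onorm (\<lambda>h. h *\<^sub>R W1 x) \<le> M" if "x \<in> {0..T}" for x
      using W1M[OF that] by (intro onorm_le) (simp, subst mult.commute, rule mult_right_mono, simp_all)
  qed (use t T in auto)
  also have "\<dots> \<le> M * T" using t E0 T by (intro mult_left_mono) (auto simp: M_def)
  finally have "norm (W t) \<le> norm (W 0) + T * M"
    using norm_triangle_sub[of "W t" "W 0"] by (simp add: mult.commute)
  then show ?thesis by (simp add: M_def E_def power2_norm_eq_inner)
qed



section \<open>Very weak solutions converge to the classical solution\<close>

lemma inner_mult_sym:
  fixes c :: "'a::euclidean_space \<Rightarrow> real"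
  assumes "f \<in> Lp_space 2" "g \<in> Lp_space 2" "(\<lambda>x. c x *\<^sub>R f x) \<in> Lp_space 2" "(\<lambda>x. c x *\<^sub>R g x) \<in> Lp_space 2"
  shows "inner (cls (\<lambda>x. c x *\<^sub>R f x)) (cls g) = inner (cls (\<lambda>x. c x *\<^sub>R g x)) (cls f)"
  using assms by (simp add: inner_cls inner_commute)

lemma inner_mult_nonneg:
  fixes c :: "'a::euclidean_space \<Rightarrow> real"
  assumes "\<And>x. 0 \<le> c x" "f \<in> Lp_space 2" "(\<lambda>x. c x *\<^sub>R f x) \<in> Lp_space 2"
  shows "0 \<le> inner (cls (\<lambda>x. c x *\<^sub>R f x)) (cls f)"
  using assms by (simp add: inner_cls)

lemma convolution_nonneg:
  fixes a :: "'a::euclidean_space \<Rightarrow> real"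
  assumes "AE x in lborel. 0 \<le> a x" "\<And>x. 0 \<le> \<psi> x" "\<epsilon> > 0"
  shows "0 \<le> convolution a (mollifying_net \<psi> \<epsilon>) x"
  unfolding convolution_def mollifying_net_def
proof (rule integral_nonneg_AE)
  show "AE y in lborel. 0 \<le> (\<psi> ((x - y) /\<^sub>R \<epsilon>) / \<epsilon> ^ DIM('a)) *\<^sub>R a y"
    using assms(1) by eventually_elim (use assms(2,3) in simp)
qed

text \<open>The difference of the two solutions solves the regularised equation with forcing
  $(a - a_\varepsilon) u + (b - b_\varepsilon) u_t$, so that its bound \<open>d\<close> involves only the
  solution \<open>u\<close> and the distance of the coefficients. The energy identities hold because the fractional Laplacian and
  the multiplication by \<open>a'\<close> are symmetric, and the signs because \<open>a'\<close> and \<open>b'\<close> are non-negative.\<close>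

lemma wave_stability:
  fixes a a' b b' \<psi> :: "'a::euclidean_space \<Rightarrow> real"
  assumes s: "0 < s" "2 * s < real DIM('a)" and T: "T > 0"
    and a': "a' \<in> Lp_space (real DIM('a) / s)" "\<And>x. 0 \<le> a' x"
    and b': "b' \<in> Lp_space (real DIM('a) / s)" "\<And>x. 0 \<le> b' x"
    and a: "a \<in> Lp_space (real DIM('a) / s)" and b: "b \<in> Lp_space (real DIM('a) / s)"
    and u: "continuous_in_sobolev (2 * s) T u" "C1_in_sobolev s T u v"
      "\<forall>t\<in>{0..T}. ((\<lambda>t. cls (v t)) has_vector_derivative
        - (Lambda (2 * s) (u t) + cls (\<lambda>x. a x *\<^sub>R u t x) + cls (\<lambda>x. b x *\<^sub>R v t x))) (at t within {0..T})"
    and u': "continuous_in_sobolev (2 * s) T u'" "C1_in_sobolev s T u' v'"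
      "\<forall>t\<in>{0..T}. ((\<lambda>t. cls (v' t)) has_vector_derivative
        - (Lambda (2 * s) (u' t) + cls (\<lambda>x. a' x *\<^sub>R u' t x) + cls (\<lambda>x. b' x *\<^sub>R v' t x))) (at t within {0..T})"
    and forcing: "\<And>t. t \<in> {0..T} \<Longrightarrow> norm (cls (\<lambda>x. (a x - a' x) *\<^sub>R u t x)) + norm (cls (\<lambda>x. (b x - b' x) *\<^sub>R v t x)) \<le> d"
    and t: "t \<in> {0..T}"
  shows "norm (cls (u' t) - cls (u t)) \<le> norm (cls (u' 0) - cls (u 0)) +
    T * sqrt (exp T * ((norm (cls (v' 0) - cls (v 0)))\<^sup>2 + (norm (Lambda s (u' 0) - Lambda s (u 0)))\<^sup>2 +
      inner (cls (\<lambda>x. a' x *\<^sub>R (u' 0 x - u 0 x))) (cls (u' 0) - cls (u 0)) + T * d\<^sup>2))"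
proof -
  have mem: "u t \<in> sobolev_space s" "v t \<in> sobolev_space s" "u t \<in> sobolev_space (2 * s)"
    "u' t \<in> sobolev_space s" "v' t \<in> sobolev_space s" "u' t \<in> sobolev_space (2 * s)" if "t \<in> {0..T}" for t
    using u u' that by (auto simp: C1_in_sobolev_def dest: continuous_in_sobolevD(1))
  note L2 = mem[THEN sobolev_spaceD(1)]
  have mult: "(\<lambda>x. c x *\<^sub>R f x) \<in> Lp_space 2" if c: "c \<in> Lp_space (real DIM('a) / s)" and f: "f \<in> sobolev_space s"
    for c :: "'a \<Rightarrow> real" and f
  proof -
    obtain C where "\<forall>f\<in>sobolev_space s. (\<lambda>x. c x *\<^sub>R f x) \<in> Lp_space 2 \<and> norm (cls (\<lambda>x. c x *\<^sub>R f x)) \<le> C * norm (Lambda s f)"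
      by (rule multiplication_operator[OF s c])
    from conjunct1[OF bspec[OF this f]] show ?thesis .
  qed
  have md: "cls (\<lambda>x. c x *\<^sub>R (f x - g x)) = cls (\<lambda>x. c x *\<^sub>R f x) - cls (\<lambda>x. c x *\<^sub>R g x)"
    if "c \<in> Lp_space (real DIM('a) / s)" "f \<in> sobolev_space s" "g \<in> sobolev_space s" for c :: "'a \<Rightarrow> real" and f g
    by (rule cls_mult_diff[OF mult[OF that(1,2)] mult[OF that(1,3)]])
  have der: "((\<lambda>t. cls (\<lambda>x. a' x *\<^sub>R w t x)) has_vector_derivative cls (\<lambda>x. a' x *\<^sub>R w1 t x)) (at t within {0..T})"
    if "C1_in_sobolev s T w w1" "t \<in> {0..T}" for w w1 t
  proof -
    obtain C where op: "\<forall>f\<in>sobolev_space s. (\<lambda>x. a' x *\<^sub>R f x) \<in> Lp_space 2 \<and> norm (cls (\<lambda>x. a' x *\<^sub>R f x)) \<le> C * norm (Lambda s f)"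
      by (rule multiplication_operator[OF s a'(1)])
    show ?thesis by (rule multiplication_has_vector_derivative[OF op that])
  qed
  let ?M = "\<lambda>c f. cls (\<lambda>x. c x *\<^sub>R f x)"
  let ?F = "\<lambda>t. (?M a (u t) - ?M a' (u t)) + (?M b (v t) - ?M b' (v t))"
  have cl: "cls (\<lambda>x. u' t x - u t x) = cls (u' t) - cls (u t)" "cls (\<lambda>x. v' t x - v t x) = cls (v' t) - cls (v t)"
    if "t \<in> {0..T}" for t
    using L2[OF that] by (simp_all only: cls_diff)
  note sd = sobolev_diff[OF mem(4,1)] sobolev_diff[OF mem(5,2)]
  have "norm (cls (u' t) - cls (u t)) \<le> norm (cls (u' 0) - cls (u 0)) +
    T * sqrt (exp T * ((norm (cls (v' 0) - cls (v 0)))\<^sup>2 + (norm (Lambda s (u' 0) - Lambda s (u 0)))\<^sup>2 +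
      inner (?M a' (u' 0) - ?M a' (u 0)) (cls (u' 0) - cls (u 0)) + T * d\<^sup>2))"
  proof (rule energy_estimate[OF T, where P="\<lambda>t. Lambda s (v' t) - Lambda s (v t)"
        and ?A1.0="\<lambda>t. ?M a' (v' t) - ?M a' (v t)" and B="\<lambda>t. ?M b' (v' t) - ?M b' (v t)"
        and L="\<lambda>t. Lambda (2 * s) (u' t) - Lambda (2 * s) (u t)" and F="?F" and ?W1.0="\<lambda>t. cls (v' t) - cls (v t)"])
    fix t assume t: "t \<in> {0..T}"
    show "((\<lambda>t. cls (u' t) - cls (u t)) has_vector_derivative cls (v' t) - cls (v t)) (at t within {0..T})"
      by (intro has_vector_derivative_diff C1_in_sobolevD(1)[OF u'(2) t] C1_in_sobolevD(1)[OF u(2) t])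
    show "((\<lambda>t. Lambda s (u' t) - Lambda s (u t)) has_vector_derivative Lambda s (v' t) - Lambda s (v t)) (at t within {0..T})"
      by (intro has_vector_derivative_diff C1_in_sobolevD(2)[OF u'(2) t] C1_in_sobolevD(2)[OF u(2) t])
    show "((\<lambda>t. ?M a' (u' t) - ?M a' (u t)) has_vector_derivative ?M a' (v' t) - ?M a' (v t)) (at t within {0..T})"
      by (intro has_vector_derivative_diff der[OF u'(2) t] der[OF u(2) t])
    show "((\<lambda>t. cls (v' t) - cls (v t)) has_vector_derivative
        - ((Lambda (2 * s) (u' t) - Lambda (2 * s) (u t)) + (?M a' (u' t) - ?M a' (u t)) + (?M b' (v' t) - ?M b' (v t))) + ?F t)
        (at t within {0..T})"
      by (rule has_vector_derivative_eq_rhs[OF has_vector_derivative_diff[OF bspec[OF u'(3) t] bspec[OF u(3) t]]])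
         (simp add: algebra_simps)
    have h: "has_frac_laplacian s (u t) (frac_laplacian s (u t))" "has_frac_laplacian s (u' t) (frac_laplacian s (u' t))"
      using sobolev_spaceD(2)[OF mem(3)[OF t]] sobolev_spaceD(2)[OF mem(6)[OF t]] by simp_all
    have LL: "Lambda (2 * s) (u' t) - Lambda (2 * s) (u t) = cls (\<lambda>x. frac_laplacian s (u' t) x - frac_laplacian s (u t) x)"
      using h[THEN has_frac_laplacian_L2(2)] by (simp add: Lambda_def cls_diff)
    have "inner (cls (\<lambda>x. frac_laplacian s (u' t) x - frac_laplacian s (u t) x)) (cls (\<lambda>x. v' t x - v t x)) =
        inner (Lambda s (\<lambda>x. u' t x - u t x)) (Lambda s (\<lambda>x. v' t x - v t x))"
      unfolding Lambda_def
      by (rule has_frac_laplacian_inner[OF has_frac_laplacian_diff[OF h(2,1)] sobolev_spaceD(2)[OF sd(1)[OF t t]]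
            sobolev_spaceD(2)[OF sd(2)[OF t t]]])
    then show "inner (Lambda (2 * s) (u' t) - Lambda (2 * s) (u t)) (cls (v' t) - cls (v t)) =
        inner (Lambda s (u' t) - Lambda s (u t)) (Lambda s (v' t) - Lambda s (v t))"
      unfolding LL cl(2)[OF t] Lambda_diff[OF mem(4)[OF t] mem(1)[OF t]] Lambda_diff[OF mem(5)[OF t] mem(2)[OF t]] .
    note ma = md[OF a'(1) mem(4)[OF t] mem(1)[OF t]] md[OF a'(1) mem(5)[OF t] mem(2)[OF t]]
    note mb = md[OF b'(1) mem(5)[OF t] mem(2)[OF t]]
    note sdt = sd(1)[OF t t] sd(2)[OF t t]
    show "inner (?M a' (v' t) - ?M a' (v t)) (cls (u' t) - cls (u t)) =
        inner (?M a' (u' t) - ?M a' (u t)) (cls (v' t) - cls (v t))"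
      unfolding ma[symmetric] cl[OF t, symmetric]
      by (rule inner_mult_sym) (intro sobolev_spaceD(1)[OF sdt(1)] sobolev_spaceD(1)[OF sdt(2)] mult[OF a'(1)] sdt)+
    show "0 \<le> inner (?M a' (u' t) - ?M a' (u t)) (cls (u' t) - cls (u t))"
      unfolding ma[symmetric] cl[OF t, symmetric]
      by (intro inner_mult_nonneg a'(2) sobolev_spaceD(1)[OF sdt(1)] mult[OF a'(1)] sdt)
    show "0 \<le> inner (?M b' (v' t) - ?M b' (v t)) (cls (v' t) - cls (v t))"
      unfolding mb[symmetric] cl[OF t, symmetric]
      by (intro inner_mult_nonneg b'(2) sobolev_spaceD(1)[OF sdt(2)] mult[OF b'(1)] sdt)
    have "?M a (u t) - ?M a' (u t) = cls (\<lambda>x. (a x - a' x) *\<^sub>R u t x)"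
      using cls_diff[OF mult[OF a mem(1)[OF t]] mult[OF a'(1) mem(1)[OF t]]] by (simp add: scaleR_diff_left)
    moreover have "?M b (v t) - ?M b' (v t) = cls (\<lambda>x. (b x - b' x) *\<^sub>R v t x)"
      using cls_diff[OF mult[OF b mem(2)[OF t]] mult[OF b'(1) mem(2)[OF t]]] by (simp add: scaleR_diff_left)
    ultimately show "norm (?F t) \<le> d"
      using forcing[OF t] norm_triangle_ineq[of "?M a (u t) - ?M a' (u t)" "?M b (v t) - ?M b' (v t)"] by simp
  qed (rule t)
  moreover have "0 \<in> {0..T}" using T by simp
  ultimately show ?thesis using md[OF a'(1) mem(4) mem(1), of 0 0] by (simp only:)
qed

theorem theorem4p2:
  fixes s T :: real
    and \<psi> a b :: "real ^ 'n \<Rightarrow> real"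
    and u0 u1 :: "real ^ 'n \<Rightarrow> complex"
    and ueps :: "real \<Rightarrow> real \<Rightarrow> real ^ 'n \<Rightarrow> complex"
    and u :: "real \<Rightarrow> real ^ 'n \<Rightarrow> complex"
  assumes "s > 0"
    and "real CARD('n) > 2 * s"
    and "T > 0"
    and "friedrichs_mollifier \<psi>"
    and "a \<in> Lp_space (real CARD('n) / s)"
    and "a \<in> Lp_space (real CARD('n) / (2 * s))"
    and "b \<in> Lp_space (real CARD('n) / s)"
    and "AE x in lborel. 0 \<le> a x"
    and "AE x in lborel. 0 \<le> b x"
    and "u0 \<in> sobolev_space (2 * s)"
    and "u1 \<in> sobolev_space s"
    and "\<And>\<epsilon>. \<epsilon> \<in> {0<..1} \<Longrightarrow>
      wave_solution s T
        (convolution a (mollifying_net \<psi> \<epsilon>)) (convolution b (mollifying_net \<psi> \<epsilon>))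
        (convolution u0 (mollifying_net \<psi> \<epsilon>)) (convolution u1 (mollifying_net \<psi> \<epsilon>))
        (ueps \<epsilon>)"
    and "wave_solution s T a b u0 u1 u"
  shows "\<forall>t\<in>{0..T}. tendsto_L2 (\<lambda>\<epsilon>. ueps \<epsilon> t) (u t) (at_right 0)"
proof -
  let ?d = "real DIM(real ^ 'n)"
  let ?p = "?d / s"
  have s: "0 < s" "2 * s < ?d" using assms(1,2) by simp_all
  have p: "1 \<le> ?p" using s by simp
  note T = assms(3) and \<psi> = assms(4)
  have a: "a \<in> Lp_space ?p" and b: "b \<in> Lp_space ?p" using assms(5,7) by simp_all
  have \<psi>0: "\<And>x. 0 \<le> \<psi> x" using \<psi> by (simp add: friedrichs_mollifier_def)
  have kernel: "mollifying_kernel \<psi>" by (rule friedrichs_mollifier_kernel[OF \<psi>])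
  let ?c = "\<lambda>f \<epsilon>. convolution f (mollifying_net \<psi> \<epsilon>)"
  have aL: "?c a \<epsilon> \<in> Lp_space ?p" and bL: "?c b \<epsilon> \<in> Lp_space ?p" if "\<epsilon> > 0" for \<epsilon>
    by (rule convolution_Lp[OF p a kernel that], rule convolution_Lp[OF p b kernel that])
  have a0: "0 \<le> ?c a \<epsilon> x" and b0: "0 \<le> ?c b \<epsilon> x" if "\<epsilon> > 0" for \<epsilon> x
    by (rule convolution_nonneg[OF assms(8) \<psi>0 that], rule convolution_nonneg[OF assms(9) \<psi>0 that])
  have u0: "u0 \<in> Lp_space 2" and u1: "u1 \<in> Lp_space 2"
    using assms(10,11) by (auto dest: sobolev_spaceD(1))
  obtain v where u: "continuous_in_sobolev (2 * s) T u" "C1_in_sobolev s T u v"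
      "\<forall>t\<in>{0..T}. ((\<lambda>t. cls (v t)) has_vector_derivative
        - (Lambda (2 * s) (u t) + cls (\<lambda>x. a x *\<^sub>R u t x) + cls (\<lambda>x. b x *\<^sub>R v t x))) (at t within {0..T})"
    and ic: "AE x in lborel. u 0 x = u0 x" "AE x in lborel. v 0 x = u1 x"
    using wave_solution_curve[OF s T \<psi> a b assms(13)] by (elim exE conjE)
  have "\<exists>v'. continuous_in_sobolev (2 * s) T (ueps \<epsilon>) \<and> C1_in_sobolev s T (ueps \<epsilon>) v' \<and>
      (AE x in lborel. ueps \<epsilon> 0 x = ?c u0 \<epsilon> x) \<and> (AE x in lborel. v' 0 x = ?c u1 \<epsilon> x) \<and>
      (\<forall>t\<in>{0..T}. ((\<lambda>t. cls (v' t)) has_vector_derivative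
        - (Lambda (2 * s) (ueps \<epsilon> t) + cls (\<lambda>x. ?c a \<epsilon> x *\<^sub>R ueps \<epsilon> t x) + cls (\<lambda>x. ?c b \<epsilon> x *\<^sub>R v' t x))) (at t within {0..T}))"
    if e: "\<epsilon> \<in> {0<..1}" for \<epsilon>
    by (rule wave_solution_curve[OF s T \<psi> aL bL assms(12)[OF e]]) (use e in simp_all)
  then have "\<forall>\<epsilon>\<in>{0<..1}. \<exists>v'. continuous_in_sobolev (2 * s) T (ueps \<epsilon>) \<and> C1_in_sobolev s T (ueps \<epsilon>) v' \<and>
      (AE x in lborel. ueps \<epsilon> 0 x = ?c u0 \<epsilon> x) \<and> (AE x in lborel. v' 0 x = ?c u1 \<epsilon> x) \<and>
      (\<forall>t\<in>{0..T}. ((\<lambda>t. cls (v' t)) has_vector_derivative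
        - (Lambda (2 * s) (ueps \<epsilon> t) + cls (\<lambda>x. ?c a \<epsilon> x *\<^sub>R ueps \<epsilon> t x) + cls (\<lambda>x. ?c b \<epsilon> x *\<^sub>R v' t x))) (at t within {0..T}))" by (rule ballI)
  from bchoice[OF this] obtain veps where V: "\<forall>\<epsilon>\<in>{0<..1}. continuous_in_sobolev (2 * s) T (ueps \<epsilon>) \<and> C1_in_sobolev s T (ueps \<epsilon>) (veps \<epsilon>) \<and>
      (AE x in lborel. ueps \<epsilon> 0 x = ?c u0 \<epsilon> x) \<and> (AE x in lborel. veps \<epsilon> 0 x = ?c u1 \<epsilon> x) \<and>
      (\<forall>t\<in>{0..T}. ((\<lambda>t. cls (veps \<epsilon> t)) has_vector_derivative
        - (Lambda (2 * s) (ueps \<epsilon> t) + cls (\<lambda>x. ?c a \<epsilon> x *\<^sub>R ueps \<epsilon> t x) + cls (\<lambda>x. ?c b \<epsilon> x *\<^sub>R veps \<epsilon> t x))) (at t within {0..T}))"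
    by (rule exE)
  note V = bspec[OF V]
  note ueps = V[THEN conjunct1] V[THEN conjunct2, THEN conjunct1]
    V[THEN conjunct2, THEN conjunct2, THEN conjunct2, THEN conjunct2]
  note iceps = V[THEN conjunct2, THEN conjunct2, THEN conjunct1]
    V[THEN conjunct2, THEN conjunct2, THEN conjunct2, THEN conjunct1]
  have cu: "continuous_in_sobolev s T u" and cv: "continuous_in_sobolev s T v"
    using u(2) by (simp_all add: C1_in_sobolev_def)
  have ce: "continuous_in_sobolev s T (ueps \<epsilon>)" "continuous_in_sobolev s T (veps \<epsilon>)" if "\<epsilon> \<in> {0<..1}" for \<epsilon>
    using ueps(2)[OF that] by (simp_all add: C1_in_sobolev_def)
  have T0: "0 \<in> {0..T}" using T by simp
  \<comment> \<open>The initial data: mollification commutes with the fractional Laplacian, so each of the three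
    norms is the distance of an element of \<open>L\<^sup>2\<close> to its mollification.\<close>
  define g0 where "g0 = frac_laplacian (s / 2) (u 0)"
  have u00: "u 0 \<in> sobolev_space s" by (rule continuous_in_sobolevD(1)[OF cu T0])
  have g0: "g0 \<in> Lp_space 2" "Lambda s (u 0) = cls g0"
    unfolding g0_def Lambda_def using sobolev_spaceD(3)[OF u00] by simp_all
  have init: "cls (ueps \<epsilon> 0) = cls (?c u0 \<epsilon>)" "cls (veps \<epsilon> 0) = cls (?c u1 \<epsilon>)" "Lambda s (ueps \<epsilon> 0) = cls (?c g0 \<epsilon>)"
    if e: "\<epsilon> \<in> {0<..1}" for \<epsilon>
  proof -
    have e0: "\<epsilon> > 0" using e by simp
    note m = continuous_in_sobolevD(1)[OF ce(1)[OF e] T0] continuous_in_sobolevD(1)[OF ce(2)[OF e] T0]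
    show 1: "cls (ueps \<epsilon> 0) = cls (?c u0 \<epsilon>)"
      using iceps(1)[OF e] cls_eq_iff[OF sobolev_spaceD(1)[OF m(1)] convolution_L2[OF u0 kernel e0]] by simp
    show "cls (veps \<epsilon> 0) = cls (?c u1 \<epsilon>)"
      using iceps(2)[OF e] cls_eq_iff[OF sobolev_spaceD(1)[OF m(2)] convolution_L2[OF u1 kernel e0]] by simp
    have "cls (?c (u 0) \<epsilon>) = cls (?c u0 \<epsilon>)"
    proof -
      have "cls (u 0) = cls u0" using ic(1) cls_eq_iff[OF sobolev_spaceD(1)[OF u00] u0] by simp
      then have "cls (\<lambda>x. u 0 x - u0 x) = 0" by (simp add: cls_diff sobolev_spaceD(1)[OF u00] u0)
      then have "norm (cls (?c (\<lambda>x. u 0 x - u0 x) \<epsilon>)) \<le> 0"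
        using norm_cls_convolution_le[OF L2_diff[OF sobolev_spaceD(1)[OF u00] u0] kernel e0] by simp
      then show ?thesis by (simp add: cls_convolution_diff[OF sobolev_spaceD(1)[OF u00] u0 kernel e0])
    qed
    then have "cls (ueps \<epsilon> 0) = cls (?c (u 0) \<epsilon>)" using 1 by simp
    from has_frac_laplacian_unique[OF sobolev_spaceD(2)[OF m(1)]
        has_frac_laplacian_convolution[OF sobolev_spaceD(2)[OF u00] kernel e0] this]
    show "Lambda s (ueps \<epsilon> 0) = cls (?c g0 \<epsilon>)" by (simp add: Lambda_def g0_def)
  qed
  have U0: "cls (u 0) = cls u0" using ic(1) cls_eq_iff[OF sobolev_spaceD(1)[OF u00] u0] by simp
  have V0: "cls (v 0) = cls u1"
    using ic(2) cls_eq_iff[OF sobolev_spaceD(1)[OF continuous_in_sobolevD(1)[OF cv T0]] u1] by simp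
  \<comment> \<open>The coefficients converge in \<open>L\<^sup>p\<close>. The added \<open>\<epsilon>\<close> keeps the bound on the difference of the coefficients positive.\<close>
  define \<alpha> where "\<alpha> \<epsilon> = (LINT x|lborel. norm (?c a \<epsilon> x - a x) powr ?p) + \<epsilon>" for \<epsilon>
  define \<beta> where "\<beta> \<epsilon> = (LINT x|lborel. norm (?c b \<epsilon> x - b x) powr ?p) + \<epsilon>" for \<epsilon>
  have "((\<lambda>\<epsilon>. (LINT x|lborel. norm (?c a \<epsilon> x - a x) powr ?p) + \<epsilon>) \<longlongrightarrow> 0 + 0) (at_right 0)"
    by (intro tendsto_add convolution_tendsto_Lp[OF p a kernel] tendsto_ident_at)
  then have \<alpha>: "(\<alpha> \<longlongrightarrow> 0) (at_right 0)" by (simp add: \<alpha>_def[abs_def])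
  have "((\<lambda>\<epsilon>. (LINT x|lborel. norm (?c b \<epsilon> x - b x) powr ?p) + \<epsilon>) \<longlongrightarrow> 0 + 0) (at_right 0)"
    by (intro tendsto_add convolution_tendsto_Lp[OF p b kernel] tendsto_ident_at)
  then have \<beta>: "(\<beta> \<longlongrightarrow> 0) (at_right 0)" by (simp add: \<beta>_def[abs_def])
  define \<gamma> where "\<gamma> = (LINT x|lborel. norm (a x) powr ?p) + 1"
  have "bounded ((\<lambda>t. Lambda s (u t)) ` {0..T})" "bounded ((\<lambda>t. Lambda s (v t)) ` {0..T})"
    by (intro compact_imp_bounded compact_continuous_image compact_Icc continuous_in_sobolevD(3)[OF cu],
        intro compact_imp_bounded compact_continuous_image compact_Icc continuous_in_sobolevD(3)[OF cv])
  then obtain M1 M2 where M: "\<forall>x\<in>(\<lambda>t. Lambda s (u t)) ` {0..T}. norm x \<le> M1" "\<forall>x\<in>(\<lambda>t. Lambda s (v t)) ` {0..T}. norm x \<le> M2"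
    unfolding bounded_iff by (elim exE)
  show ?thesis
  proof (rule multiplication_bound[OF s])
    fix K :: real
    assume K: "K > 0" and bound: "\<And>(c :: real ^ 'n \<Rightarrow> real) \<alpha> f g. c \<in> Lp_space ?p \<Longrightarrow> \<alpha> > 0 \<Longrightarrow>
        (LINT x|lborel. norm (c x) powr ?p) \<le> \<alpha> \<Longrightarrow> has_frac_laplacian (s / 2) f g \<Longrightarrow>
        (\<lambda>x. c x *\<^sub>R f x) \<in> Lp_space 2 \<and> norm (cls (\<lambda>x. c x *\<^sub>R f x)) \<le> K * \<alpha> powr (s / ?d) * norm (cls g)"
    have bd: "norm (cls (\<lambda>x. c x *\<^sub>R f x)) \<le> K * \<alpha> powr (s / ?d) * norm (Lambda s f)"
      if "c \<in> Lp_space ?p" "\<alpha> > 0" "(LINT x|lborel. norm (c x) powr ?p) \<le> \<alpha>" "f \<in> sobolev_space s"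
      for c :: "real ^ 'n \<Rightarrow> real" and \<alpha> f
      using bound[OF that(1-3) sobolev_spaceD(2)[OF that(4)]] by (simp add: Lambda_def)
    define d where "d \<epsilon> = K * \<alpha> \<epsilon> powr (s / ?d) * M1 + K * \<beta> \<epsilon> powr (s / ?d) * M2" for \<epsilon>
    define w where "w \<epsilon> = norm (cls (?c u0 \<epsilon>) - cls u0)" for \<epsilon>
    define z where "z \<epsilon> = norm (cls (?c g0 \<epsilon>) - cls g0)" for \<epsilon>
    define E where "E \<epsilon> = (norm (cls (?c u1 \<epsilon>) - cls u1))\<^sup>2 + (z \<epsilon>)\<^sup>2 + K * \<gamma> powr (s / ?d) * z \<epsilon> * w \<epsilon>" for \<epsilon>
    have estimate: "norm (cls (ueps \<epsilon> t) - cls (u t)) \<le> w \<epsilon> + T * sqrt (exp T * (E \<epsilon> + T * (d \<epsilon>)\<^sup>2))"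
      if e: "\<epsilon> \<in> {0<..1}" and t: "t \<in> {0..T}" for \<epsilon> t
    proof -
      have e0: "\<epsilon> > 0" using e by simp
      have pos: "\<alpha> \<epsilon> > 0" "\<beta> \<epsilon> > 0" unfolding \<alpha>_def \<beta>_def using e0 by (auto intro!: add_nonneg_pos)
      have p0: "0 \<le> ?p" using p by simp
      have da: "(\<lambda>x. a x - ?c a \<epsilon> x) \<in> Lp_space ?p" "(LINT x|lborel. norm (a x - ?c a \<epsilon> x) powr ?p) \<le> \<alpha> \<epsilon>"
        by (rule Lp_space_diff[OF p0 a aL[OF e0]], unfold \<alpha>_def norm_minus_commute[of "a _"], use e0 in simp)
      have db: "(\<lambda>x. b x - ?c b \<epsilon> x) \<in> Lp_space ?p" "(LINT x|lborel. norm (b x - ?c b \<epsilon> x) powr ?p) \<le> \<beta> \<epsilon>"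
        by (rule Lp_space_diff[OF p0 b bL[OF e0]], unfold \<beta>_def norm_minus_commute[of "b _"], use e0 in simp)
      have "norm (cls (ueps \<epsilon> t) - cls (u t)) \<le> norm (cls (ueps \<epsilon> 0) - cls (u 0)) +
        T * sqrt (exp T * ((norm (cls (veps \<epsilon> 0) - cls (v 0)))\<^sup>2 + (norm (Lambda s (ueps \<epsilon> 0) - Lambda s (u 0)))\<^sup>2 +
          inner (cls (\<lambda>x. ?c a \<epsilon> x *\<^sub>R (ueps \<epsilon> 0 x - u 0 x))) (cls (ueps \<epsilon> 0) - cls (u 0)) + T * (d \<epsilon>)\<^sup>2))"
      proof (rule wave_stability[OF s T aL[OF e0] a0[OF e0] bL[OF e0] b0[OF e0] a b u ueps[OF e] _ t])
        fix t assume t: "t \<in> {0..T}"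
        have "norm (cls (\<lambda>x. (a x - ?c a \<epsilon> x) *\<^sub>R u t x)) \<le> K * \<alpha> \<epsilon> powr (s / ?d) * norm (Lambda s (u t))"
          by (rule bd[OF da(1) pos(1) da(2) continuous_in_sobolevD(1)[OF cu t]])
        also have "\<dots> \<le> K * \<alpha> \<epsilon> powr (s / ?d) * M1"
          using K by (intro mult_left_mono bspec[OF M(1)] imageI t) simp
        finally have 1: "norm (cls (\<lambda>x. (a x - ?c a \<epsilon> x) *\<^sub>R u t x)) \<le> K * \<alpha> \<epsilon> powr (s / ?d) * M1" .
        have "norm (cls (\<lambda>x. (b x - ?c b \<epsilon> x) *\<^sub>R v t x)) \<le> K * \<beta> \<epsilon> powr (s / ?d) * norm (Lambda s (v t))"
          by (rule bd[OF db(1) pos(2) db(2) continuous_in_sobolevD(1)[OF cv t]])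
        also have "\<dots> \<le> K * \<beta> \<epsilon> powr (s / ?d) * M2"
          using K by (intro mult_left_mono bspec[OF M(2)] imageI t) simp
        finally show "norm (cls (\<lambda>x. (a x - ?c a \<epsilon> x) *\<^sub>R u t x)) + norm (cls (\<lambda>x. (b x - ?c b \<epsilon> x) *\<^sub>R v t x)) \<le> d \<epsilon>"
          unfolding d_def by (rule add_mono[OF 1])
      qed
      also have "\<dots> \<le> w \<epsilon> + T * sqrt (exp T * (E \<epsilon> + T * (d \<epsilon>)\<^sup>2))"
      proof -
        note i = init[OF e]
        have W: "norm (cls (ueps \<epsilon> 0) - cls (u 0)) = w \<epsilon>" by (simp only: i U0 w_def)
        have Z: "norm (Lambda s (ueps \<epsilon> 0) - Lambda s (u 0)) = z \<epsilon>" by (simp only: i g0 z_def)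
        have sd: "(\<lambda>x. ueps \<epsilon> 0 x - u 0 x) \<in> sobolev_space s"
          by (rule sobolev_diff[OF continuous_in_sobolevD(1)[OF ce(1)[OF e] T0] u00])
        have "0 \<le> (LINT x|lborel. norm (a x) powr ?p)" by simp
        then have g: "\<gamma> > 0" unfolding \<gamma>_def by linarith
        have "(LINT x|lborel. norm (?c a \<epsilon> x) powr ?p) \<le> \<gamma>"
          unfolding \<gamma>_def using convolution_Lp_le[OF p a kernel e0] by linarith
        from bd[OF aL[OF e0] g this sd]
        have "norm (cls (\<lambda>x. ?c a \<epsilon> x *\<^sub>R (ueps \<epsilon> 0 x - u 0 x))) \<le> K * \<gamma> powr (s / ?d) * z \<epsilon>"
          by (simp only: Lambda_diff[OF continuous_in_sobolevD(1)[OF ce(1)[OF e] T0] u00] Z)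
        then have "norm (cls (\<lambda>x. ?c a \<epsilon> x *\<^sub>R (ueps \<epsilon> 0 x - u 0 x))) * norm (cls (ueps \<epsilon> 0) - cls (u 0)) \<le>
            K * \<gamma> powr (s / ?d) * z \<epsilon> * w \<epsilon>"
          unfolding W by (rule mult_right_mono) (simp add: w_def)
        then have "inner (cls (\<lambda>x. ?c a \<epsilon> x *\<^sub>R (ueps \<epsilon> 0 x - u 0 x))) (cls (ueps \<epsilon> 0) - cls (u 0)) \<le>
            K * \<gamma> powr (s / ?d) * z \<epsilon> * w \<epsilon>"
          by (rule order_trans[OF norm_cauchy_schwarz])
        then show ?thesis
          unfolding W Z i(2) V0 E_def using T
          by (intro add_left_mono mult_left_mono real_sqrt_le_mono add_right_mono) simp_all
      qed
      finally show ?thesis .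
    qed
    have wz: "(w \<longlongrightarrow> 0) (at_right 0)" "(z \<longlongrightarrow> 0) (at_right 0)"
        "((\<lambda>\<epsilon>. norm (cls (?c u1 \<epsilon>) - cls u1)) \<longlongrightarrow> 0) (at_right 0)"
      unfolding w_def[abs_def] z_def[abs_def]
      by (intro tendsto_norm_zero LIM_zero cls_convolution_tendsto[OF _ kernel] u0 u1 g0)+
    have pw: "((\<lambda>\<epsilon>. X \<epsilon> powr (s / ?d)) \<longlongrightarrow> 0) (at_right 0)" if "(X \<longlongrightarrow> 0) (at_right 0)" "\<And>\<epsilon>. \<epsilon> > 0 \<Longrightarrow> X \<epsilon> \<ge> 0"
      for X :: "real \<Rightarrow> real"
      using tendsto_powr'[OF that(1) tendsto_const, of "s / ?d"] s
        eventually_mono[OF eventually_at_right_less[of 0], of "\<lambda>\<epsilon>. 0 \<le> X \<epsilon>"] that(2) by simp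
    have "(d \<longlongrightarrow> K * 0 * M1 + K * 0 * M2) (at_right 0)"
      unfolding d_def[abs_def]
      by (intro tendsto_intros pw \<alpha> \<beta>) (auto simp: \<alpha>_def \<beta>_def intro!: add_nonneg_nonneg)
    then have d: "(d \<longlongrightarrow> 0) (at_right 0)" by simp
    have "(E \<longlongrightarrow> 0\<^sup>2 + 0\<^sup>2 + K * \<gamma> powr (s / ?d) * 0 * 0) (at_right 0)"
      unfolding E_def[abs_def] by (intro tendsto_intros wz)
    then have "((\<lambda>\<epsilon>. w \<epsilon> + T * sqrt (exp T * (E \<epsilon> + T * (d \<epsilon>)\<^sup>2))) \<longlongrightarrow>
        0 + T * sqrt (exp T * ((0\<^sup>2 + 0\<^sup>2 + K * \<gamma> powr (s / ?d) * 0 * 0) + T * 0\<^sup>2))) (at_right 0)"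
      by (intro tendsto_intros wz d)
    then have lim: "((\<lambda>\<epsilon>. w \<epsilon> + T * sqrt (exp T * (E \<epsilon> + T * (d \<epsilon>)\<^sup>2))) \<longlongrightarrow> 0) (at_right 0)" by simp
    have ev: "\<forall>\<^sub>F \<epsilon> in at_right 0. \<epsilon> \<in> {0<..1::real}"
      by (simp add: eventually_at_right_field) (intro exI[of _ 1], simp)
    show ?thesis
    proof
      fix t assume t: "t \<in> {0..T}"
      have "((\<lambda>\<epsilon>. norm (cls (ueps \<epsilon> t) - cls (u t))) \<longlongrightarrow> 0) (at_right 0)"
        by (rule tendsto_sandwich[OF _ _ tendsto_const lim])
           (simp, rule eventually_mono[OF ev], rule estimate[OF _ t])
      then have "((\<lambda>\<epsilon>. cls (ueps \<epsilon> t)) \<longlongrightarrow> cls (u t)) (at_right 0)"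
        by (simp add: tendsto_norm_zero_iff LIM_zero_iff)
      moreover have "\<forall>\<^sub>F \<epsilon> in at_right 0. ueps \<epsilon> t \<in> Lp_space 2"
        by (rule eventually_mono[OF ev]) (rule sobolev_spaceD(1)[OF continuous_in_sobolevD(1)[OF ce(1) t]])
      moreover have "u t \<in> Lp_space 2" by (rule sobolev_spaceD(1)[OF continuous_in_sobolevD(1)[OF cu t]])
      ultimately show "tendsto_L2 (\<lambda>\<epsilon>. ueps \<epsilon> t) (u t) (at_right 0)" unfolding tendsto_L2_iff by (intro conjI)
    qed
  qed
qed


end
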